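(* Let $G(s)$ and $\bar G(s)$ be $m\times m$ transfer function matrices. Suppose that $G(s)$ is strictly proper and negative imaginary (NI) with $G_2\neq 0$, and that $\bar G(s)$ is strictly negative imaginary (SNI). Let $G_0,G_1,G_2,J,F,N_f$ be the matrices defined in the context, and suppose that $F^{T}\bar G(0)F$ is non-singular. (a) If $N_f$ is positive semidefinite, then the positive-feedback interconnection $[G(s),\bar G(s)]$ is internally stable if and only if both $$F^{T}\bar G(0)F<0$$ and $$I-N_f^{1/2}G_0N_f^{1/2}-N_f^{1/2}G_1J(J^TJ)^{-2}J^TG_1^TN_f^{1/2}>0 .$$ (b) If $N_f$ is negative semidefinite, then, with $\tilde N_f=(-N_f)^{1/2}$, the positive-feedback interconnection $[G(s),\bar G(s)]$ is internally stable if and only if both $$F^{T}\bar G(0)F<0$$ and $$\det\left(I+\tilde N_fG_0\tilde N_f+\tilde N_fG_1J(J^TJ)^{-2}J^TG_1^T\tilde N_f\right)\neq 0 .$$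
   Context: Conventions. Transfer function matrices are square, real, rational and proper, $G(s)=C(sI-A)^{-1}B+D$ with real $A,B,C,D$; $G$ is strictly proper if $G(\infty)=D=0$. $M^*$ is the conjugate transpose; $>0,\ \ge 0,\ <0$ denote (Hermitian/symmetric) positive definiteness, positive semidefiniteness, negative definiteness; $(\cdot)^{1/2}$ is the positive semidefinite square root of a positive semidefinite matrix. NI. A square $G(s)$ is NI if: (1) $G(s)$ has no pole in $\mathrm{Re}[s]>0$; (2) for all $\omega>0$ such that $j\omega$ is not a pole of $G(s)$, $j(G(j\omega)-G(j\omega)^* )\ge 0$; (3) if $s=j\omega_0$ with $\omega_0>0$ is a pole of $G(s)$, it is a simple pole and $K=\lim_{s\to j\omega_0}(s-j\omega_0)jG(s)$ is Hermitian and positive semidefinite; (4) if $s=0$ is a pole of $G(s)$, then $\lim_{s\to0}s^kG(s)=0$ for all $k\ge 3$ and $\lim_{s\to 0}s^2G(s)$ is Hermitian and positive semidefinite. SNI. A square $\bar G(s)$ is SNI if it has no pole in $\mathrm{Re}[s]\ge 0$ and $j(\bar G(j\omega)-\bar G(j\omega)^* )>0$ for all $\omega>0$. Internal stability. Let $G$ have minimal realization $(A,B,C,D)$ and $\bar G$ minimal realization $(\bar A,\bar B,\bar C,\bar D)$ with $I-D\bar D$ nonsingular. The positive feedback interconnection $[G(s),\bar G(s)]$ is internally stable if $$\breve A=\begin{bmatrix}A+B\bar D(I-D\bar D)^{-1}C & B\bar C+B\bar D(I-D\bar D)^{-1}D\bar C \\ \bar B(I-D\bar D)^{-1}C & \bar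 A+\bar B(I-D\bar D)^{-1}D\bar C\end{bmatrix}$$ is Hurwitz (all eigenvalues in the open left half plane). Matrices attached to an NI $G$: $G_2=\lim_{s\to0}s^2G(s)$, $G_1=\lim_{s\to0}s\left(G(s)-\frac{G_2}{s^2}\right)$, $G_0=\lim_{s\to0}\left(G(s)-\frac{G_2}{s^2}-\frac{G_1}{s}\right)$. Since $G_2\ge0$ and $G_2\ne0$, write $G_2=JJ^T$ with $J$ real of full column rank. Definition of $F$. Let $\Gamma=\begin{bmatrix}G_1 & G_2 \\ G_2 & 0\end{bmatrix}\in\mathbb R^{2m\times 2m}$ (nonzero), with singular value decomposition $\Gamma=\begin{bmatrix}H_1 & H_2\end{bmatrix}\begin{bmatrix}S & 0 \\ 0 & 0\end{bmatrix}\begin{bmatrix}V_1^T \\ V_2^T\end{bmatrix}=H_1SV_1^T=UV_1^T$, where $[H_1\ H_2]$ and $[V_1\ V_2]$ are orthogonal, $S>0$ is $\tilde n\times\tilde n$, and $U=H_1S=\begin{bmatrix}U_1 \\ U_2\end{bmatrix}$ with $U_1,U_2\in\mathbb R^{m\times\tilde n}$. Take a singular value decomposition $U_1^TU_2=\hat U\begin{bmatrix}S_1 & 0 \\ 0 & 0\end{bmatrix}\begin{bmatrix}\hat V_1^T \\ \hat V_2^T\end{bmatrix}$ with $\hat U$ and $\hat V=[\hat V_1\ \hat V_2]$ orthogonal $\tilde n\times\tilde n$, $S_1>0$, $\hat V_2\in\mathbb R^{\tilde n\times\check n}$. Set $F=U_1\hat V_2\in\mathbb R^{m\times\check n}$.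 For $X\in\mathbb R^{m\times m}$ and $Y$ with $m$ rows such that $\det(Y^TXY)\ne0$, $\mathcal P(X,Y)=X-XY(Y^TXY)^{-1}Y^TX$. Set $N_f=\mathcal P(\bar G(0),F)$. *)

theory Defs
  imports
    "HOL-Complex_Analysis.Complex_Singularities"
    "Jordan_Normal_Form.Schur_Decomposition"
    "Jordan_Normal_Form.Gauss_Jordan_Elimination"
    "Jordan_Normal_Form.DL_Rank"
begin

section \<open>Matrices\<close>

text \<open>Only used for nonsingular matrices; unspecified otherwise.\<close>

definition mat_inv :: "'a::field mat \<Rightarrow> 'a mat" where
  "mat_inv M = the (mat_inverse M)"

abbreviation cmat :: "real mat \<Rightarrow> complex mat" where
  "cmat \<equiv> map_mat complex_of_real"

definition hermitian :: "'a::conjugatable_field mat \<Rightarrow> bool" where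
  "hermitian M \<longleftrightarrow> square_mat M \<and> mat_adjoint M = M"

text \<open>On \<^typ>\<open>real\<close>, conjugation is the identity, so the following two notions are
  those for real symmetric matrices. On \<^typ>\<open>complex\<close>, \<open>0 \<le> z\<close> and \<open>0 < z\<close> also say that
  \<open>z\<close> is real. The scalar \<open>(M *\<^sub>v v) \<bullet>c v\<close> is $v^* M v$.\<close>

definition pos_semidef :: "'a::conjugatable_ordered_field mat \<Rightarrow> bool" where
  "pos_semidef M \<longleftrightarrow> hermitian M \<and> (\<forall>v \<in> carrier_vec (dim_row M). 0 \<le> (M *\<^sub>v v) \<bullet>c v)"

definition pos_def :: "'a::conjugatable_ordered_field mat \<Rightarrow> bool" where
  "pos_def M \<longleftrightarrow> hermitian M \<and>
     (\<forall>v \<in> carrier_vec (dim_row M). v \<noteq> 0\<^sub>v (dim_row M) \<longrightarrow> 0 < (M *\<^sub>v v) \<bullet>c v)"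

abbreviation neg_semidef :: "'a::conjugatable_ordered_field mat \<Rightarrow> bool" where
  "neg_semidef M \<equiv> pos_semidef (- M)"

abbreviation neg_def :: "'a::conjugatable_ordered_field mat \<Rightarrow> bool" where
  "neg_def M \<equiv> pos_def (- M)"

definition is_psd_sqrt :: "real mat \<Rightarrow> real mat \<Rightarrow> bool" where
  "is_psd_sqrt R M \<longleftrightarrow> R \<in> carrier_mat (dim_row M) (dim_col M) \<and> pos_semidef R \<and> R * R = M"

definition hurwitz :: "real mat \<Rightarrow> bool" where
  "hurwitz M \<longleftrightarrow> (\<forall>z. eigenvalue (cmat M) z \<longrightarrow> Re z < 0)"

definition hcat :: "'a::zero mat \<Rightarrow> 'a mat \<Rightarrow> 'a mat" where
  "hcat X Y = four_block_mat X Y (0\<^sub>m 0 (dim_col X)) (0\<^sub>m 0 (dim_col Y))"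

text \<open>The library's \<^const>\<open>orthogonal_mat\<close> does not normalise the columns.\<close>

definition orthonormal_mat :: "nat \<Rightarrow> real mat \<Rightarrow> bool" where
  "orthonormal_mat n Q \<longleftrightarrow> Q \<in> carrier_mat n n \<and> Q\<^sup>T * Q = 1\<^sub>m n"

text \<open>Singular value decomposition of a \<open>p \<times> q\<close> matrix of rank \<open>k\<close>. The order of the singular
  values on the diagonal of \<open>S\<close> is left free.\<close>

definition is_svd ::
  "nat \<Rightarrow> nat \<Rightarrow> nat \<Rightarrow> real mat \<Rightarrow> real mat \<Rightarrow> real mat \<Rightarrow> real mat \<Rightarrow> real mat \<Rightarrow> real mat \<Rightarrow> bool"
where
  "is_svd p q k M H1 H2 S V1 V2 \<longleftrightarrow>
     M \<in> carrier_mat p q \<and> k \<le> p \<and> k \<le> q \<and>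
     H1 \<in> carrier_mat p k \<and> H2 \<in> carrier_mat p (p - k) \<and>
     V1 \<in> carrier_mat q k \<and> V2 \<in> carrier_mat q (q - k) \<and>
     orthonormal_mat p (hcat H1 H2) \<and> orthonormal_mat q (hcat V1 V2) \<and>
     S \<in> carrier_mat k k \<and> diagonal_mat S \<and> (\<forall>i<k. 0 < S $$ (i,i)) \<and>
     M = hcat H1 H2 *
         four_block_mat S (0\<^sub>m k (q - k)) (0\<^sub>m (p - k) k) (0\<^sub>m (p - k) (q - k)) *
         (hcat V1 V2)\<^sup>T"

definition proj_compl :: "real mat \<Rightarrow> real mat \<Rightarrow> real mat" where
  "proj_compl X Y = X - X * Y * mat_inv (Y\<^sup>T * X * Y) * Y\<^sup>T * X"


section \<open>Transfer function matrices and realizations\<close>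

text \<open>As the fraction is in lowest terms, the roots of \<open>q\<close> are exactly the poles of \<open>f\<close>; there
  the value of \<open>f\<close> is \<open>0\<close> by the convention on division and plays no role.\<close>

definition proper_real_rational :: "(complex \<Rightarrow> complex) \<Rightarrow> bool" where
  "proper_real_rational f \<longleftrightarrow> (\<exists>p q :: real poly. q \<noteq> 0 \<and> coprime p q \<and> degree p \<le> degree q \<and>
     (\<forall>s. f s = poly (map_poly complex_of_real p) s / poly (map_poly complex_of_real q) s))"

definition transfer_function_matrix :: "nat \<Rightarrow> (complex \<Rightarrow> complex mat) \<Rightarrow> bool" where
  "transfer_function_matrix m G \<longleftrightarrow> (\<forall>s. G s \<in> carrier_mat m m) \<and>
     (\<forall>i<m. \<forall>j<m. proper_real_rational (\<lambda>s. G s $$ (i,j)))"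

definition mat_tendsto ::
  "(complex \<Rightarrow> complex mat) \<Rightarrow> complex mat \<Rightarrow> complex filter \<Rightarrow> bool" where
  "mat_tendsto G L Z \<longleftrightarrow>
     (\<forall>i<dim_row L. \<forall>j<dim_col L. ((\<lambda>s. G s $$ (i,j)) \<longlongrightarrow> L $$ (i,j)) Z)"

definition strictly_proper :: "nat \<Rightarrow> (complex \<Rightarrow> complex mat) \<Rightarrow> bool" where
  "strictly_proper m G \<longleftrightarrow> mat_tendsto G (0\<^sub>m m m) at_infinity"

text \<open>\<open>G s = C (s I - A)\<^sup>-\<^sup>1 B + D\<close> as rational functions, with state dimension \<open>n\<close>. Eigenvalues
  of \<open>A\<close> are excluded because they need not be poles of \<open>G\<close> when \<open>n\<close> is not minimal.\<close>

definition realization ::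
  "nat \<Rightarrow> nat \<Rightarrow> real mat \<Rightarrow> real mat \<Rightarrow> real mat \<Rightarrow> real mat \<Rightarrow> (complex \<Rightarrow> complex mat) \<Rightarrow> bool"
where
  "realization m n A B C D G \<longleftrightarrow>
     A \<in> carrier_mat n n \<and> B \<in> carrier_mat n m \<and> C \<in> carrier_mat m n \<and> D \<in> carrier_mat m m \<and>
     (\<forall>s. det (s \<cdot>\<^sub>m 1\<^sub>m n - cmat A) \<noteq> 0 \<longrightarrow>
        G s = cmat C * mat_inv (s \<cdot>\<^sub>m 1\<^sub>m n - cmat A) * cmat B + cmat D)"

definition minimal_realization ::
  "nat \<Rightarrow> nat \<Rightarrow> real mat \<Rightarrow> real mat \<Rightarrow> real mat \<Rightarrow> real mat \<Rightarrow> (complex \<Rightarrow> complex mat) \<Rightarrow> bool"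
where
  "minimal_realization m n A B C D G \<longleftrightarrow> realization m n A B C D G \<and>
     (\<forall>n' A' B' C' D'. realization m n' A' B' C' D' G \<longrightarrow> n \<le> n')"

definition closed_loop_matrix ::
  "real mat \<Rightarrow> real mat \<Rightarrow> real mat \<Rightarrow> real mat \<Rightarrow>
   real mat \<Rightarrow> real mat \<Rightarrow> real mat \<Rightarrow> real mat \<Rightarrow> real mat"
where
  "closed_loop_matrix A B C D A' B' C' D' =
     (let E = mat_inv (1\<^sub>m (dim_row D) - D * D') in
      four_block_mat
        (A + B * D' * E * C)   (B * C' + B * D' * E * D * C')
        (B' * E * C)           (A' + B' * E * D * C'))"

text \<open>Internal stability of the positive feedback interconnection, in terms of minimal
  realizations \<open>(A, B, C, D)\<close> and \<open>(A', B', C', D')\<close> of the two transfer function matrices.\<close>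

definition internally_stable ::
  "real mat \<Rightarrow> real mat \<Rightarrow> real mat \<Rightarrow> real mat \<Rightarrow>
   real mat \<Rightarrow> real mat \<Rightarrow> real mat \<Rightarrow> real mat \<Rightarrow> bool"
where
  "internally_stable A B C D A' B' C' D' \<longleftrightarrow>
     det (1\<^sub>m (dim_row D) - D * D') \<noteq> 0 \<and> hurwitz (closed_loop_matrix A B C D A' B' C' D')"


section \<open>Negative imaginary systems\<close>

definition mat_pole :: "nat \<Rightarrow> (complex \<Rightarrow> complex mat) \<Rightarrow> complex \<Rightarrow> bool" where
  "mat_pole m G z \<longleftrightarrow> (\<exists>i<m. \<exists>j<m. is_pole (\<lambda>s. G s $$ (i,j)) z)"

definition simple_mat_pole :: "nat \<Rightarrow> (complex \<Rightarrow> complex mat) \<Rightarrow> complex \<Rightarrow> bool" where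
  "simple_mat_pole m G z \<longleftrightarrow> mat_pole m G z \<and>
     (\<forall>i<m. \<forall>j<m. is_pole (\<lambda>s. G s $$ (i,j)) z \<longrightarrow> zorder (\<lambda>s. G s $$ (i,j)) z = - 1)"

definition negative_imaginary :: "nat \<Rightarrow> (complex \<Rightarrow> complex mat) \<Rightarrow> bool" where
  "negative_imaginary m G \<longleftrightarrow>
     (\<forall>s. Re s > 0 \<longrightarrow> \<not> mat_pole m G s) \<and>
     (\<forall>\<omega>::real. \<omega> > 0 \<longrightarrow> \<not> mat_pole m G (\<i> * of_real \<omega>) \<longrightarrow>
        pos_semidef (\<i> \<cdot>\<^sub>m (G (\<i> * of_real \<omega>) - mat_adjoint (G (\<i> * of_real \<omega>))))) \<and>
     (\<forall>\<omega>::real. \<omega> > 0 \<longrightarrow> mat_pole m G (\<i> * of_real \<omega>) \<longrightarrow>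
        simple_mat_pole m G (\<i> * of_real \<omega>) \<and>
        (\<exists>K \<in> carrier_mat m m.
           mat_tendsto (\<lambda>s. ((s - \<i> * of_real \<omega>) * \<i>) \<cdot>\<^sub>m G s) K (at (\<i> * of_real \<omega>)) \<and>
           pos_semidef K)) \<and>
     (mat_pole m G 0 \<longrightarrow>
        (\<forall>k\<ge>3. mat_tendsto (\<lambda>s. s ^ k \<cdot>\<^sub>m G s) (0\<^sub>m m m) (at 0)) \<and>
        (\<exists>K \<in> carrier_mat m m. mat_tendsto (\<lambda>s. s\<^sup>2 \<cdot>\<^sub>m G s) K (at 0) \<and> pos_semidef K))"

definition strictly_negative_imaginary :: "nat \<Rightarrow> (complex \<Rightarrow> complex mat) \<Rightarrow> bool" where
  "strictly_negative_imaginary m G \<longleftrightarrow>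
     (\<forall>s. Re s \<ge> 0 \<longrightarrow> \<not> mat_pole m G s) \<and>
     (\<forall>\<omega>::real. \<omega> > 0 \<longrightarrow>
        pos_def (\<i> \<cdot>\<^sub>m (G (\<i> * of_real \<omega>) - mat_adjoint (G (\<i> * of_real \<omega>)))))"

text \<open>The matrices \<open>G\<^sub>2\<close>, \<open>G\<^sub>1\<close>, \<open>G\<^sub>0\<close> are real because \<open>G\<close> has real coefficients.\<close>

definition laurent_matrices ::
  "nat \<Rightarrow> (complex \<Rightarrow> complex mat) \<Rightarrow> real mat \<Rightarrow> real mat \<Rightarrow> real mat \<Rightarrow> bool" where
  "laurent_matrices m G G0 G1 G2 \<longleftrightarrow>
     G0 \<in> carrier_mat m m \<and> G1 \<in> carrier_mat m m \<and> G2 \<in> carrier_mat m m \<and>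
     mat_tendsto (\<lambda>s. s\<^sup>2 \<cdot>\<^sub>m G s) (cmat G2) (at 0) \<and>
     mat_tendsto (\<lambda>s. s \<cdot>\<^sub>m (G s - (1 / s\<^sup>2) \<cdot>\<^sub>m cmat G2)) (cmat G1) (at 0) \<and>
     mat_tendsto (\<lambda>s. G s - (1 / s\<^sup>2) \<cdot>\<^sub>m cmat G2 - (1 / s) \<cdot>\<^sub>m cmat G1) (cmat G0) (at 0)"

definition full_rank_factor :: "nat \<Rightarrow> real mat \<Rightarrow> real mat \<Rightarrow> bool" where
  "full_rank_factor m G2 J \<longleftrightarrow>
     dim_row J = m \<and> vec_space.rank m J = dim_col J \<and> G2 = J * J\<^sup>T"

text \<open>\<open>F\<close> depends on the choice of the two singular value decompositions; the relation holds for
  every matrix arising from some choice. Here \<open>k\<close> is the rank of \<open>\<Gamma>\<close> and \<open>l\<close> that of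
  \<open>U1\<^sup>T U2\<close>, so that \<open>F\<close> has \<open>k - l\<close> columns.\<close>

definition is_F_matrix :: "nat \<Rightarrow> real mat \<Rightarrow> real mat \<Rightarrow> real mat \<Rightarrow> bool" where
  "is_F_matrix m G1 G2 F \<longleftrightarrow>
     (\<exists>k l H1 H2 S V1 V2 U1 U2 W1 W2 S1 X1 X2.
        is_svd (2 * m) (2 * m) k (four_block_mat G1 G2 G2 (0\<^sub>m m m)) H1 H2 S V1 V2 \<and>
        U1 \<in> carrier_mat m k \<and> U2 \<in> carrier_mat m k \<and> H1 * S = U1 @\<^sub>r U2 \<and>
        is_svd k k l (U1\<^sup>T * U2) W1 W2 S1 X1 X2 \<and>
        F = U1 * X2)"

text \<open>For \<open>G\<close> with real coefficients and no pole at \<open>0\<close>, \<open>G 0\<close> is real; this is \<open>G 0\<close> as a real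
  matrix.\<close>

definition dc_gain :: "(complex \<Rightarrow> complex mat) \<Rightarrow> real mat" where
  "dc_gain G = map_mat Re (G 0)"

end

(*
Multiplication by s turns the strictly proper NI function G into a positive real function, and
(M - G')/s with M = G'(0) is strictly positive real; both follow from the minimum principle for the
real part. If (s, x) is an eigenpair of the closed loop, with input y and output u of G, this gives
  Re (s * y^* u) >= 0  and  y = G'(s) u,
which is impossible on the imaginary axis except at 0.

Near 0 the Laurent expansion of G is accretive, so that for y orthogonal to the range of F the
vectors G(t) (y + t y1 + t^2 y2) converge to S y + f, where
  S = G0 + G1 G2^+ G1^T,  G2^+ = J (J^T J)^(-2) J^T,
and f runs through the range of F = {G2 a + G1 b | G2 b = 0}. On the orthogonal complement of this
range, S is Hermitian and positive semidefinite.

Stability is equivalent to y^T S y >= v^T M v for all v = S y + f, together with nondegeneracy.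
  Necessity: if the closed loop is stable, then s T(s) is positive real for its transfer function
    T = (I - G G')^(-1) G, and T(0) inherits positivity.
  Sufficiency: for the regularization G + e I, a Schwarz-Pick estimate between s and 0 bounds
    Re (y^* u / s) from below by Re (1/s) times the limit form at 0, which excludes eigenvalues in
    the open right half plane.
Eliminating f by completing the square replaces M by Nf, which gives the stated criteria. In (b)
the determinant never vanishes, because S is positive semidefinite where it matters.
*)
theory Submission
  imports Defs "HOL-Complex_Analysis.Conformal_Mappings" "HOL-Computational_Algebra.Field_as_Ring"
    "HOL-Library.Function_Algebras"
begin

section \<open>Positive real functions on the right half plane\<close>

text \<open>A closed-loop eigenvalue may be a pole of \<open>G\<close> on the imaginary axis, and
  there no matrix relates input and output of \<open>G\<close>. The argument therefore works with
  state equations, and an input-output pair at \<open>s\<close> is obtained as a limit of pairs at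
  \<open>s + t\<close> with small \<open>t > 0\<close>. Minimality enters only here and in the
  exclusion of \<open>u = 0\<close>, through the eigenvector tests for controllability and
  observability. At the origin the place of the matrix is taken by a linear relation, defined on a
  subspace and multivalued by the range of \<open>F\<close>. Schwarz-Pick is applied to an inverse,
  which neither \<open>G\<close> nor this relation need possess. With \<open>e > 0\<close> the
  inverse exists, and it converges at the origin because the relation is maximal monotone;
  \<open>e\<close> goes to 0 only in the final inequality. Singular value decompositions and
  inverses of Gram matrices are confined to the passage from the given matrices to abstract data:
  the range of \<open>F\<close>, a few identities for the pseudo-inverse, and an orthogonality
  property of the Schur complement.\<close>

lemma re_lower_bound_at_imaginary_point:
  fixes f :: "complex \<Rightarrow> complex" and r :: real
  assumes p: "Re p = 0" and r: "0 \<le> r" and e: "e > 0" and hol: "f holomorphic_on (ball p e - {p})"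
    and lim: "((\<lambda>s. (s - p) * f s) \<longlongrightarrow> of_real r) (at p)"
    and axis: "\<forall>\<^sub>F x in at (0::real). 0 \<le> Re (f (p + \<i> * of_real x))"
    and \<eta>: "\<eta> > 0"
  shows "\<forall>\<^sub>F s in at p. 0 < Re s \<longrightarrow> - \<eta> < Re (f s)"
proof -
  \<comment> \<open>The principal part \<open>r / (s - p)\<close> has zero real part on the
    imaginary axis and nonnegative real part to the right of it. Once it is subtracted the
    singularity is removable, so the sign on the axis passes to the value of the extension at
    \<open>p\<close>, and from there to a neighbourhood up to \<open>\<eta>\<close>.\<close>
  have "(\<lambda>s. f s - of_real r / (s - p)) holomorphic_on (ball p e - {p})"
    by (intro holomorphic_intros hol) auto
  moreover have "((\<lambda>s. (s - p) * (f s - of_real r / (s - p))) \<longlongrightarrow> 0) (at p)"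
  proof -
    have "((\<lambda>s. (s - p) * f s - of_real r) \<longlongrightarrow> of_real r - of_real r) (at p)"
      by (intro tendsto_intros lim)
    moreover have "\<forall>\<^sub>F s in at p. (s - p) * f s - of_real r = (s - p) * (f s - of_real r / (s - p))"
      by (auto simp: eventually_at_filter field_simps)
    ultimately show ?thesis by (simp add: Lim_transform_eventually)
  qed
  moreover have "p \<in> interior (ball p e)" using e by simp
  ultimately obtain g where g: "g holomorphic_on ball p e"
    and gf: "\<And>s. s \<in> ball p e - {p} \<Longrightarrow> g s = f s - of_real r / (s - p)"
    using holomorphic_on_extend_lim[of "\<lambda>s. f s - of_real r / (s - p)" "ball p e" p] by auto
  have cont: "isCont g p"
    by (rule continuous_on_interior[OF holomorphic_on_imp_continuous_on[OF g]]) (use e in simp)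
  have near: "\<forall>\<^sub>F s in at p. s \<in> ball p e - {p}"
    using e by (auto simp: eventually_at dist_commute intro!: exI[of _ e])
  have path: "filterlim (\<lambda>x. p + \<i> * of_real x) (at p) (at (0::real))"
    unfolding filterlim_at by (auto intro!: tendsto_eq_intros simp: eventually_at_filter)
  have "((\<lambda>x. Re (g (p + \<i> * of_real x))) \<longlongrightarrow> Re (g p)) (at (0::real))"
    by (intro tendsto_intros) (use cont path in \<open>auto simp: isCont_def intro: filterlim_compose\<close>)
  moreover have "\<forall>\<^sub>F x in at (0::real). 0 \<le> Re (g (p + \<i> * of_real x))"
    using axis filterlim_iff[THEN iffD1, OF path, rule_format, OF near]
  proof eventually_elim
    case (elim x)
    have "Re (of_real r / (\<i> * of_real x)) = 0" by (cases "x = 0") (simp_all add: Re_divide)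
    then show ?case using gf[OF elim(2)] elim(1) by simp
  qed
  ultimately have "0 \<le> Re (g p)"
    by (metis tendsto_lowerbound trivial_limit_at)
  moreover have "((\<lambda>s. Re (g s)) \<longlongrightarrow> Re (g p)) (at p)"
    using cont by (auto simp: isCont_def intro: tendsto_intros)
  ultimately have "\<forall>\<^sub>F s in at p. - \<eta> < Re (g s)"
    using \<eta> by (intro order_tendstoD) auto
  then show ?thesis using near
  proof eventually_elim
    case (elim s)
    show ?case
    proof
      assume "0 < Re s"
      then have "0 \<le> Re (of_real r / (s - p))" using r p by (simp add: Re_divide)
      then show "- \<eta> < Re (f s)" using gf[OF elim(2)] elim(1) by simp
    qed
  qed
qed

text \<open>Inversion preserves the right half plane and the imaginary axis and carries infinity to
  0. The growth condition becomes \<open>z * f (1 / z)\<close> tending to 0, which is the local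
  estimate with residue 0.\<close>

lemma re_lower_bound_at_infinity:
  fixes f :: "complex \<Rightarrow> complex"
  assumes K: "K > 0" and hol: "f holomorphic_on {s. norm s > K}"
    and lim: "((\<lambda>s. f s / s) \<longlongrightarrow> 0) at_infinity"
    and axis: "\<And>x. \<bar>x\<bar> > K \<Longrightarrow> 0 \<le> Re (f (\<i> * of_real x))"
    and \<eta>: "\<eta> > 0"
  shows "\<exists>K'>0. \<forall>s. 0 < Re s \<longrightarrow> norm s > K' \<longrightarrow> - \<eta> < Re (f s)"
proof -
  let ?h = "\<lambda>z. f (inverse z)"
  have K': "norm (inverse z) > K" if "z \<noteq> 0" "norm z < inverse K" for z :: complex
    using that K less_imp_inverse_less[of "norm z" "inverse K"] by (simp add: norm_inverse)
  have "?h holomorphic_on (ball 0 (inverse K) - {0})"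
  proof -
    have "(f \<circ> inverse) holomorphic_on (ball 0 (inverse K) - {0})"
      by (rule holomorphic_on_compose_gen[OF _ hol]) (use K' in \<open>auto intro!: holomorphic_intros\<close>)
    then show ?thesis by (simp add: o_def)
  qed
  moreover have "((\<lambda>z. (z - 0) * ?h z) \<longlongrightarrow> of_real 0) (at 0)"
    using filterlim_compose[OF lim filterlim_inverse_at_infinity] by (simp add: field_simps)
  moreover have "\<forall>\<^sub>F x in at (0::real). 0 \<le> Re (?h (0 + \<i> * of_real x))"
    unfolding eventually_at
  proof (intro exI[of _ "inverse K"] conjI ballI impI)
    fix x :: real assume x: "x \<noteq> 0 \<and> dist x 0 < inverse K"
    have "inverse (\<i> * of_real x) = \<i> * of_real (- inverse x)"
      by (simp add: inverse_mult_distrib)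
    moreover have "\<bar>- inverse x\<bar> > K"
      using x K less_imp_inverse_less[of "\<bar>x\<bar>" "inverse K"] by (simp add: dist_real_def)
    ultimately show "0 \<le> Re (?h (0 + \<i> * of_real x))" using axis[of "- inverse x"] by simp
  qed (use K in auto)
  ultimately have "\<forall>\<^sub>F z in at 0. 0 < Re z \<longrightarrow> - \<eta> < Re (?h z)"
    using K by (intro re_lower_bound_at_imaginary_point[of 0 0 "inverse K"]) (use \<eta> in auto)
  then obtain d where d: "d > 0" and *: "\<And>z. z \<noteq> 0 \<Longrightarrow> norm z < d \<Longrightarrow> 0 < Re z \<Longrightarrow> - \<eta> < Re (?h z)"
    by (auto simp: eventually_at)
  show ?thesis
  proof (intro exI[of _ "inverse d"] conjI allI impI)
    fix s :: complex assume s: "0 < Re s" "norm s > inverse d"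
    have "norm (inverse s) < d" using s(2) d less_imp_inverse_less[of "inverse d" "norm s"]
      by (simp add: norm_inverse)
    moreover have "0 < Re (inverse s)" using s(1) by (auto simp: add_pos_nonneg intro!: divide_pos_pos)
    ultimately show "- \<eta> < Re (f s)" using *[of "inverse s"] s by (metis Re_complex_of_real
        inverse_inverse_eq inverse_zero less_irrefl zero_complex.simps(1))
  qed (use d in auto)
qed

text \<open>Minimum principle on an unbounded domain whose boundary may carry simple poles with
  nonnegative residues. The two local bounds keep the set where the real part is at most a given
  negative constant away from the axis and from infinity, so a negative value would force an
  interior minimum. The second claim is the equality case.\<close>

theorem positive_real_from_boundary:
  fixes f :: "complex \<Rightarrow> complex"
  assumes S: "finite S" and hol: "f holomorphic_on - S" and Spos: "\<And>s. s \<in> S \<Longrightarrow> Re s \<le> 0"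
    and axis: "\<And>x. \<i> * of_real x \<notin> S \<Longrightarrow> 0 \<le> Re (f (\<i> * of_real x))"
    and pole: "\<And>x. \<i> * of_real x \<in> S \<Longrightarrow>
      \<exists>r\<ge>0. ((\<lambda>s. (s - \<i> * of_real x) * f s) \<longlongrightarrow> of_real r) (at (\<i> * of_real x))"
    and lim: "((\<lambda>s. f s / s) \<longlongrightarrow> 0) at_infinity"
  shows "0 < Re s \<Longrightarrow> 0 \<le> Re (f s)"
    and "0 < Re z \<Longrightarrow> Re (f z) = 0 \<Longrightarrow> 0 < Re w \<Longrightarrow> Re (f w) = 0"
proof -
  let ?R = "{s. 0 < Re s}"
  have R: "open ?R" "connected ?R"
    by (auto simp: open_halfspace_Re_gt convex_halfspace_Re_gt convex_connected)
  have holR: "f holomorphic_on ?R" by (rule holomorphic_on_subset[OF hol]) (use Spos in force)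
  then have contR: "continuous_on ?R f" by (rule holomorphic_on_imp_continuous_on)
  have imag: "\<forall>\<^sub>F s in at p. 0 < Re s \<longrightarrow> - \<eta> < Re (f s)" if p: "Re p = 0" and \<eta>: "\<eta> > 0" for p \<eta>
  proof -
    have peq: "p = \<i> * of_real (Im p)" using p by (simp add: complex_eq_iff)
    have "open (- (S - {p}))" using S by (intro open_Compl finite_imp_closed) auto
    then obtain e where e: "e > 0" "ball p e \<subseteq> - (S - {p})"
      by (meson Compl_iff Diff_iff insertI1 open_contains_ball)
    have h: "f holomorphic_on (ball p e - {p})" by (rule holomorphic_on_subset[OF hol]) (use e in auto)
    have "\<exists>r\<ge>0. ((\<lambda>s. (s - p) * f s) \<longlongrightarrow> of_real r) (at p)"
    proof (cases "p \<in> S")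
      case True then show ?thesis using pole[of "Im p"] peq by simp
    next
      case False
      have "isCont f p" by (rule continuous_on_interior[OF holomorphic_on_imp_continuous_on[OF hol]])
          (use False S in \<open>simp add: interior_open finite_imp_closed open_Compl\<close>)
      then have "((\<lambda>s. (s - p) * f s) \<longlongrightarrow> (p - p) * f p) (at p)"
        unfolding isCont_def by (intro tendsto_intros)
      then show ?thesis by (intro exI[of _ 0]) auto
    qed
    then obtain r where r: "r \<ge> 0" "((\<lambda>s. (s - p) * f s) \<longlongrightarrow> of_real r) (at p)" by blast
    have "\<forall>\<^sub>F x in at (0::real). 0 \<le> Re (f (p + \<i> * of_real x))"
      unfolding eventually_at
    proof (intro exI[of _ e] conjI ballI impI)
      fix x :: real assume x: "x \<noteq> 0 \<and> dist x 0 < e"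
      have eq: "p + \<i> * of_real x = \<i> * of_real (Im p + x)" using peq by (simp add: algebra_simps)
      have "p + \<i> * of_real x \<in> ball p e" "p + \<i> * of_real x \<noteq> p"
        using x by (auto simp: dist_norm norm_mult)
      then have "p + \<i> * of_real x \<notin> S" using e by auto
      then show "0 \<le> Re (f (p + \<i> * of_real x))" unfolding eq by (rule axis)
    qed (rule e)
    from re_lower_bound_at_imaginary_point[OF p r(1) e(1) h r(2) this \<eta>] show ?thesis .
  qed
  have inf: "\<exists>K>0. \<forall>s. 0 < Re s \<longrightarrow> norm s > K \<longrightarrow> - \<eta> < Re (f s)" if \<eta>: "\<eta> > 0" for \<eta>
  proof -
    obtain K where K: "K > 0" "\<And>s. s \<in> S \<Longrightarrow> norm s \<le> K"
      using finite_imp_bounded[OF S] by (auto simp: bounded_pos)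
    show ?thesis
    proof (rule re_lower_bound_at_infinity[OF K(1) _ lim _ \<eta>])
      show "f holomorphic_on {s. norm s > K}"
        by (rule holomorphic_on_subset[OF hol]) (use K(2) in force)
      show "0 \<le> Re (f (\<i> * of_real x))" if "\<bar>x\<bar> > K" for x
        by (rule axis) (use K(2)[of "\<i> * of_real x"] that in \<open>auto simp: norm_mult\<close>)
    qed
  qed
  have const: "Re (f w) = Re (f z)"
    if z: "0 < Re z" and w: "0 < Re w" and min: "\<And>s. 0 < Re s \<Longrightarrow> Re (f z) \<le> Re (f s)" for z w
  proof -
    \<comment> \<open>The modulus of \<open>exp (- f s)\<close> is \<open>exp (- Re (f s))\<close>,
      so a minimum of the real part is a maximum of the modulus.\<close>
    have "(\<lambda>s. exp (- f s)) constant_on ?R"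
      by (rule maximum_modulus_principle[of _ _ ?R z])
        (use R z min in \<open>auto intro!: holomorphic_intros holR\<close>)
    then obtain c where "\<And>s. s \<in> ?R \<Longrightarrow> exp (- f s) = c" by (auto simp: constant_on_def)
    then have "norm (exp (- f w)) = norm (exp (- f z))" using z w by simp
    then show ?thesis by simp
  qed
  have nonneg: "0 \<le> Re (f z)" if z: "0 < Re z" for z
  proof (rule ccontr)
    assume "\<not> 0 \<le> Re (f z)"
    define \<eta> where "\<eta> = - Re (f z)"
    have \<eta>: "\<eta> > 0" using \<open>\<not> 0 \<le> Re (f z)\<close> by (simp add: \<eta>_def)
    let ?K = "{s. 0 < Re s \<and> Re (f s) \<le> - \<eta>}"
    obtain B where B: "B > 0" "\<And>s. 0 < Re s \<Longrightarrow> norm s > B \<Longrightarrow> - \<eta> < Re (f s)" using inf[OF \<eta>] by blast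
    have "bounded ?K" unfolding bounded_iff using B(2) by (intro exI[of _ B]) force
    moreover have "closed ?K"
    proof (unfold closed_limpt, intro allI impI)
      fix p assume lp: "p islimpt ?K"
      have "p \<in> {s. 0 \<le> Re s}"
        by (rule closed_limpt[THEN iffD1, rule_format, OF closed_halfspace_Re_ge])
          (rule islimpt_subset[OF lp], auto)
      then have p: "0 \<le> Re p" by simp
      have freq: "\<exists>\<^sub>F s in at p. s \<in> ?K" using lp by (simp add: islimpt_conv_frequently_at)
      have "Re p \<noteq> 0"
      proof
        assume "Re p = 0"
        from frequently_ex[OF frequently_eventually_conj[OF freq imag[OF this \<eta>]]]
        show False by auto
      qed
      with p have p': "0 < Re p" by simp
      have "((\<lambda>s. Re (f s)) \<longlongrightarrow> Re (f p)) (at p)"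
        using contR R p' by (auto simp: continuous_on_eq_continuous_at isCont_def intro: tendsto_intros)
      then have "\<forall>\<^sub>F s in at p. - \<eta> < Re (f s)" if "- \<eta> < Re (f p)"
        using that by (rule order_tendstoD)
      then have "\<not> - \<eta> < Re (f p)" using frequently_ex[OF frequently_eventually_conj[OF freq]] by fastforce
      then show "p \<in> ?K" using p' by simp
    qed
    ultimately have "compact ?K" by (simp add: compact_eq_bounded_closed)
    moreover have "z \<in> ?K" using z by (simp add: \<eta>_def)
    moreover have "continuous_on ?K (\<lambda>s. Re (f s))"
      by (intro continuous_intros continuous_on_subset[OF contR]) auto
    ultimately obtain x where x: "x \<in> ?K" "\<And>s. s \<in> ?K \<Longrightarrow> Re (f x) \<le> Re (f s)"
      using continuous_attains_inf[of ?K "\<lambda>s. Re (f s)"] by (metis (no_types, lifting) empty_iff)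
    have min: "Re (f x) \<le> Re (f s)" if "0 < Re s" for s
      using x(1) x(2)[of s] that by (cases "s \<in> ?K") auto
    \<comment> \<open>The real part would have to be constant, but beyond the radius
      \<open>B\<close> it exceeds \<open>- \<eta>\<close>.\<close>
    have "Re (f (of_real (B + 1))) = Re (f x)" by (rule const) (use x min B in auto)
    moreover have "- \<eta> < Re (f (of_real (B + 1)))" using B by (intro B(2)) auto
    ultimately show False using x(1) by simp
  qed
  show "0 < Re s \<Longrightarrow> 0 \<le> Re (f s)" by (rule nonneg)
  show "0 < Re z \<Longrightarrow> Re (f z) = 0 \<Longrightarrow> 0 < Re w \<Longrightarrow> Re (f w) = 0"
    using const[of z w] nonneg by simp
qed

lemma eventually_at_right_0I: "(\<And>t::real. 0 < t \<Longrightarrow> P t) \<Longrightarrow> \<forall>\<^sub>F t in at_right 0. P t"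
  by (simp add: eventually_at_filter)

text \<open>Schwarz--Pick between \<open>s\<close> and \<open>t\<close>; as \<open>t \<rightarrow> 0\<close> it becomes Julia's lemma at the boundary
  point \<open>0\<close>.\<close>

lemma half_plane_schwarz_pick:
  fixes f :: "complex \<Rightarrow> complex" and t :: real
  assumes hol: "f holomorphic_on {s. 0 < Re s}" and pos: "\<And>s. 0 < Re s \<Longrightarrow> 0 < Re (f s)"
    and t: "t > 0" and s: "0 < Re s"
  shows "Re s * t * Re (f (of_real t)) \<le> Re (f s) * (norm (s + of_real t))\<^sup>2"
proof -
  let ?c = "f (of_real t)"
  \<comment> \<open>\<open>\<sigma>\<close> maps the unit disc onto the right half plane and 0 to
    \<open>t\<close>; \<open>\<phi>\<close> is \<open>f\<close> in disc coordinates centred at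
    \<open>t\<close> and \<open>f t\<close>. The Schwarz lemma for \<open>\<phi>\<close> is then the
    contraction of the pseudo-hyperbolic distance.\<close>
  define \<sigma> where "\<sigma> = (\<lambda>z::complex. of_real t * (1 + z) / (1 - z))"
  define \<phi> where "\<phi> = (\<lambda>z. (f (\<sigma> z) - ?c) / (f (\<sigma> z) + cnj ?c))"
  have \<sigma>: "0 < Re (\<sigma> z)" if "norm z < 1" for z
  proof -
    have n: "(Re z)\<^sup>2 + (Im z)\<^sup>2 < 1"
      using that by (metis abs_square_less_1 cmod_power2 abs_norm_cancel)
    have "z \<noteq> 1" using that by auto
    then have d: "0 < (1 - Re z)\<^sup>2 + (Im z)\<^sup>2"
      by (auto simp: complex_eq_iff sum_power2_gt_zero_iff)
    have "Re (\<sigma> z) = t * (1 - ((Re z)\<^sup>2 + (Im z)\<^sup>2)) / ((1 - Re z)\<^sup>2 + (Im z)\<^sup>2)"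
      using d by (simp add: \<sigma>_def Re_divide field_simps power2_eq_square)
    then show ?thesis using n d t by simp
  qed
  have c: "0 < Re ?c" using pos t by simp
  have diff: "(norm (a - b))\<^sup>2 = (norm (a + cnj b))\<^sup>2 - 4 * Re a * Re b" for a b :: complex
    unfolding cmod_power2 by (simp add: power2_eq_square algebra_simps)
  have nz: "f (\<sigma> z) + cnj ?c \<noteq> 0" if "norm z < 1" for z
  proof -
    have "0 < Re (f (\<sigma> z) + cnj ?c)" using pos[OF \<sigma>[OF that]] c by simp
    then show ?thesis by force
  qed
  have "\<sigma> holomorphic_on ball 0 1" unfolding \<sigma>_def by (intro holomorphic_intros) auto
  then have "(f \<circ> \<sigma>) holomorphic_on ball 0 1"
    by (rule holomorphic_on_compose_gen[OF _ hol]) (use \<sigma> in auto)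
  then have "\<phi> holomorphic_on ball 0 1"
    unfolding \<phi>_def o_def by (intro holomorphic_intros) (use nz in auto)
  moreover have "\<phi> 0 = 0" by (simp add: \<phi>_def \<sigma>_def)
  moreover have "norm (\<phi> z) < 1" if "norm z < 1" for z
  proof -
    have "(norm (f (\<sigma> z) - ?c))\<^sup>2 < (norm (f (\<sigma> z) + cnj ?c))\<^sup>2"
      unfolding diff using pos[OF \<sigma>[OF that]] c by simp
    then have "norm (f (\<sigma> z) - ?c) < norm (f (\<sigma> z) + cnj ?c)"
      using power_less_imp_less_base norm_ge_zero by blast
    then show ?thesis using nz[OF that] by (simp add: \<phi>_def norm_divide)
  qed
  moreover define z where "z = (s - of_real t) / (s + of_real t)"
  have st: "s + of_real t \<noteq> 0" using s t by (metis Re_complex_of_real add_pos_pos less_irrefl plus_complex.simps(1) zero_complex.simps(1))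
  have diff': "(norm (s - of_real t))\<^sup>2 = (norm (s + of_real t))\<^sup>2 - 4 * Re s * t"
    using diff[of s "of_real t"] by simp
  have "norm z < 1"
  proof -
    have "(norm (s - of_real t))\<^sup>2 < (norm (s + of_real t))\<^sup>2" unfolding diff' using s t by simp
    then have "norm (s - of_real t) < norm (s + of_real t)"
      using power_less_imp_less_base norm_ge_zero by blast
    then show ?thesis using st by (simp add: z_def norm_divide)
  qed
  ultimately have le: "norm (\<phi> z) \<le> norm z" using Schwarz_Lemma(1)[of \<phi> z] by blast
  have "\<sigma> z = s"
  proof -
    have "1 + z = 2 * s / (s + of_real t)" "1 - z = 2 * of_real t / (s + of_real t)"
      using st by (auto simp: z_def field_simps)
    then show ?thesis using st t by (simp add: \<sigma>_def)
  qed
  let ?A = "(norm (f s + cnj ?c))\<^sup>2" and ?B = "(norm (s + of_real t))\<^sup>2"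
  have A: "norm (f s + cnj ?c) \<noteq> 0" using nz[OF \<open>norm z < 1\<close>] \<open>\<sigma> z = s\<close> by simp
  have "norm (f s - ?c) / norm (f s + cnj ?c) \<le> norm (s - of_real t) / norm (s + of_real t)"
    using le by (simp add: \<phi>_def \<open>\<sigma> z = s\<close> norm_divide) (simp add: z_def norm_divide)
  then have "norm (f s - ?c) * norm (s + of_real t) \<le> norm (s - of_real t) * norm (f s + cnj ?c)"
    using A st by (simp add: field_simps)
  then have "(norm (f s - ?c))\<^sup>2 * ?B \<le> (norm (s - of_real t))\<^sup>2 * ?A"
    by (metis power_mono power_mult_distrib mult_nonneg_nonneg norm_ge_zero)
  then have *: "Re s * t * ?A \<le> Re (f s) * Re ?c * ?B"
    unfolding diff diff' by (simp add: algebra_simps)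
  \<comment> \<open>This discards \<open>f s\<close> and the imaginary parts. The weaker estimate
    suffices: it is used where \<open>t * Re (f t)\<close> has a finite limit as \<open>t\<close>
    tends to 0, and in this form the limit can be taken in the inequality.\<close>
  have "(Re ?c)\<^sup>2 \<le> ?A"
    using pos[OF s] c power_mono[of "Re ?c" "Re (f s) + Re ?c" 2] unfolding cmod_power2
    by (simp add: add_increasing2)
  then have "Re s * t * (Re ?c)\<^sup>2 \<le> Re s * t * ?A" using s t by (intro mult_left_mono) auto
  with * have "(Re s * t * Re ?c) * Re ?c \<le> (Re (f s) * ?B) * Re ?c"
    by (simp add: power2_eq_square algebra_simps)
  then show ?thesis using c by (simp only: mult_le_cancel_right_pos)
qed

section \<open>Vectors as functions\<close>

text \<open>Complex vectors of length \<open>n\<close> are functions supported on \<open>{..<n}\<close>. They form a vector space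
  without side conditions on dimensions.\<close>

definition supp :: "nat \<Rightarrow> (nat \<Rightarrow> complex) \<Rightarrow> bool" where
  "supp n v \<longleftrightarrow> (\<forall>i\<ge>n. v i = 0)"

definition sv :: "complex \<Rightarrow> (nat \<Rightarrow> complex) \<Rightarrow> nat \<Rightarrow> complex" where
  "sv c v = (\<lambda>i. c * v i)"

text \<open>Entries of \<open>v\<close> beyond \<open>dim_col X\<close> are ignored, so no condition
  on \<open>v\<close> is required, and \<open>1\<^sub>m n\<close> acts as truncation to the first
  \<open>n\<close> entries.\<close>

definition mv :: "complex mat \<Rightarrow> (nat \<Rightarrow> complex) \<Rightarrow> nat \<Rightarrow> complex" where
  "mv X v = (\<lambda>i. if i < dim_row X then \<Sum>j<dim_col X. X $$ (i,j) * v j else 0)"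

abbreviation rv :: "real mat \<Rightarrow> (nat \<Rightarrow> complex) \<Rightarrow> nat \<Rightarrow> complex" where
  "rv X \<equiv> mv (cmat X)"

definition ip :: "nat \<Rightarrow> (nat \<Rightarrow> complex) \<Rightarrow> (nat \<Rightarrow> complex) \<Rightarrow> complex" where
  "ip n v w = (\<Sum>i<n. v i * cnj (w i))"

definition vlim :: "('a \<Rightarrow> nat \<Rightarrow> complex) \<Rightarrow> (nat \<Rightarrow> complex) \<Rightarrow> 'a filter \<Rightarrow> bool" where
  "vlim x L Z \<longleftrightarrow> (\<forall>i. ((\<lambda>t. x t i) \<longlongrightarrow> L i) Z)"

text \<open>\<^const>\<open>mat_tendsto\<close> for filters on arbitrary types.\<close>

definition mlim :: "('a \<Rightarrow> complex mat) \<Rightarrow> complex mat \<Rightarrow> 'a filter \<Rightarrow> bool" where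
  "mlim X L Z \<longleftrightarrow> (\<forall>i<dim_row L. \<forall>j<dim_col L. ((\<lambda>t. X t $$ (i,j)) \<longlongrightarrow> L $$ (i,j)) Z)"

lemma mat_tendsto_eq_mlim: "mat_tendsto = mlim"
  by (simp add: fun_eq_iff mat_tendsto_def mlim_def)

lemma mlim_compose: "mlim X L Z \<Longrightarrow> filterlim f Z Z' \<Longrightarrow> mlim (\<lambda>t. X (f t)) L Z'"
  unfolding mlim_def
proof (intro allI impI)
  fix i j assume X: "\<forall>i<dim_row L. \<forall>j<dim_col L. ((\<lambda>s. X s $$ (i,j)) \<longlongrightarrow> L $$ (i,j)) Z"
    and f: "filterlim f Z Z'" and ij: "i < dim_row L" "j < dim_col L"
  have "((\<lambda>s. X s $$ (i,j)) \<longlongrightarrow> L $$ (i,j)) Z" using X ij by simp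
  from filterlim_compose[OF this f] show "((\<lambda>t. X (f t) $$ (i,j)) \<longlongrightarrow> L $$ (i,j)) Z'" .
qed

lemma supp_intros [intro, simp]:
  "supp n v \<Longrightarrow> supp n w \<Longrightarrow> supp n (v + w)" "supp n v \<Longrightarrow> supp n w \<Longrightarrow> supp n (v - w)"
  "supp n v \<Longrightarrow> supp n (- v)" "supp n v \<Longrightarrow> supp n (sv c v)" "supp n 0"
  by (simp_all add: supp_def sv_def)

lemma supp_mv [simp]: "dim_row X = n \<Longrightarrow> supp n (mv X v)"
  by (auto simp: supp_def mv_def)

lemma supp_mv' [intro]: "X \<in> carrier_mat n k \<Longrightarrow> supp n (mv X v)"
  by (auto simp: supp_def mv_def)

lemma supp_eqI: "supp n v \<Longrightarrow> supp n w \<Longrightarrow> (\<And>i. i < n \<Longrightarrow> v i = w i) \<Longrightarrow> v = w"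
  by (rule ext) (metis linorder_not_less supp_def)

lemma sv_simps [simp]: "sv 0 v = 0" "sv 1 v = v" "sv c 0 = 0" "sv c (sv d v) = sv (c * d) v" "sv (-1) v = - v"
  by (auto simp: sv_def fun_eq_iff mult.assoc)

lemma sv_add: "sv c (v + w) = sv c v + sv c w" and sv_diff: "sv c (v - w) = sv c v - sv c w"
  and sv_add_left: "sv (c + d) v = sv c v + sv d v"
  by (auto simp: sv_def fun_eq_iff algebra_simps)

lemma mv_add: "mv X (v + w) = mv X v + mv X w"
  and mv_diff: "mv X (v - w) = mv X v - mv X w"
  and mv_minus: "mv X (- v) = - mv X v"
  and mv_sv: "mv X (sv c v) = sv c (mv X v)"
  and mv_zero [simp]: "mv X 0 = 0"
  by (auto simp: mv_def sv_def fun_eq_iff algebra_simps sum.distrib sum_subtractf sum_negf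
      sum_distrib_left)

lemma mv_mat_add: "X \<in> carrier_mat p q \<Longrightarrow> Y \<in> carrier_mat p q \<Longrightarrow> mv (X + Y) v = mv X v + mv Y v"
  and mv_mat_diff: "X \<in> carrier_mat p q \<Longrightarrow> Y \<in> carrier_mat p q \<Longrightarrow> mv (X - Y) v = mv X v - mv Y v"
  by (auto simp: mv_def fun_eq_iff algebra_simps sum.distrib sum_subtractf)

lemma mv_smult: "mv (c \<cdot>\<^sub>m X) v = sv c (mv X v)"
  by (auto simp: mv_def sv_def fun_eq_iff sum_negf sum_distrib_left mult.assoc)

lemma mv_mult: "X \<in> carrier_mat p q \<Longrightarrow> Y \<in> carrier_mat q r \<Longrightarrow> mv (X * Y) v = mv X (mv Y v)"
proof (rule ext)
  fix i assume X: "X \<in> carrier_mat p q" and Y: "Y \<in> carrier_mat q r"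
  show "mv (X * Y) v i = mv X (mv Y v) i"
  proof (cases "i < p")
    case True
    have "(\<Sum>j<r. (\<Sum>k<q. X $$ (i,k) * Y $$ (k,j)) * v j) = (\<Sum>j<r. \<Sum>k<q. X $$ (i,k) * Y $$ (k,j) * v j)"
      by (simp add: sum_distrib_right)
    also have "\<dots> = (\<Sum>k<q. \<Sum>j<r. X $$ (i,k) * Y $$ (k,j) * v j)" by (rule sum.swap)
    finally show ?thesis
      using X Y True by (auto simp: mv_def scalar_prod_def sum_distrib_left mult.assoc
          simp flip: lessThan_atLeast0 intro!: sum.cong)
  qed (use X in \<open>auto simp: mv_def\<close>)
qed

lemma mv_one: "supp n v \<Longrightarrow> mv (1\<^sub>m n) v = v"
  by (auto simp: mv_def supp_def fun_eq_iff if_distrib[of "\<lambda>c. c * _"] cong: if_cong)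

lemma mv_zero_mat [simp]: "mv (0\<^sub>m p q) v = 0"
  by (auto simp: mv_def fun_eq_iff)

lemma mv_cmat_mult: "dim_col X = dim_row Y \<Longrightarrow> rv (X * Y) v = rv X (rv Y v)"
proof -
  assume d: "dim_col X = dim_row Y"
  have X: "X \<in> carrier_mat (dim_row X) (dim_row Y)" and Y: "Y \<in> carrier_mat (dim_row Y) (dim_col Y)"
    by (rule carrier_matI[OF refl d], rule carrier_matI[OF refl refl])
  have "cmat X \<in> carrier_mat (dim_row X) (dim_row Y)" "cmat Y \<in> carrier_mat (dim_row Y) (dim_col Y)"
    using X Y by (simp_all only: map_carrier_mat)
  then show ?thesis unfolding of_real_hom.mat_hom_mult[OF X Y] by (rule mv_mult)
qed

lemma mv_cmat_diff: "dim_row X = dim_row Y \<Longrightarrow> dim_col X = dim_col Y \<Longrightarrow>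
    rv (X - Y) v = rv X v - rv Y v"
  and mv_cmat_add: "dim_row X = dim_row Y \<Longrightarrow> dim_col X = dim_col Y \<Longrightarrow>
    rv (X + Y) v = rv X v + rv Y v"
  and mv_cmat_uminus: "rv (- X) v = - rv X v"
  by (auto simp: mv_def fun_eq_iff algebra_simps sum.distrib sum_subtractf sum_negf)

lemma cmat_one: "cmat (1\<^sub>m n) = 1\<^sub>m n"
  by (rule eq_matI) auto

lemma mv_cmat_one: "supp n v \<Longrightarrow> rv (1\<^sub>m n) v = v"
  by (simp add: cmat_one mv_one)

lemma mv_cmat_truncate: "dim_col X = n \<Longrightarrow> rv X (rv (1\<^sub>m n) v) = rv X v"
  by (simp flip: mv_cmat_mult)

lemma mv_eq_vec: "mv X v = (\<lambda>i. if i < dim_row X then (X *\<^sub>v vec (dim_col X) v) $ i else 0)"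
  by (auto simp: mv_def scalar_prod_def fun_eq_iff lessThan_atLeast0 intro!: sum.cong)

section \<open>The inner product and adjoints\<close>

lemma ip_add_left: "ip n (v + w) u = ip n v u + ip n w u"
  and ip_add_right: "ip n u (v + w) = ip n u v + ip n u w"
  and ip_diff_left: "ip n (v - w) u = ip n v u - ip n w u"
  and ip_diff_right: "ip n u (v - w) = ip n u v - ip n u w"
  and ip_minus_left: "ip n (- v) u = - ip n v u"
  and ip_minus_right: "ip n u (- v) = - ip n u v"
  and ip_sv_left: "ip n (sv c v) u = c * ip n v u"
  and ip_sv_right: "ip n u (sv c v) = cnj c * ip n u v"
  and ip_zero [simp]: "ip n 0 u = 0" "ip n u 0 = 0"
  by (auto simp: ip_def sv_def algebra_simps sum.distrib sum_subtractf sum_negf sum_distrib_left)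

lemmas ip_linear = ip_add_left ip_add_right ip_diff_left ip_diff_right ip_minus_left ip_minus_right
  ip_sv_left ip_sv_right

lemma ip_commute: "ip n w v = cnj (ip n v w)"
  by (simp add: ip_def mult.commute)

lemma ip_self: "ip n v v = of_real (\<Sum>i<n. (norm (v i))\<^sup>2)"
  unfolding ip_def of_real_sum complex_norm_square ..

lemma ip_self_nonneg: "0 \<le> Re (ip n v v)" "Im (ip n v v) = 0"
  by (auto simp: ip_self intro: sum_nonneg)

lemma ip_self_eq_0: "supp n v \<Longrightarrow> Re (ip n v v) = 0 \<Longrightarrow> v = 0"
proof (rule supp_eqI[of n])
  fix i assume "Re (ip n v v) = 0" "i < n"
  then have "(norm (v i))\<^sup>2 = 0"
    unfolding ip_self by (subst (asm) Re_complex_of_real, subst (asm) sum_nonneg_eq_0_iff) auto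
  then show "v i = 0 i" by simp
qed auto

lemma ip_self_pos: "supp n v \<Longrightarrow> v \<noteq> 0 \<Longrightarrow> 0 < Re (ip n v v)"
  using ip_self_eq_0[of n v] ip_self_nonneg[of n v] by linarith

lemma mat_adjoint_index [simp]:
  "i < dim_col X \<Longrightarrow> j < dim_row X \<Longrightarrow> mat_adjoint X $$ (i,j) = conjugate (X $$ (j,i))"
  "dim_row (mat_adjoint X) = dim_col X" "dim_col (mat_adjoint X) = dim_row X"
  by (auto simp: mat_adjoint_def mat_of_rows_def)

lemma mat_adjoint_carrier [simp, intro]: "X \<in> carrier_mat p q \<Longrightarrow> mat_adjoint X \<in> carrier_mat q p"
  by auto

lemma mat_adjoint_cmat: "mat_adjoint (cmat X) = cmat (X\<^sup>T)"
  by (rule eq_matI) auto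

lemma mat_adjoint_real: "mat_adjoint (X :: real mat) = X\<^sup>T"
  by (rule eq_matI) auto

lemma ip_adjoint:
  assumes "X \<in> carrier_mat p q"
  shows "ip p (mv X v) w = ip q v (mv (mat_adjoint X) w)"
proof -
  have "ip p (mv X v) w = (\<Sum>i<p. \<Sum>j<q. X $$ (i,j) * v j * cnj (w i))"
    using assms by (auto simp: ip_def mv_def sum_distrib_right intro!: sum.cong)
  also have "\<dots> = (\<Sum>j<q. \<Sum>i<p. X $$ (i,j) * v j * cnj (w i))" by (rule sum.swap)
  also have "\<dots> = ip q v (mv (mat_adjoint X) w)"
    using assms by (auto simp: ip_def mv_def sum_distrib_left intro!: sum.cong)
  finally show ?thesis .
qed

lemma ip_adjoint': "X \<in> carrier_mat p q \<Longrightarrow> ip p w (mv X v) = ip q (mv (mat_adjoint X) w) v"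
  using ip_adjoint[of X p q v w] by (metis ip_commute)

section \<open>Entrywise limits\<close>

lemma vlim_const [simp, intro]: "vlim (\<lambda>_. v) v Z"
  by (simp add: vlim_def)

lemma vlim_add: "vlim x a Z \<Longrightarrow> vlim y b Z \<Longrightarrow> vlim (\<lambda>t. x t + y t) (a + b) Z"
  and vlim_diff: "vlim x a Z \<Longrightarrow> vlim y b Z \<Longrightarrow> vlim (\<lambda>t. x t - y t) (a - b) Z"
  and vlim_sv: "(c \<longlongrightarrow> d) Z \<Longrightarrow> vlim x a Z \<Longrightarrow> vlim (\<lambda>t. sv (c t) (x t)) (sv d a) Z"
  by (auto simp: vlim_def sv_def intro: tendsto_intros)

lemma vlim_mv: "vlim x a Z \<Longrightarrow> vlim (\<lambda>t. mv X (x t)) (mv X a) Z"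
  by (auto simp: vlim_def mv_def intro!: tendsto_intros)

lemma vlim_mat_mv:
  assumes "mlim X L Z" "\<And>t. X t \<in> carrier_mat p q" "L \<in> carrier_mat p q" "vlim x a Z"
  shows "vlim (\<lambda>t. mv (X t) (x t)) (mv L a) Z"
  unfolding vlim_def
proof
  fix i
  have d: "dim_row (X t) = p" "dim_col (X t) = q" for t using assms(2)[of t] by auto
  show "((\<lambda>t. mv (X t) (x t) i) \<longlongrightarrow> mv L a i) Z"
    using assms(1,3,4) by (auto simp: mv_def d mlim_def vlim_def intro!: tendsto_intros)
qed

lemma vlim_ip: "vlim x a Z \<Longrightarrow> vlim y b Z \<Longrightarrow> ((\<lambda>t. ip n (x t) (y t)) \<longlongrightarrow> ip n a b) Z"
  by (auto simp: vlim_def ip_def intro!: tendsto_intros)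

lemma vlim_unique: "vlim x a Z \<Longrightarrow> vlim x b Z \<Longrightarrow> Z \<noteq> bot \<Longrightarrow> a = b"
  by (auto simp: vlim_def fun_eq_iff intro: tendsto_unique)

lemma vlim_cong: "vlim x a Z \<Longrightarrow> \<forall>\<^sub>F t in Z. x t = y t \<Longrightarrow> vlim y a Z"
  unfolding vlim_def
proof
  fix i assume lim: "\<forall>i. ((\<lambda>t. x t i) \<longlongrightarrow> a i) Z" and ev: "\<forall>\<^sub>F t in Z. x t = y t"
  show "((\<lambda>t. y t i) \<longlongrightarrow> a i) Z"
    by (rule Lim_transform_eventually[of "\<lambda>t. x t i"]) (use lim ev in \<open>auto elim: eventually_mono\<close>)
qed

lemma vlim_bound:
  assumes "((\<lambda>t. Re (ip n (x t) (x t))) \<longlongrightarrow> 0) Z" "\<And>t. supp n (x t)"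
  shows "vlim x 0 Z"
  unfolding vlim_def
proof
  fix i
  show "((\<lambda>t. x t i) \<longlongrightarrow> 0 i) Z"
  proof (cases "i < n")
    case True
    have "(norm (x t i))\<^sup>2 \<le> Re (ip n (x t) (x t))" for t
      unfolding ip_self Re_complex_of_real using True
      by (intro member_le_sum[of i _ "\<lambda>i. (norm (x t i))\<^sup>2"]) auto
    then have le: "\<forall>\<^sub>F t in Z. (norm (x t i))\<^sup>2 \<le> Re (ip n (x t) (x t))" by simp
    have "((\<lambda>t. (norm (x t i))\<^sup>2) \<longlongrightarrow> 0) Z"
      by (rule tendsto_sandwich[OF _ le tendsto_const assms(1)]) simp
    then have "((\<lambda>t. sqrt ((norm (x t i))\<^sup>2)) \<longlongrightarrow> sqrt 0) Z" by (rule tendsto_real_sqrt)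
    then show ?thesis by (simp add: tendsto_norm_zero_iff)
  next
    case False then show ?thesis using assms(2) by (simp add: supp_def)
  qed
qed

section \<open>Inverses and eigenvalues\<close>

lemma mat_inv:
  assumes "X \<in> carrier_mat n n" "det X \<noteq> 0"
  shows "mat_inv X \<in> carrier_mat n n" "X * mat_inv X = 1\<^sub>m n" "mat_inv X * X = 1\<^sub>m n"
proof -
  have "X \<in> Units (ring_mat TYPE('a) n ())" by (rule det_non_zero_imp_unit[OF assms])
  then obtain B where "mat_inverse X = Some B" using mat_inverse(1)[OF assms(1)] by fastforce
  then show "mat_inv X \<in> carrier_mat n n" "X * mat_inv X = 1\<^sub>m n" "mat_inv X * X = 1\<^sub>m n"
    using mat_inverse(2)[OF assms(1)] by (auto simp: mat_inv_def)
qed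

lemma mat_inv_unique:
  assumes X: "(X :: 'a :: field mat) \<in> carrier_mat n n" and Y: "Y \<in> carrier_mat n n" and XY: "X * Y = 1\<^sub>m n"
  shows "mat_inv X = Y" "det X \<noteq> 0"
proof -
  have "det X * det Y = 1" using det_mult[OF X Y] XY by simp
  then show d: "det X \<noteq> 0" by auto
  have "mat_inv X = mat_inv X * (X * Y)" using mat_inv[OF X d] XY by simp
  also have "\<dots> = mat_inv X * X * Y"
    using assoc_mult_mat[OF mat_inv(1)[OF X d] X Y] by simp
  finally show "mat_inv X = Y" using mat_inv[OF X d] Y by simp
qed

lemma mv_mat_inv:
  assumes "X \<in> carrier_mat n n" "det X \<noteq> 0" "supp n v"
  shows "mv X (mv (mat_inv X) v) = v" "mv (mat_inv X) (mv X v) = v"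
  using mat_inv[OF assms(1,2)] assms by (simp_all add: mv_one flip: mv_mult[of _ n n _ n])

lemma mat_inv_adj_mat:
  assumes X: "(X :: 'a :: field mat) \<in> carrier_mat n n" and d: "det X \<noteq> 0"
  shows "mat_inv X = inverse (det X) \<cdot>\<^sub>m adj_mat X"
proof (rule mat_inv_unique[OF X])
  show "inverse (det X) \<cdot>\<^sub>m adj_mat X \<in> carrier_mat n n" using adj_mat[OF X] by simp
  show "X * (inverse (det X) \<cdot>\<^sub>m adj_mat X) = 1\<^sub>m n"
    unfolding mult_smult_distrib[OF X adj_mat(1)[OF X]] adj_mat(2)[OF X] using d by (intro eq_matI) auto
qed

lemma det_nonzero_iff:
  assumes X: "X \<in> carrier_mat n n"
  shows "det X \<noteq> 0 \<longleftrightarrow> (\<forall>v. supp n v \<longrightarrow> mv X v = 0 \<longrightarrow> v = 0)"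
proof
  assume d: "det X \<noteq> 0"
  show "\<forall>v. supp n v \<longrightarrow> mv X v = 0 \<longrightarrow> v = 0" using mv_mat_inv(2)[OF X d] by force
next
  assume *: "\<forall>v. supp n v \<longrightarrow> mv X v = 0 \<longrightarrow> v = 0"
  show "det X \<noteq> 0"
  proof
    assume "det X = 0"
    then obtain v where v: "v \<in> carrier_vec n" "v \<noteq> 0\<^sub>v n" "X *\<^sub>v v = 0\<^sub>v n"
      using det_0_iff_vec_prod_zero_field[OF X] by blast
    let ?v = "\<lambda>i. if i < n then v $ i else 0"
    have "vec n ?v = v" using v by (intro eq_vecI) auto
    then have "mv X ?v = 0" using X v by (auto simp: mv_eq_vec fun_eq_iff)
    moreover have "supp n ?v" by (simp add: supp_def)
    ultimately have "?v = 0" using * by blast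
    then have "v = 0\<^sub>v n" using v(1) by (intro eq_vecI) (auto simp: fun_eq_iff split: if_splits)
    then show False using v by simp
  qed
qed

lemma eigenvalue_iff:
  assumes A: "A \<in> carrier_mat n n"
  shows "eigenvalue A z \<longleftrightarrow> (\<exists>v. supp n v \<and> v \<noteq> 0 \<and> mv A v = sv z v)"
proof
  assume "eigenvalue A z"
  then obtain v where v: "v \<in> carrier_vec n" "v \<noteq> 0\<^sub>v n" "A *\<^sub>v v = z \<cdot>\<^sub>v v"
    using A by (auto simp: eigenvalue_def eigenvector_def)
  let ?v = "\<lambda>i. if i < n then v $ i else 0"
  have eq: "vec n ?v = v" using v by (intro eq_vecI) auto
  have "mv A ?v = sv z ?v" using A v eq by (auto simp: mv_eq_vec fun_eq_iff sv_def)
  moreover have "?v \<noteq> 0"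
  proof
    assume "?v = 0"
    then have "v = 0\<^sub>v n" using v(1) by (intro eq_vecI) (auto simp: fun_eq_iff split: if_splits)
    then show False using v by simp
  qed
  ultimately show "\<exists>v. supp n v \<and> v \<noteq> 0 \<and> mv A v = sv z v" by (intro exI[of _ ?v]) (auto simp: supp_def)
next
  assume "\<exists>v. supp n v \<and> v \<noteq> 0 \<and> mv A v = sv z v"
  then obtain v where v: "supp n v" "v \<noteq> 0" "mv A v = sv z v" by blast
  have "A *\<^sub>v vec n v = z \<cdot>\<^sub>v vec n v"
  proof (rule eq_vecI)
    fix i assume "i < dim_vec (z \<cdot>\<^sub>v vec n v)"
    then have i: "i < n" by simp
    have "(A *\<^sub>v vec n v) $ i = mv A v i" using A i by (auto simp: mv_eq_vec)
    then show "(A *\<^sub>v vec n v) $ i = (z \<cdot>\<^sub>v vec n v) $ i" using i v(3) by (simp add: sv_def)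
  qed (use A in auto)
  moreover have "vec n v \<noteq> 0\<^sub>v n"
  proof
    assume eq: "vec n v = 0\<^sub>v n"
    have "v i = 0" if "i < n" for i using arg_cong[OF eq, of "\<lambda>w. w $ i"] that by simp
    then have "v = 0" by (intro supp_eqI[OF v(1)]) auto
    then show False using v by simp
  qed
  ultimately show "eigenvalue A z"
    using A by (auto simp: eigenvalue_def eigenvector_def intro!: exI[of _ "vec n v"])
qed

lemma mv_char:
  assumes "A \<in> carrier_mat n n" "supp n v"
  shows "mv (z \<cdot>\<^sub>m 1\<^sub>m n - A) v = sv z v - mv A v"
  using assms by (simp add: mv_mat_diff[of _ n n] mv_smult mv_one)

lemma det_char_nonzero_iff:
  assumes A: "(A :: complex mat) \<in> carrier_mat n n"
  shows "det (z \<cdot>\<^sub>m 1\<^sub>m n - A) \<noteq> 0 \<longleftrightarrow> \<not> eigenvalue A z"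
proof -
  have *: "z \<cdot>\<^sub>m 1\<^sub>m n - A \<in> carrier_mat n n" using A by auto
  show ?thesis unfolding det_nonzero_iff[OF *] eigenvalue_iff[OF A]
    by (metis (no_types, lifting) A mv_char right_minus_eq)
qed

lemma finite_eigenvalues:
  assumes A: "(A :: 'a :: field mat) \<in> carrier_mat n n"
  shows "finite {z. eigenvalue A z}"
  unfolding eigenvalue_root_char_poly[OF A]
  by (rule poly_roots_finite) (use degree_monic_char_poly[OF A] in auto)

section \<open>Holomorphic matrix functions\<close>

lemma holomorphic_det:
  assumes "\<And>s. X s \<in> carrier_mat n n"
    and "\<And>i j. i < n \<Longrightarrow> j < n \<Longrightarrow> (\<lambda>s. X s $$ (i,j)) holomorphic_on S"
  shows "(\<lambda>s. det (X s)) holomorphic_on S"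
  unfolding det_def'[OF assms(1)]
  by (intro holomorphic_intros assms(2)) (use permutes_in_image in fastforce)+

lemma tendsto_det:
  assumes "\<And>s. X s \<in> carrier_mat n n" "L \<in> carrier_mat n n" "mlim X L Z"
  shows "((\<lambda>s. det (X s)) \<longlongrightarrow> det L) Z"
  unfolding det_def'[OF assms(1)] det_def'[OF assms(2)]
proof (intro tendsto_intros)
  fix p i assume "p \<in> {p. p permutes {0..<n}}" "i \<in> {0..<n}"
  then have "i < n" "p i < n" using permutes_in_image[of p "{0..<n}" i] by auto
  then show "((\<lambda>s. X s $$ (i, p i)) \<longlongrightarrow> L $$ (i, p i)) Z"
    using assms(2,3) by (auto simp: mlim_def)
qed

lemma mat_delete_index:
  assumes "Y \<in> carrier_mat n n" "i < n - 1" "j < n - 1"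
  shows "mat_delete Y k l $$ (i,j) = Y $$ (if i < k then i else Suc i, if j < l then j else Suc j)"
  using assms by (auto simp: mat_delete_def)

lemma mat_delete_square: "Y \<in> carrier_mat n n \<Longrightarrow> mat_delete Y k l \<in> carrier_mat (n - 1) (n - 1)"
  by (auto simp: mat_delete_def)

lemma mv_mat_inv_cofactor:
  assumes "X \<in> carrier_mat n n" "det X \<noteq> 0"
  shows "mv (mat_inv X) b i = (if i < n then \<Sum>j<n. inverse (det X) * cofactor X j i * b j else 0)"
  using assms(1) by (auto simp: mat_inv_adj_mat[OF assms] mv_def adj_mat_def)

text \<open>By Cramer's rule the entries of the inverse are cofactors divided by the
  determinant.\<close>

lemma holomorphic_mat_inv:
  assumes X: "\<And>s. X s \<in> carrier_mat n n"
    and hol: "\<And>i j. i < n \<Longrightarrow> j < n \<Longrightarrow> (\<lambda>s. X s $$ (i,j)) holomorphic_on S"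
    and d: "\<And>s. s \<in> S \<Longrightarrow> det (X s) \<noteq> 0"
  shows "(\<lambda>s. mv (mat_inv (X s)) b i) holomorphic_on S"
proof -
  have "(\<lambda>s. cofactor (X s) k l) holomorphic_on S" for k l
    unfolding cofactor_def
    by (intro holomorphic_intros holomorphic_det[OF mat_delete_square[OF X]])
      (simp add: mat_delete_index[OF X] hol)
  then have "(\<lambda>s. if i < n then \<Sum>j<n. inverse (det (X s)) * cofactor (X s) j i * b j else 0) holomorphic_on S"
    by (cases "i < n") (auto intro!: holomorphic_intros holomorphic_det[OF X hol] d)
  then show ?thesis by (simp add: mv_mat_inv_cofactor[OF X d] cong: holomorphic_cong)
qed

text \<open>Nonsingularity of the limit makes the determinant eventually nonzero, and convergence is
  then read off from Cramer's rule. At the exceptional points \<open>mat_inv\<close> is unspecified,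
  hence the detour over an eventually equal function.\<close>

lemma vlim_mat_inv:
  assumes X: "\<And>s. X s \<in> carrier_mat n n" and L: "L \<in> carrier_mat n n" and lim: "mlim X L Z"
    and d: "det L \<noteq> 0" and b: "vlim b c Z"
  shows "\<forall>\<^sub>F s in Z. det (X s) \<noteq> 0" "vlim (\<lambda>s. mv (mat_inv (X s)) (b s)) (mv (mat_inv L) c) Z"
proof -
  have dlim: "((\<lambda>s. det (X s)) \<longlongrightarrow> det L) Z" by (rule tendsto_det[OF X L lim])
  show ev: "\<forall>\<^sub>F s in Z. det (X s) \<noteq> 0" by (rule tendsto_imp_eventually_ne[OF dlim d])
  have Lim: "((\<lambda>s. X s $$ (i,j)) \<longlongrightarrow> L $$ (i,j)) Z" if "i < n" "j < n" for i j
    using lim L that by (auto simp: mlim_def)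
  have "mlim (\<lambda>s. mat_delete (X s) k l) (mat_delete L k l) Z" for k l
    unfolding mlim_def
  proof (intro allI impI)
    fix i j assume "i < dim_row (mat_delete L k l)" "j < dim_col (mat_delete L k l)"
    then have ij: "i < n - 1" "j < n - 1" using mat_delete_square[OF L, of k l] by auto
    show "((\<lambda>s. mat_delete (X s) k l $$ (i,j)) \<longlongrightarrow> mat_delete L k l $$ (i,j)) Z"
      unfolding mat_delete_index[OF X ij] mat_delete_index[OF L ij] by (rule Lim) (use ij in auto)
  qed
  then have "((\<lambda>s. det (mat_delete (X s) k l)) \<longlongrightarrow> det (mat_delete L k l)) Z" for k l
    by (rule tendsto_det[OF mat_delete_square[OF X] mat_delete_square[OF L]])
  then have cof: "((\<lambda>s. cofactor (X s) k l) \<longlongrightarrow> cofactor L k l) Z" for k l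
    unfolding cofactor_def by (intro tendsto_intros)
  have "vlim (\<lambda>s i. if i < n then \<Sum>j<n. inverse (det (X s)) * cofactor (X s) j i * b s j else 0) (mv (mat_inv L) c) Z"
    using b by (auto simp: vlim_def mv_mat_inv_cofactor[OF L d] intro!: tendsto_intros dlim d cof)
  then show "vlim (\<lambda>s. mv (mat_inv (X s)) (b s)) (mv (mat_inv L) c) Z"
    by (rule vlim_cong) (use ev in eventually_elim, simp add: mv_mat_inv_cofactor[OF X] fun_eq_iff)
qed

lemma resolvent_tendsto_zero:
  assumes A: "A \<in> carrier_mat n n"
  shows "vlim (\<lambda>s. mv (mat_inv (s \<cdot>\<^sub>m 1\<^sub>m n - A)) b) 0 at_infinity"
proof -
  define N where "N = (\<lambda>x::nat \<Rightarrow> complex. \<Sum>i<n. norm (x i))"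
  \<comment> \<open>\<open>c\<close> bounds the operator norm of \<open>A\<close> for the sum norm
    \<open>N\<close>. Where \<open>norm s > c\<close>, the equation \<open>s x = A x + b\<close>
    alone gives \<open>(norm s - c) * N x \<le> N b\<close>, so no Neumann series has to be
    summed.\<close>
  define c where "c = (\<Sum>i<n. \<Sum>j<n. norm (A $$ (i,j)))"
  define R where "R = (\<lambda>s. mv (mat_inv (s \<cdot>\<^sub>m 1\<^sub>m n - A)) b)"
  let ?b = "mv (1\<^sub>m n) b"
  have c0: "c \<ge> 0" by (auto simp: c_def intro!: sum_nonneg)
  have NA: "N (mv A x) \<le> c * N x" for x
  proof -
    have "N (mv A x) \<le> (\<Sum>i<n. \<Sum>j<n. norm (A $$ (i,j)) * norm (x j))"
      unfolding N_def mv_def using A by (auto intro!: sum_mono norm_sum[THEN order_trans] simp: norm_mult)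
    also have "\<dots> \<le> (\<Sum>i<n. \<Sum>j<n. norm (A $$ (i,j)) * N x)"
      unfolding N_def by (intro sum_mono mult_left_mono member_le_sum) auto
    finally show ?thesis by (simp add: c_def sum_distrib_right)
  qed
  obtain K where K: "\<And>z. eigenvalue A z \<Longrightarrow> norm z \<le> K"
    using finite_imp_bounded[OF finite_eigenvalues[OF A]] by (auto simp: bounded_iff)
  have ev: "\<forall>\<^sub>F s in at_infinity. norm s > max K (c + 1)"
    unfolding eventually_at_infinity by (intro exI[of _ "max K (c + 1) + 1"]) auto
  have bound: "N (R s) \<le> N ?b / (norm s - c)" if s: "norm s > max K (c + 1)" for s
  proof -
    have nd: "det (s \<cdot>\<^sub>m 1\<^sub>m n - A) \<noteq> 0" using K[of s] s det_char_nonzero_iff[OF A] by force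
    have car: "s \<cdot>\<^sub>m 1\<^sub>m n - A \<in> carrier_mat n n" using A by auto
    have Rs: "supp n (R s)" unfolding R_def using mat_inv(1)[OF car nd] by auto
    have "R s = mv (mat_inv (s \<cdot>\<^sub>m 1\<^sub>m n - A)) ?b"
      unfolding R_def using mat_inv(1)[OF car nd] by (simp flip: mv_mult[of _ n n _ n])
    then have "mv (s \<cdot>\<^sub>m 1\<^sub>m n - A) (R s) = ?b" using mv_mat_inv(1)[OF car nd, of ?b] by simp
    then have eq: "sv s (R s) = mv A (R s) + ?b" using mv_char[OF A Rs] by (simp add: algebra_simps)
    have "N (sv s (R s)) \<le> N (mv A (R s)) + N ?b"
      unfolding eq N_def sum.distrib[symmetric] by (intro sum_mono) (simp add: norm_triangle_ineq)
    moreover have "N (sv s (R s)) = norm s * N (R s)" by (simp add: N_def sv_def norm_mult sum_distrib_left)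
    ultimately have "norm s * N (R s) \<le> c * N (R s) + N ?b" using NA[of "R s"] by linarith
    then show ?thesis using s by (simp add: field_simps)
  qed
  have "filterlim (\<lambda>s::complex. norm s - c) at_top at_infinity"
    using filterlim_tendsto_add_at_top[OF tendsto_const[of "- c"] filterlim_norm_at_top] by simp
  then have lim0: "((\<lambda>s::complex. N ?b / (norm s - c)) \<longlongrightarrow> 0) at_infinity"
    by (intro tendsto_divide_0[OF tendsto_const] filterlim_at_top_imp_at_infinity)
  have le: "\<forall>\<^sub>F s in at_infinity. N (R s) \<le> N ?b / (norm s - c)"
    using ev by eventually_elim (rule bound)
  have ge: "\<forall>\<^sub>F s in at_infinity. 0 \<le> N (R s)" by (simp add: N_def sum_nonneg)
  note lim = tendsto_sandwich[OF ge le tendsto_const lim0]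
  show ?thesis unfolding vlim_def R_def[symmetric]
  proof
    fix i
    show "((\<lambda>s. R s i) \<longlongrightarrow> 0 i) at_infinity"
    proof (cases "i < n")
      case True
      then have "norm (R s i) \<le> N (R s)" for s unfolding N_def by (intro member_le_sum) auto
      then have "((\<lambda>s. R s i) \<longlongrightarrow> 0) at_infinity"
        by (intro Lim_null_comparison[OF _ lim]) simp
      then show ?thesis by simp
    next
      \<comment> \<open>At eigenvalues of \<open>A\<close> the dimensions of \<open>mat_inv\<close>
        are unspecified, so the entries with index at least \<open>n\<close> are known to vanish
        only outside a large disc.\<close>
      case False
      have "\<forall>\<^sub>F s in at_infinity. R s i = 0"
        using ev
      proof eventually_elim
        case (elim s)
        have nd: "det (s \<cdot>\<^sub>m 1\<^sub>m n - A) \<noteq> 0" using K[of s] elim det_char_nonzero_iff[OF A] by force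
        have "s \<cdot>\<^sub>m 1\<^sub>m n - A \<in> carrier_mat n n" using A by auto
        from mat_inv(1)[OF this nd] show ?case using False by (auto simp: R_def mv_def)
      qed
      then show ?thesis by (simp add: tendsto_eventually)
    qed
  qed
qed

section \<open>Rational functions\<close>

text \<open>A Bezout identity for numerator and denominator survives the passage to complex
  polynomials, so every root of the denominator is a genuine pole. Hence the last property: a finite
  limit, where it exists, is the value. It extends identities proved off a finite set to the points
  where the other side is continuous.\<close>

lemma proper_real_rational_props:
  assumes "proper_real_rational f"
  obtains S where "finite S" "f holomorphic_on - S" "\<And>z. z \<in> S \<Longrightarrow> is_pole f z"
    and "\<And>s. f (cnj s) = cnj (f s)" and "\<And>s L. (f \<longlongrightarrow> L) (at s) \<Longrightarrow> f s = L"
proof -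
  let ?c = "map_poly complex_of_real"
  obtain p q where q: "q \<noteq> 0" and cop: "coprime p q"
    and f: "\<And>s. f s = poly (?c p) s / poly (?c q) s"
    using assms unfolding proper_real_rational_def by blast
  obtain a b where ab: "a * p + b * q = 1"
    using bezout_coefficients_fst_snd[of p q] coprime_imp_gcd_eq_1[OF cop] by metis
  have hom: "poly (?c (u + v)) s = poly (?c u) s + poly (?c v) s" "poly (?c (u * v)) s = poly (?c u) s * poly (?c v) s" for u v s
  proof -
    have "?c (u + v) = ?c u + ?c v" "?c (u * v) = ?c u * ?c v"
      by (simp_all add: poly_eq_iff coeff_map_poly coeff_mult)
    then show "poly (?c (u + v)) s = poly (?c u) s + poly (?c v) s" "poly (?c (u * v)) s = poly (?c u) s * poly (?c v) s" by simp_all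
  qed
  have bez: "poly (?c a) s * poly (?c p) s + poly (?c b) s * poly (?c q) s = 1" for s
    unfolding hom[symmetric] ab by simp
  define S where "S = {s. poly (?c q) s = 0}"
  have fin: "finite S" unfolding S_def by (rule poly_roots_finite) (use q in \<open>simp add: map_poly_eq_0_iff\<close>)
  have np: "poly (?c p) z \<noteq> 0" if "z \<in> S" for z using bez[of z] that by (auto simp: S_def)
  have ev: "\<forall>\<^sub>F s in at z. poly (?c q) s \<noteq> 0" for z
  proof -
    have "open (- (S - {z}))" using fin by (intro open_Compl finite_imp_closed) auto
    then have "\<forall>\<^sub>F s in at z. s \<in> - (S - {z})" by (intro eventually_at_in_open') auto
    then show ?thesis by (auto simp: eventually_at_filter S_def elim!: eventually_mono)
  qed
  have pole: "is_pole f z" if z: "z \<in> S" for z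
  proof -
    have "((\<lambda>s. poly (?c q) s) \<longlongrightarrow> poly (?c q) z) (at z)" by (intro tendsto_intros)
    then have "filterlim (poly (?c q)) (at 0) (at z)"
      using z ev[of z] by (auto simp: filterlim_at S_def)
    moreover have "((\<lambda>s. poly (?c p) s) \<longlongrightarrow> poly (?c p) z) (at z)" by (intro tendsto_intros)
    ultimately show ?thesis
      unfolding is_pole_def f[abs_def] using np[OF z] filterlim_divide_at_infinity by blast
  qed
  show ?thesis
  proof (rule that[OF fin _ pole])
    show "f holomorphic_on - S"
      unfolding f[abs_def] by (intro holomorphic_intros) (auto simp: S_def)
    show "f (cnj s) = cnj (f s)" for s
      by (simp add: f poly_altdef degree_map_poly coeff_map_poly)
    show "f s = L" if lim: "(f \<longlongrightarrow> L) (at s)" for s L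
    proof -
      have "s \<notin> S" using pole[of s] not_tendsto_and_filterlim_at_infinity[OF _ lim]
        by (auto simp: is_pole_def)
      then have "(f \<longlongrightarrow> f s) (at s)"
        unfolding f[abs_def] by (intro tendsto_intros) (auto simp: S_def)
      then show ?thesis using lim tendsto_unique trivial_limit_at by blast
    qed
  qed
qed

lemma eventually_not_in_finite: "finite S \<Longrightarrow> \<forall>\<^sub>F s in at (z :: complex). s \<notin> S"
proof -
  assume fin: "finite S"
  have "open (- (S - {z}))" using fin by (intro open_Compl finite_imp_closed) auto
  then have "\<forall>\<^sub>F s in at z. s \<in> - (S - {z})" by (intro eventually_at_in_open') auto
  then show ?thesis by (auto simp: eventually_at_filter elim!: eventually_mono)
qed

lemma eventually_char_nonzero:
  assumes "A \<in> carrier_mat n n"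
  shows "\<forall>\<^sub>F s in at z. det (s \<cdot>\<^sub>m 1\<^sub>m n - A) \<noteq> (0 :: complex)"
  using eventually_not_in_finite[OF finite_eigenvalues[OF assms], of z]
  by (simp add: det_char_nonzero_iff[OF assms])

section \<open>Realizations\<close>

definition unitv :: "nat \<Rightarrow> nat \<Rightarrow> complex" where
  "unitv j = (\<lambda>k. if k = j then 1 else 0)"

lemma mv_unitv: "i < dim_row X \<Longrightarrow> j < dim_col X \<Longrightarrow> mv X (unitv j) i = X $$ (i,j)"
  by (simp add: mv_def unitv_def if_distrib[of "\<lambda>c. _ * c"] cong: if_cong)

lemma mlim_char:
  "A \<in> carrier_mat n n \<Longrightarrow> mlim (\<lambda>s. s \<cdot>\<^sub>m 1\<^sub>m n - A) (z \<cdot>\<^sub>m 1\<^sub>m n - A) (at z within T)"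
  by (auto simp: mlim_def intro!: tendsto_intros)

lemma realization_carrier:
  assumes "realization m n A B C D G"
  shows "A \<in> carrier_mat n n" "B \<in> carrier_mat n m" "C \<in> carrier_mat m n" "D \<in> carrier_mat m m"
    "cmat A \<in> carrier_mat n n" "cmat B \<in> carrier_mat n m" "cmat C \<in> carrier_mat m n" "cmat D \<in> carrier_mat m m"
  using assms by (auto simp: realization_def)

lemma realization_mv:
  assumes "realization m n A B C D G" and d: "det (s \<cdot>\<^sub>m 1\<^sub>m n - cmat A) \<noteq> 0"
  shows "mv (G s) v = rv C (mv (mat_inv (s \<cdot>\<^sub>m 1\<^sub>m n - cmat A)) (rv B v)) + rv D v"
proof -
  note car = realization_carrier[OF assms(1)]
  have "s \<cdot>\<^sub>m 1\<^sub>m n - cmat A \<in> carrier_mat n n" using car by auto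
  note i = mat_inv(1)[OF this d]
  have "G s = cmat C * mat_inv (s \<cdot>\<^sub>m 1\<^sub>m n - cmat A) * cmat B + cmat D"
    using assms by (auto simp: realization_def)
  then show ?thesis using car i
    by (simp add: mv_mat_add[of _ m m] mv_mult[of _ m n _ m] mv_mult[of _ n n _ m])
qed

lemma realization_output:
  assumes r: "realization m n A B C D G" and d: "det (s \<cdot>\<^sub>m 1\<^sub>m n - cmat A) \<noteq> 0"
    and x: "supp n x" "sv s x - rv A x = rv B v"
  shows "rv C x + rv D v = mv (G s) v"
proof -
  note car = realization_carrier[OF r]
  have c: "s \<cdot>\<^sub>m 1\<^sub>m n - cmat A \<in> carrier_mat n n" using car by auto
  have "mv (s \<cdot>\<^sub>m 1\<^sub>m n - cmat A) x = rv B v" using x mv_char[OF car(5)] by simp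
  then have "x = mv (mat_inv (s \<cdot>\<^sub>m 1\<^sub>m n - cmat A)) (rv B v)"
    using mv_mat_inv(2)[OF c d x(1)] by simp
  then show ?thesis using realization_mv[OF r d] by simp
qed

text \<open>The conditions say that \<open>S * T\<close> fixes the columns of \<open>A * S\<close>
  and of \<open>B\<close>. Hence \<open>S\<close> carries solutions of the reduced state equation to
  solutions of the original one, with the same output.\<close>

lemma realization_reduce:
  assumes tf: "transfer_function_matrix m G" and r: "realization m n A B C D G"
    and S: "S \<in> carrier_mat n k" and T: "T \<in> carrier_mat k n"
    and SA: "S * (T * A * S) = A * S" and SB: "S * (T * B) = B"
  shows "realization m k (T * A * S) (T * B) (C * S) D G"
proof -
  note car = realization_carrier[OF r]
  let ?A = "T * A * S" and ?B = "T * B" and ?C = "C * S"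
  have c1: "?A \<in> carrier_mat k k" "?B \<in> carrier_mat k m" "?C \<in> carrier_mat m k" using S T car by auto
  have cS: "cmat S \<in> carrier_mat n k" using S by simp
  have cA: "cmat ?A \<in> carrier_mat k k" and cB: "cmat ?B \<in> carrier_mat k m" using c1 by simp_all
  let ?X = "\<lambda>s. s \<cdot>\<^sub>m 1\<^sub>m n - cmat A" and ?Y = "\<lambda>s. s \<cdot>\<^sub>m 1\<^sub>m k - cmat ?A"
  let ?g = "\<lambda>s v. rv ?C (mv (mat_inv (?Y s)) (rv ?B v)) + rv D v"
  have Y: "?Y s \<in> carrier_mat k k" and X: "?X s \<in> carrier_mat n n" for s
    by (rule minus_carrier_mat[OF cA], rule minus_carrier_mat[OF car(5)])
  have hS: "cmat (S * ?A) = cmat S * cmat ?A" "cmat (A * S) = cmat A * cmat S"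
    "cmat (S * ?B) = cmat S * cmat ?B" "cmat ?C = cmat C * cmat S"
    using S c1 car by (auto simp: of_real_hom.mat_hom_mult)
  have SAv: "rv S (rv ?A v) = rv A (rv S v)" for v
    by (simp only: mv_mult[OF cS cA, symmetric] mv_mult[OF car(5) cS, symmetric] hS(1,2)[symmetric] SA)
  have SBv: "rv S (rv ?B v) = rv B v" for v
    by (simp only: mv_mult[OF cS cB, symmetric] hS(3)[symmetric] SB)
  have generic: "mv (G s) v = ?g s v" if d: "det (?X s) \<noteq> 0" "det (?Y s) \<noteq> 0" for s v
  proof -
    let ?x = "mv (mat_inv (?Y s)) (rv ?B v)"
    have sx: "supp k ?x" using mat_inv(1)[OF Y d(2)] by auto
    have "mv (?Y s) ?x = rv ?B v" by (rule mv_mat_inv[OF Y d(2)]) (use c1 in auto)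
    then have "sv s ?x - rv ?A ?x = rv ?B v"
      using mv_char[of "cmat ?A" k ?x s] c1 sx by simp
    then have "rv S (sv s ?x - rv ?A ?x) = rv B v" using SBv by simp
    then have "sv s (rv S ?x) - rv A (rv S ?x) = rv B v"
      by (simp only: mv_diff mv_sv SAv)
    from realization_output[OF r d(1) _ this] cS
    have "mv (G s) v = rv C (rv S ?x) + rv D v" by auto
    then show ?thesis unfolding hS(4) mv_mult[OF car(7) cS] .
  qed
  \<comment> \<open>An eigenvalue of \<open>A\<close> that is no eigenvalue of the reduced matrix is
    not covered by the generic identity. There the right-hand side is continuous, and a transfer
    function takes its limit as its value.\<close>
  have "mv (G s) (unitv j) i = ?g s (unitv j) i" if d: "det (?Y s) \<noteq> 0" and ij: "i < m" "j < m" for s i j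
  proof -
    have Gc: "G s \<in> carrier_mat m m" for s using tf by (simp add: transfer_function_matrix_def)
    have dims: "dim_row (G s) = m" "dim_col (G s) = m" for s using Gc[of s] by auto
    obtain F where *: "\<And>s L. ((\<lambda>s. G s $$ (i,j)) \<longlongrightarrow> L) (at s) \<Longrightarrow> G s $$ (i,j) = L"
      using tf ij proper_real_rational_props[of "\<lambda>s. G s $$ (i,j)"]
      by (metis transfer_function_matrix_def)
    have mt: "mlim ?Y (?Y s) (at s)" by (rule mlim_char) (use c1 in auto)
    note vl = vlim_mat_inv[OF Y Y mt d vlim_const]
    have "vlim (\<lambda>s. ?g s (unitv j)) (?g s (unitv j)) (at s)"
      by (intro vlim_add vlim_mv vlim_const vl(2))
    then have "((\<lambda>s. ?g s (unitv j) i) \<longlongrightarrow> ?g s (unitv j) i) (at s)" by (simp add: vlim_def)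
    moreover have "\<forall>\<^sub>F s in at s. ?g s (unitv j) i = G s $$ (i,j)"
      using vl(1) eventually_char_nonzero[OF car(5), of s]
    proof eventually_elim
      case (elim s)
      show ?case using generic[OF elim(2,1), of "unitv j"] ij dims by (metis mv_unitv)
    qed
    ultimately have "((\<lambda>s. G s $$ (i,j)) \<longlongrightarrow> ?g s (unitv j) i) (at s)"
      by (rule Lim_transform_eventually)
    from *[OF this] show ?thesis using ij dims by (metis mv_unitv)
  qed
  moreover have "mv (cmat ?C * mat_inv (?Y s) * cmat ?B + cmat D) v = ?g s v" if d: "det (?Y s) \<noteq> 0" for s v
    using c1 car mat_inv(1)[OF Y d] by (simp add: mv_mat_add[of _ m m] mv_mult[of _ m k _ m] mv_mult[of _ k k _ m])
  ultimately have eq: "mv (G s) (unitv j) i = mv (cmat ?C * mat_inv (?Y s) * cmat ?B + cmat D) (unitv j) i"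
    if "det (?Y s) \<noteq> 0" "i < m" "j < m" for s i j using that by simp
  have "G s = cmat ?C * mat_inv (?Y s) * cmat ?B + cmat D" if d: "det (?Y s) \<noteq> 0" for s
  proof (rule eq_matI)
    let ?R = "cmat ?C * mat_inv (?Y s) * cmat ?B + cmat D"
    have R: "dim_row ?R = m" "dim_col ?R = m" using car by auto
    have Gd: "dim_row (G s) = m" "dim_col (G s) = m" using tf by (auto simp: transfer_function_matrix_def)
    show "dim_row (G s) = dim_row ?R" "dim_col (G s) = dim_col ?R" using R Gd by simp_all
    fix i j assume "i < dim_row ?R" "j < dim_col ?R"
    then have ij: "i < m" "j < m" using R by auto
    show "G s $$ (i,j) = ?R $$ (i,j)"
      using eq[OF d ij] mv_unitv[of i "G s" j] mv_unitv[of i ?R j] ij R Gd by simp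
  qed
  then show ?thesis unfolding realization_def using c1 car by auto
qed

text \<open>Row reduction of the pair \<open>a\<close>, \<open>b\<close>: \<open>\<alpha>\<close>
  has pivot 1 at \<open>k\<close>, and \<open>\<beta>\<close> has pivot 1 at \<open>l\<close> if the
  rows are independent, so the coefficients of \<open>a\<close> and \<open>b\<close> are their
  entries at the pivots. If \<open>b\<close> is a multiple of \<open>a\<close>, then
  \<open>\<beta> = 0\<close> and \<open>l = k\<close> is a dummy value.\<close>

lemma two_vectors_echelon:
  fixes a b :: "nat \<Rightarrow> real"
  assumes "k < n" "a k \<noteq> 0"
  obtains l \<alpha> \<beta> c1 c2 d1 d2 where "l < n" "\<alpha> k = 1" "\<beta> k = 0"
    "\<And>i. i < n \<Longrightarrow> a i = a k * \<alpha> i + a l * \<beta> i" "\<And>i. i < n \<Longrightarrow> b i = b k * \<alpha> i + b l * \<beta> i"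
    "\<And>i. \<alpha> i = c1 * a i + c2 * b i" "\<And>i. \<beta> i = d1 * a i + d2 * b i"
proof -
  define b' where "b' = (\<lambda>i. b i - b k / a k * a i)"
  show ?thesis
  proof (cases "\<forall>i<n. b' i = 0")
    case True
    show ?thesis
      by (rule that[of k "\<lambda>i. a i / a k" "\<lambda>_. 0" "1 / a k" 0 0 0])
        (use True assms in \<open>auto simp: b'_def field_simps\<close>)
  next
    case False
    then obtain l where l: "l < n" "b' l \<noteq> 0" by blast
    define \<beta> where "\<beta> = (\<lambda>i. b' i / b' l)"
    define \<alpha> where "\<alpha> = (\<lambda>i. a i / a k - a l / a k * \<beta> i)"
    have "b k * \<alpha> i + b l * \<beta> i = b i" for i
    proof -
      have "b k * \<alpha> i + b l * \<beta> i = b k / a k * a i + b' l * \<beta> i"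
        by (simp add: \<alpha>_def b'_def algebra_simps)
      also have "b' l * \<beta> i = b' i" using l by (simp add: \<beta>_def)
      finally show ?thesis by (simp add: b'_def)
    qed
    then have b_eq: "b i = b k * \<alpha> i + b l * \<beta> i" for i by simp
    have b'i: "b' i = b i - b k / a k * a i" for i by (simp add: b'_def)
    define d1 d2 where "d1 = - (b k / a k) / b' l" and "d2 = 1 / b' l"
    have \<beta>_eq: "\<beta> i = d1 * a i + d2 * b i" for i
      by (simp add: \<beta>_def d1_def d2_def b'i[of i] diff_divide_distrib)
    have \<alpha>_eq: "\<alpha> i = (1 / a k - a l / a k * d1) * a i + (- (a l / a k) * d2) * b i" for i
      unfolding \<alpha>_def \<beta>_eq[of i] by (simp add: algebra_simps)
    have a_eq: "a i = a k * \<alpha> i + a l * \<beta> i" for i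
      using assms by (simp add: \<alpha>_def right_diff_distrib)
    have \<beta>k: "\<beta> k = 0" using assms by (simp add: \<beta>_def b'_def)
    then have "\<alpha> k = 1" using assms by (simp add: \<alpha>_def)
    from that[OF l(1) this \<beta>k a_eq b_eq \<alpha>_eq \<beta>_eq] show ?thesis .
  qed
qed

text \<open>The functionals \<open>a\<close> and \<open>b\<close> span a left-invariant space of
  \<open>A\<close> that annihilates \<open>B\<close>, so everything reachable lies in their common
  kernel. The state dimension is lowered by one only, even if the two are independent; this already
  contradicts minimality.\<close>

lemma deflation:
  fixes A B :: "real mat"
  assumes A: "A \<in> carrier_mat n n" and B: "B \<in> carrier_mat n m" and k: "k < n" "a k \<noteq> 0"
    and aA: "\<And>j. j < n \<Longrightarrow> (\<Sum>i<n. a i * A $$ (i,j)) = p1 * a j + q1 * b j"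
    and bA: "\<And>j. j < n \<Longrightarrow> (\<Sum>i<n. b i * A $$ (i,j)) = p2 * a j + q2 * b j"
    and aB: "\<And>j. j < m \<Longrightarrow> (\<Sum>i<n. a i * B $$ (i,j)) = 0"
    and bB: "\<And>j. j < m \<Longrightarrow> (\<Sum>i<n. b i * B $$ (i,j)) = 0"
  obtains S T where "S \<in> carrier_mat n (n - 1)" "T \<in> carrier_mat (n - 1) n"
    "S * (T * A * S) = A * S" "S * (T * B) = B"
proof -
  obtain l \<alpha> \<beta> c1 c2 d1 d2 where l: "l < n" and e: "\<alpha> k = 1" "\<beta> k = 0"
    and ae: "\<And>i. i < n \<Longrightarrow> a i = a k * \<alpha> i + a l * \<beta> i" and be: "\<And>i. i < n \<Longrightarrow> b i = b k * \<alpha> i + b l * \<beta> i"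
    and \<alpha>: "\<And>i. \<alpha> i = c1 * a i + c2 * b i" and \<beta>: "\<And>i. \<beta> i = d1 * a i + d2 * b i"
    using two_vectors_echelon[of k n a b, OF k] by metis
  (* Q projects onto the common kernel of a and b and kills the k-th unit vector, so it factors
     through dimension n - 1. *)
  define Q where "Q = (\<lambda>i j. (if i = j then 1 else 0) - (if i = k then \<alpha> j else 0) - (if i = l then \<beta> j else 0))"
  have Qsum: "(\<Sum>r<n. Q i r * M r) = M i" if "i < n" "(\<Sum>r<n. a r * M r) = 0" "(\<Sum>r<n. b r * M r) = 0" for i M
  proof -
    have "(\<Sum>r<n. \<alpha> r * M r) = c1 * (\<Sum>r<n. a r * M r) + c2 * (\<Sum>r<n. b r * M r)"
      "(\<Sum>r<n. \<beta> r * M r) = d1 * (\<Sum>r<n. a r * M r) + d2 * (\<Sum>r<n. b r * M r)"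
      unfolding \<alpha> \<beta> by (simp_all add: sum.distrib sum_distrib_left algebra_simps)
    moreover have "(\<Sum>r<n. Q i r * M r) = (\<Sum>r<n. if i = r then M r else 0)
        - (if i = k then \<Sum>r<n. \<alpha> r * M r else 0) - (if i = l then \<Sum>r<n. \<beta> r * M r else 0)"
      unfolding Q_def by (simp add: left_diff_distrib sum_subtractf if_distrib[of "\<lambda>c. c * _"] cong: if_cong)
    ultimately show ?thesis using that by simp
  qed
  have delta: "(\<Sum>j<n. f j * (if j = c then y else 0)) = f c * y" if "c < n" for f :: "nat \<Rightarrow> real" and c y
    using that by (simp add: if_distrib[of "\<lambda>c. _ * c"] cong: if_cong)
  have aQ: "(\<Sum>j<n. a j * Q j c) = 0" "(\<Sum>j<n. b j * Q j c) = 0" if "c < n" for c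
    unfolding Q_def right_diff_distrib sum_subtractf delta[OF that] delta[OF k(1)] delta[OF l]
    using ae[OF that] be[OF that] by simp_all
  \<comment> \<open>\<open>\<sigma>\<close> enumerates the indices other than \<open>k\<close>.
    Column \<open>k\<close> of \<open>Q\<close> is zero, because \<open>\<alpha> k = 1\<close> and
    \<open>\<beta> k = 0\<close>, so omitting it does not change the product
    \<open>S * T = Q\<close>.\<close>
  define \<sigma> where "\<sigma> = (\<lambda>j. if j < k then j else Suc j)"
  have \<sigma>: "\<sigma> j < n" if "j < n - 1" for j using that k by (auto simp: \<sigma>_def)
  define S where "S = mat n (n - 1) (\<lambda>(i,j). Q i (\<sigma> j))"
  define T where "T = mat (n - 1) n (\<lambda>(i,j). if j = \<sigma> i then 1 else 0 :: real)"
  have S: "S \<in> carrier_mat n (n - 1)" and T: "T \<in> carrier_mat (n - 1) n" by (auto simp: S_def T_def)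
  have ST: "S * T = mat n n (\<lambda>(i,j). Q i j)"
  proof (rule eq_matI)
    fix i j assume "i < dim_row (mat n n (\<lambda>(i,j). Q i j))" "j < dim_col (mat n n (\<lambda>(i,j). Q i j))"
    then have ij: "i < n" "j < n" by auto
    have "(S * T) $$ (i,j) = (\<Sum>r<n - 1. if j = \<sigma> r then Q i (\<sigma> r) else 0)"
      using ij by (auto simp: S_def T_def scalar_prod_def if_distrib[of "\<lambda>c. _ * c"] lessThan_atLeast0 cong: if_cong intro!: sum.cong)
    also have "\<dots> = Q i j"
    proof (cases "j = k")
      case True
      then have "j \<noteq> \<sigma> r" for r by (auto simp: \<sigma>_def)
      moreover have "Q i j = 0" using e True by (auto simp: Q_def)
      ultimately show ?thesis by simp
    next
      case False
      define r0 where "r0 = (if j < k then j else j - 1)"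
      have r0: "j = \<sigma> r \<longleftrightarrow> r = r0" for r using False by (auto simp: \<sigma>_def r0_def)
      have "r0 < n - 1" using ij k False by (auto simp: r0_def)
      moreover have "\<sigma> r0 = j" using r0[of r0] by simp
      ultimately show ?thesis by (simp add: r0 cong: if_cong)
    qed
    finally show "(S * T) $$ (i,j) = mat n n (\<lambda>(i,j). Q i j) $$ (i,j)" using ij by simp
  qed (auto simp: S_def T_def)
  have fixQ: "S * T * M = M" if M: "M \<in> carrier_mat n c"
    and z: "\<And>j. j < c \<Longrightarrow> (\<Sum>r<n. a r * M $$ (r,j)) = 0" "\<And>j. j < c \<Longrightarrow> (\<Sum>r<n. b r * M $$ (r,j)) = 0" for M c
    unfolding ST
  proof (rule eq_matI)
    fix i j assume "i < dim_row M" "j < dim_col M"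
    then have ij: "i < n" "j < c" using M by auto
    have "(mat n n (\<lambda>(i,j). Q i j) * M) $$ (i,j) = (\<Sum>r<n. Q i r * M $$ (r,j))"
      using ij M by (auto simp: scalar_prod_def lessThan_atLeast0 intro!: sum.cong)
    then show "(mat n n (\<lambda>(i,j). Q i j) * M) $$ (i,j) = M $$ (i,j)" using Qsum z ij by simp
  qed (use M in auto)
  have AS: "A * S \<in> carrier_mat n (n - 1)" using A S by auto
  have row: "(\<Sum>r<n. f r * (A * S) $$ (r,j)) = (\<Sum>c<n. (\<Sum>r<n. f r * A $$ (r,c)) * Q c (\<sigma> j))"
    if "j < n - 1" for f j
  proof -
    have "(\<Sum>r<n. f r * (A * S) $$ (r,j)) = (\<Sum>r<n. \<Sum>c<n. f r * A $$ (r,c) * Q c (\<sigma> j))"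
      using that A S by (auto simp: S_def scalar_prod_def lessThan_atLeast0 sum_distrib_left mult.assoc intro!: sum.cong)
    also have "\<dots> = (\<Sum>c<n. \<Sum>r<n. f r * A $$ (r,c) * Q c (\<sigma> j))" by (rule sum.swap)
    finally show ?thesis by (simp add: sum_distrib_right)
  qed
  have lin: "(\<Sum>c<n. (p * a c + q * b c) * Q c j) = 0" if "j < n" for p q j
    using aQ[OF that] by (simp add: algebra_simps sum.distrib flip: sum_distrib_left)
  have "S * T * (A * S) = A * S"
    by (rule fixQ[OF AS]) (simp_all add: row aA bA lin \<sigma>)
  moreover have "S * T * B = B" by (rule fixQ[OF B]) (simp_all add: aB bB)
  moreover have "S * (T * A * S) = S * T * (A * S)"
    unfolding assoc_mult_mat[OF T A S] assoc_mult_mat[OF S T AS] ..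
  moreover have "S * (T * B) = S * T * B" unfolding assoc_mult_mat[OF S T B] ..
  ultimately show ?thesis using that[OF S T] by metis
qed

text \<open>The eigenvector test of Popov, Belevitch and Hautus. The real and imaginary parts of a
  nonzero \<open>w\<close> would span a real left-invariant space that annihilates \<open>B\<close>,
  and deflation along it would give a smaller realization.\<close>

lemma minimal_realization_controllable:
  assumes tf: "transfer_function_matrix m G" and min: "minimal_realization m n A B C D G"
    and w: "supp n w" "rv (A\<^sup>T) w = sv z w" "rv (B\<^sup>T) w = 0"
  shows "w = 0"
proof (rule ccontr)
  assume "w \<noteq> 0"
  have r: "realization m n A B C D G" using min by (simp add: minimal_realization_def)
  note car = realization_carrier[OF r]
  let ?a = "\<lambda>i. Re (w i)" and ?b = "\<lambda>i. Im (w i)"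
  obtain k where k: "k < n" "?a k \<noteq> 0 \<or> ?b k \<noteq> 0"
    using \<open>w \<noteq> 0\<close> supp_eqI[OF w(1), of 0] by (metis complex_eq_iff supp_intros(5) zero_complex.simps zero_fun_def)
  have A: "(\<Sum>i<n. of_real (A $$ (i,j)) * w i) = z * w j" if "j < n" for j
    using fun_cong[OF w(2), of j] that car by (simp add: mv_def sv_def)
  have B: "(\<Sum>i<n. of_real (B $$ (i,j)) * w i) = 0" if "j < m" for j
    using fun_cong[OF w(3), of j] that car by (simp add: mv_def)
  have eqs: "(\<Sum>i<n. ?a i * A $$ (i,j)) = Re z * ?a j + (- Im z) * ?b j"
    "(\<Sum>i<n. ?b i * A $$ (i,j)) = Im z * ?a j + Re z * ?b j" if "j < n" for j
    using arg_cong[OF A[OF that], of Re] arg_cong[OF A[OF that], of Im] by (simp_all add: mult.commute)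
  have eqB: "(\<Sum>i<n. ?a i * B $$ (i,j)) = 0" "(\<Sum>i<n. ?b i * B $$ (i,j)) = 0" if "j < m" for j
    using arg_cong[OF B[OF that], of Re] arg_cong[OF B[OF that], of Im] by (simp_all add: mult.commute)
  have eqs': "(\<Sum>i<n. ?a i * A $$ (i,j)) = (- Im z) * ?b j + Re z * ?a j"
    "(\<Sum>i<n. ?b i * A $$ (i,j)) = Re z * ?b j + Im z * ?a j" if "j < n" for j
    using eqs[OF that] by simp_all
  have "\<exists>S T. S \<in> carrier_mat n (n - 1) \<and> T \<in> carrier_mat (n - 1) n \<and>
      S * (T * A * S) = A * S \<and> S * (T * B) = B"
  \<comment> \<open>The pivot entry must belong to the first of the two vectors, so the parts
    exchange their roles if \<open>w k\<close> is purely imaginary.\<close>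
  proof (cases "?a k = 0")
    case False
    show ?thesis by (rule deflation[where a = "?a" and b = "?b", OF car(1,2) k(1) False eqs eqB]) blast+
  next
    case True
    then have "?b k \<noteq> 0" using k by simp
    show ?thesis by (rule deflation[where a = "?b" and b = "?a", OF car(1,2) k(1) \<open>?b k \<noteq> 0\<close> eqs'(2,1) eqB(2,1)]) blast+
  qed
  then obtain S T where "S \<in> carrier_mat n (n - 1)" "T \<in> carrier_mat (n - 1) n"
    "S * (T * A * S) = A * S" "S * (T * B) = B" by blast
  from realization_reduce[OF tf r this] min have "n \<le> n - 1"
    unfolding minimal_realization_def by blast
  then show False using k by simp
qed

lemma realization_transpose:
  assumes r: "realization m n A B C D G"
  shows "realization m n (A\<^sup>T) (C\<^sup>T) (B\<^sup>T) (D\<^sup>T) (\<lambda>s. (G s)\<^sup>T)"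
proof -
  note car = realization_carrier[OF r]
  have "(G s)\<^sup>T = cmat (B\<^sup>T) * mat_inv (s \<cdot>\<^sub>m 1\<^sub>m n - cmat (A\<^sup>T)) * cmat (C\<^sup>T) + cmat (D\<^sup>T)"
    if d: "det (s \<cdot>\<^sub>m 1\<^sub>m n - cmat (A\<^sup>T)) \<noteq> 0" for s
  proof -
    let ?X = "s \<cdot>\<^sub>m 1\<^sub>m n - cmat A" and ?Y = "s \<cdot>\<^sub>m 1\<^sub>m n - cmat (A\<^sup>T)"
    have X: "?X \<in> carrier_mat n n" and Y: "?Y \<in> carrier_mat n n" using car by auto
    have XY: "?Y = ?X\<^sup>T" using car by (intro eq_matI) auto
    have dX: "det ?X \<noteq> 0" using d det_transpose[OF X] XY by simp
    note i = mat_inv[OF X dX]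
    have "?Y * (mat_inv ?X)\<^sup>T = 1\<^sub>m n"
      using transpose_mult[OF i(1) X] i(3) XY by (metis transpose_one)
    then have iY: "mat_inv ?Y = (mat_inv ?X)\<^sup>T" using mat_inv_unique(1)[OF Y] i(1) by simp
    have "G s = cmat C * mat_inv ?X * cmat B + cmat D" using r dX by (simp add: realization_def)
    then have "(G s)\<^sup>T = (cmat C * mat_inv ?X * cmat B)\<^sup>T + (cmat D)\<^sup>T"
      using car i(1) by (simp add: transpose_add[of _ m m])
    also have "(cmat C * mat_inv ?X * cmat B)\<^sup>T = (cmat B)\<^sup>T * ((mat_inv ?X)\<^sup>T * (cmat C)\<^sup>T)"
      using car i(1) by (simp add: transpose_mult[of _ m n _ m] transpose_mult[of _ n n _ m])
    also have "\<dots> = (cmat B)\<^sup>T * (mat_inv ?X)\<^sup>T * (cmat C)\<^sup>T"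
      using car i(1) by (simp add: assoc_mult_mat[of _ m n _ n _ m])
    finally show ?thesis unfolding iY by (simp add: map_mat_transpose)
  qed
  then show ?thesis using car by (auto simp: realization_def)
qed

text \<open>Duality: transposition exchanges input and output and preserves minimality, so this is
  the controllability test for the transposed system.\<close>

lemma minimal_realization_observable:
  assumes tf: "transfer_function_matrix m G" and min: "minimal_realization m n A B C D G"
    and w: "supp n w" "rv A w = sv z w" "rv C w = 0"
  shows "w = 0"
proof (rule minimal_realization_controllable[of m "\<lambda>s. (G s)\<^sup>T" n "A\<^sup>T" "C\<^sup>T" "B\<^sup>T" "D\<^sup>T" w z])
  have G: "G s \<in> carrier_mat m m" for s using tf by (simp add: transfer_function_matrix_def)
  then have d: "dim_row (G s) = m" "dim_col (G s) = m" for s by auto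
  show "transfer_function_matrix m (\<lambda>s. (G s)\<^sup>T)"
    using tf by (auto simp: transfer_function_matrix_def d)
  show "minimal_realization m n (A\<^sup>T) (C\<^sup>T) (B\<^sup>T) (D\<^sup>T) (\<lambda>s. (G s)\<^sup>T)"
    using min realization_transpose[of m n A B C D G] realization_transpose[of m _ _ _ _ _ "\<lambda>s. (G s)\<^sup>T"]
    unfolding minimal_realization_def by (metis (no_types, lifting) transpose_transpose ext)
qed (use w in auto)

section \<open>Positive realness\<close>

lemma filterlim_cnj_at: "filterlim cnj (at (cnj p)) (at p)"
  unfolding filterlim_at by (auto intro!: tendsto_intros simp: eventually_at_filter)

lemma quadratic_form_conv:
  assumes "K \<in> carrier_mat m m"
  shows "(K *\<^sub>v vec m v) \<bullet>c vec m v = ip m (mv K v) v"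
  using assms by (auto simp: scalar_prod_def ip_def mv_eq_vec lessThan_atLeast0 intro!: sum.cong)

lemma pos_semidef_ip:
  assumes "pos_semidef K" "K \<in> carrier_mat m m"
  shows "0 \<le> Re (ip m (mv K v) v)" "Im (ip m (mv K v) v) = 0"
proof -
  have "0 \<le> (K *\<^sub>v vec m v) \<bullet>c vec m v"
    using assms by (auto simp: pos_semidef_def)
  then show "0 \<le> Re (ip m (mv K v) v)" "Im (ip m (mv K v) v) = 0"
    unfolding quadratic_form_conv[OF assms(2)] by (auto simp: less_eq_complex_def)
qed

lemma vec_eq_zero_iff: "supp m v \<Longrightarrow> vec m v = 0\<^sub>v m \<longleftrightarrow> v = 0"
proof
  assume s: "supp m v" and eq: "vec m v = 0\<^sub>v m"
  have "v i = 0" if "i < m" for i using arg_cong[OF eq, of "\<lambda>w. w $ i"] that by simp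
  then show "v = 0" using s by (intro supp_eqI[of m]) auto
qed auto

lemma pos_def_ip:
  assumes "pos_def K" "K \<in> carrier_mat m m" "supp m v" "v \<noteq> 0"
  shows "0 < Re (ip m (mv K v) v)"
proof -
  have "0 < (K *\<^sub>v vec m v) \<bullet>c vec m v"
    using assms vec_eq_zero_iff[of m v] by (auto simp: pos_def_def)
  then show ?thesis unfolding quadratic_form_conv[OF assms(2)] by (auto simp: less_complex_def)
qed

text \<open>Polarization with \<open>v + w\<close> and \<open>v + \<i> w\<close>.\<close>

lemma hermitian_ip_real:
  assumes X: "X \<in> carrier_mat m m" and im: "\<And>v. Im (ip m (mv X v) v) = 0"
  shows "ip m (mv X v) w = cnj (ip m (mv X w) v)"
proof -
  have 1: "Im (ip m (mv X v) w + ip m (mv X w) v) = 0"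
    using im[of "v + w"] im[of v] im[of w] by (simp add: mv_add ip_linear)
  have 2: "Im (- \<i> * ip m (mv X v) w + \<i> * ip m (mv X w) v) = 0"
    using im[of "v + sv \<i> w"] im[of v] im[of w] by (simp add: mv_add mv_sv ip_linear)
  show ?thesis using 1 2 by (simp add: complex_eq_iff)
qed

lemma quarter_turn: "(- \<i> * s) * (a * \<i> * q) = a * (s * q)" for a s q :: complex
  by (simp add: complex_eq_iff algebra_simps)

text \<open>Conjugate symmetry is what transports conditions stated for positive frequencies to
  negative ones, at the price of conjugating \<open>v\<close>. The other facts provide holomorphy of
  the quadratic form off a finite set of genuine poles.\<close>

lemma transfer_function_matrix_props:
  assumes tf: "transfer_function_matrix m G"
  obtains S where "finite S"
    "\<And>i j. i < m \<Longrightarrow> j < m \<Longrightarrow> (\<lambda>s. G s $$ (i,j)) holomorphic_on - S"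
    "\<And>z. z \<in> S \<Longrightarrow> mat_pole m G z"
    "\<And>v. (\<lambda>s. ip m (mv (G s) v) v) holomorphic_on - S"
    "\<And>s v. ip m (mv (G (cnj s)) v) v = cnj (ip m (mv (G s) (\<lambda>i. cnj (v i))) (\<lambda>i. cnj (v i)))"
    "\<And>s i j. i < m \<Longrightarrow> j < m \<Longrightarrow> G (cnj s) $$ (i,j) = cnj (G s $$ (i,j))"
proof -
  have d: "dim_row (G s) = m" "dim_col (G s) = m" for s using tf by (auto simp: transfer_function_matrix_def)
  have "\<forall>p \<in> {..<m} \<times> {..<m}. \<exists>S. finite S \<and> (\<lambda>s. G s $$ p) holomorphic_on - S \<and>
      (\<forall>z\<in>S. is_pole (\<lambda>s. G s $$ p) z) \<and> (\<forall>s. G (cnj s) $$ p = cnj (G s $$ p))"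
  proof
    fix p assume "p \<in> {..<m} \<times> {..<m}"
    then have "proper_real_rational (\<lambda>s. G s $$ p)" using tf by (auto simp: transfer_function_matrix_def)
    then show "\<exists>S. finite S \<and> (\<lambda>s. G s $$ p) holomorphic_on - S \<and>
        (\<forall>z\<in>S. is_pole (\<lambda>s. G s $$ p) z) \<and> (\<forall>s. G (cnj s) $$ p = cnj (G s $$ p))"
      by (rule proper_real_rational_props) blast
  qed
  then obtain S where S: "\<And>p. p \<in> {..<m} \<times> {..<m} \<Longrightarrow> finite (S p) \<and> (\<lambda>s. G s $$ p) holomorphic_on - S p \<and>
      (\<forall>z\<in>S p. is_pole (\<lambda>s. G s $$ p) z) \<and> (\<forall>s. G (cnj s) $$ p = cnj (G s $$ p))"
    by metis
  define T where "T = (\<Union>p \<in> {..<m} \<times> {..<m}. S p)"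
  have hol: "(\<lambda>s. G s $$ (i,j)) holomorphic_on - T" if "i < m" "j < m" for i j
    by (rule holomorphic_on_subset[of _ "- S (i,j)"]) (use S[of "(i,j)"] that in \<open>auto simp: T_def\<close>)
  have cnj: "G (cnj s) $$ (i,j) = cnj (G s $$ (i,j))" if "i < m" "j < m" for s i j
    using S[of "(i,j)"] that by auto
  have form: "ip m (mv (G s) v) v = (\<Sum>i<m. (\<Sum>j<m. G s $$ (i,j) * v j) * cnj (v i))" for s v
    by (simp add: ip_def mv_def d)
  show ?thesis
  proof (rule that[of T])
    show "finite T" unfolding T_def using S by (intro finite_UN_I) auto
    show "mat_pole m G z" if z: "z \<in> T" for z
    proof -
      obtain i j where "i < m" "j < m" "z \<in> S (i,j)" using z by (auto simp: T_def)
      then show ?thesis using S[of "(i,j)"] by (auto simp: mat_pole_def)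
    qed
    show "(\<lambda>s. ip m (mv (G s) v) v) holomorphic_on - T" for v
      unfolding form by (intro holomorphic_intros hol) auto
    show "ip m (mv (G (cnj s)) v) v = cnj (ip m (mv (G s) (\<lambda>i. cnj (v i))) (\<lambda>i. cnj (v i)))" for s v
      unfolding form by (simp add: cnj)
  qed (use hol cnj in auto)
qed

text \<open>Write \<open>q\<close> for the form \<open>v^* G(s) v\<close>. At
  \<open>s = \<i> x\<close> the real part of \<open>s q\<close> is \<open>- x\<close> times the
  imaginary part of \<open>q\<close>, so its sign is the NI inequality. At a pole
  \<open>\<i> x\<close> with \<open>x > 0\<close> the residue of \<open>s q\<close> is
  \<open>x v^* K v\<close>, at 0 it is \<open>v^* G2 v\<close>, and strict properness supplies the
  decay at infinity.\<close>

lemma ni_positive_real: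
  assumes tf: "transfer_function_matrix m G" and ni: "negative_imaginary m G"
    and sp: "strictly_proper m G"
    and G2: "G2 \<in> carrier_mat m m" "mlim (\<lambda>s. s\<^sup>2 \<cdot>\<^sub>m G s) G2 (at 0)"
    and psd: "\<And>v. 0 \<le> Re (ip m (mv G2 v) v)" "\<And>v. Im (ip m (mv G2 v) v) = 0"
    and s: "0 < Re s"
  shows "0 \<le> Re (s * ip m (mv (G s) v) v)"
proof -
  have Gc: "G s \<in> carrier_mat m m" for s using tf by (simp add: transfer_function_matrix_def)
  obtain S where S: "finite S" and hol: "\<And>i j. i < m \<Longrightarrow> j < m \<Longrightarrow> (\<lambda>s. G s $$ (i,j)) holomorphic_on - S"
    and pole: "\<And>z. z \<in> S \<Longrightarrow> mat_pole m G z"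
    and holq: "\<And>v. (\<lambda>s. ip m (mv (G s) v) v) holomorphic_on - S"
    and conj: "\<And>s v. ip m (mv (G (cnj s)) v) v = cnj (ip m (mv (G s) (\<lambda>i. cnj (v i))) (\<lambda>i. cnj (v i)))"
    by (rule transfer_function_matrix_props[OF tf]) (rule that)
  let ?f = "\<lambda>v s. s * ip m (mv (G s) v) v"
  \<comment> \<open>Adding the conjugates makes the exceptional set symmetric, so that an admissible
    point of the negative half axis reflects to an admissible one.\<close>
  define S' where "S' = S \<union> cnj ` S"
  have oS: "open (- S)" using S by (simp add: finite_imp_closed open_Compl)
  have axis_pos: "0 \<le> Re (?f v (\<i> * of_real x))" if x: "x > 0" "\<i> * of_real x \<notin> S" for v and x :: real
  proof -
    let ?z = "\<i> * of_real x"
    have "\<not> is_pole (\<lambda>s. G s $$ (i,j)) ?z" if "i < m" "j < m" for i j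
      by (rule not_is_pole_holomorphic[OF oS _ hol[OF that]]) (use x in auto)
    then have "\<not> mat_pole m G ?z" by (auto simp: mat_pole_def)
    then have "pos_semidef (\<i> \<cdot>\<^sub>m (G ?z - mat_adjoint (G ?z)))"
      using ni x(1) by (auto simp: negative_imaginary_def)
    moreover have "\<i> \<cdot>\<^sub>m (G ?z - mat_adjoint (G ?z)) \<in> carrier_mat m m"
      by (intro smult_carrier_mat minus_carrier_mat mat_adjoint_carrier Gc)
    ultimately have "0 \<le> Re (ip m (mv (\<i> \<cdot>\<^sub>m (G ?z - mat_adjoint (G ?z))) v) v)" by (rule pos_semidef_ip)
    then have "0 \<le> Re (\<i> * (ip m (mv (G ?z) v) v - ip m (mv (mat_adjoint (G ?z)) v) v))"
      using Gc by (auto simp: mv_smult mv_mat_diff[of _ m m] ip_linear)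
    moreover have "ip m (mv (mat_adjoint (G ?z)) v) v = cnj (ip m (mv (G ?z) v) v)"
      using ip_adjoint[OF Gc] ip_commute by metis
    ultimately show ?thesis using x by (simp add: mult_nonneg_nonpos)
  qed
  have lim_pos: "\<exists>r\<ge>0. ((\<lambda>s. (s - \<i> * of_real x) * ?f v s) \<longlongrightarrow> of_real r) (at (\<i> * of_real x))"
    if x: "x > 0" for v and x :: real
  proof (cases "mat_pole m G (\<i> * of_real x)")
    case True
    let ?z = "\<i> * of_real x"
    obtain K where K: "K \<in> carrier_mat m m" "mlim (\<lambda>s. ((s - ?z) * \<i>) \<cdot>\<^sub>m G s) K (at ?z)" "pos_semidef K"
      using ni x True unfolding negative_imaginary_def mat_tendsto_eq_mlim by blast
    have "vlim (\<lambda>s. mv (((s - ?z) * \<i>) \<cdot>\<^sub>m G s) v) (mv K v) (at ?z)"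
      by (rule vlim_mat_mv[OF K(2) _ K(1)]) (use Gc in auto)
    \<comment> \<open>The factor \<open>- \<i> * s\<close> converts the normalization of
      \<open>K\<close> into that of a residue of \<open>s G\<close>; at the pole it equals the
      positive number \<open>x\<close>.\<close>
    then have "((\<lambda>s. (- \<i> * s) * ip m (mv (((s - ?z) * \<i>) \<cdot>\<^sub>m G s) v) v) \<longlongrightarrow> (- \<i> * ?z) * ip m (mv K v) v) (at ?z)"
      by (intro tendsto_intros vlim_ip) auto
    moreover have "(- \<i> * s) * ip m (mv (((s - ?z) * \<i>) \<cdot>\<^sub>m G s) v) v = (s - ?z) * ?f v s" for s
      unfolding mv_smult ip_sv_left by (rule quarter_turn)
    moreover have "(- \<i> * ?z) * ip m (mv K v) v = of_real (x * Re (ip m (mv K v) v))"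
      using pos_semidef_ip(2)[OF K(3,1)] by (simp add: complex_eq_iff)
    ultimately show ?thesis using pos_semidef_ip(1)[OF K(3,1)] x
      by (intro exI[of _ "x * Re (ip m (mv K v) v)"]) simp
  next
    case False
    let ?z = "\<i> * of_real x"
    have "?z \<notin> S" using pole False by blast
    then have "isCont (\<lambda>s. ip m (mv (G s) v) v) ?z"
      using holomorphic_on_imp_continuous_on[OF holq] oS by (simp add: continuous_on_eq_continuous_at)
    then have "((\<lambda>s. (s - ?z) * ?f v s) \<longlongrightarrow> (?z - ?z) * (?z * ip m (mv (G ?z) v) v)) (at ?z)"
      unfolding isCont_def by (intro tendsto_intros)
    then show ?thesis by (intro exI[of _ 0]) auto
  qed
  have neg: "?f v s = cnj (?f (\<lambda>i. cnj (v i)) (cnj s))" for v s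
    using conj[of "cnj s" v] by simp
  show ?thesis
  proof (rule positive_real_from_boundary(1)[of S', OF _ _ _ _ _ _ s])
    show "finite S'" using S by (simp add: S'_def)
    show "?f v holomorphic_on - S'"
      by (intro holomorphic_intros holomorphic_on_subset[OF holq]) (auto simp: S'_def)
    show "Re z \<le> 0" if "z \<in> S'" for z
    proof -
      have "\<forall>s. Re s > 0 \<longrightarrow> \<not> mat_pole m G s" using ni unfolding negative_imaginary_def by (rule conjunct1)
      then have "Re z \<le> 0" if "z \<in> S" for z using pole[OF that] by (meson not_le)
      then show ?thesis using that by (auto simp: S'_def)
    qed
    show "0 \<le> Re (?f v (\<i> * of_real x))" if x: "\<i> * of_real x \<notin> S'" for x :: real
    proof -
      consider "x > 0" | "x = 0" | "x < 0" by linarith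
      then show ?thesis
      proof cases
        case 1 then show ?thesis using axis_pos x by (auto simp: S'_def)
      next
        case 3
        have "\<i> * of_real (- x) \<notin> S"
        proof
          assume "\<i> * of_real (- x) \<in> S"
          then have "cnj (\<i> * of_real (- x)) \<in> S'" unfolding S'_def by blast
          then show False using x by simp
        qed
        moreover have "0 < - x" using 3 by simp
        ultimately have "0 \<le> Re (?f (\<lambda>i. cnj (v i)) (\<i> * of_real (- x)))" by (intro axis_pos)
        moreover have "cnj (\<i> * of_real x) = \<i> * of_real (- x)" by simp
        ultimately show ?thesis unfolding neg[where v = v and s = "\<i> * of_real x"] by (simp only: cnj.simps)
      qed simp
    qed
    show "\<exists>r\<ge>0. ((\<lambda>s. (s - \<i> * of_real x) * ?f v s) \<longlongrightarrow> of_real r) (at (\<i> * of_real x))" for x :: real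
    proof -
      consider "x > 0" | "x = 0" | "x < 0" by linarith
      then show ?thesis
      proof cases
        case 1 then show ?thesis by (rule lim_pos)
      next
        case 2
        have "vlim (\<lambda>s. mv (s\<^sup>2 \<cdot>\<^sub>m G s) v) (mv G2 v) (at 0)"
          by (rule vlim_mat_mv[OF G2(2) _ G2(1)]) (use Gc in auto)
        then have "((\<lambda>s. ip m (mv (s\<^sup>2 \<cdot>\<^sub>m G s) v) v) \<longlongrightarrow> ip m (mv G2 v) v) (at 0)" by (intro vlim_ip) auto
        moreover have "ip m (mv (s\<^sup>2 \<cdot>\<^sub>m G s) v) v = s * ?f v s" for s
          by (simp add: mv_smult ip_linear power2_eq_square)
        moreover have "ip m (mv G2 v) v = of_real (Re (ip m (mv G2 v) v))" using psd by (simp add: complex_eq_iff)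
        ultimately have "((\<lambda>s. (s - \<i> * of_real x) * ?f v s) \<longlongrightarrow> of_real (Re (ip m (mv G2 v) v))) (at (\<i> * of_real x))"
          using 2 by simp
        then show ?thesis using psd(1) by blast
      next
        case 3
        let ?z = "\<i> * of_real (- x)"
        obtain r where r: "r \<ge> 0" "((\<lambda>s. (s - ?z) * ?f (\<lambda>i. cnj (v i)) s) \<longlongrightarrow> of_real r) (at ?z)"
          using lim_pos[of "- x" "\<lambda>i. cnj (v i)"] 3 by auto
        have "cnj (\<i> * of_real x) = ?z" by simp
        then have "filterlim cnj (at ?z) (at (\<i> * of_real x))" using filterlim_cnj_at by metis
        from tendsto_cnj[OF filterlim_compose[OF r(2) this]]
        have "((\<lambda>s. cnj ((cnj s - ?z) * ?f (\<lambda>i. cnj (v i)) (cnj s))) \<longlongrightarrow> of_real r) (at (\<i> * of_real x))" by simp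
        moreover have "cnj ((cnj s - ?z) * ?f (\<lambda>i. cnj (v i)) (cnj s)) = (s - \<i> * of_real x) * ?f v s" for s
          unfolding neg[where v = v and s = s] by simp
        ultimately have "((\<lambda>s. (s - \<i> * of_real x) * ?f v s) \<longlongrightarrow> of_real r) (at (\<i> * of_real x))"
          by (simp only:)
        then show ?thesis using r(1) by blast
      qed
    qed
    have "vlim (\<lambda>s. mv (G s) v) (mv (0\<^sub>m m m) v) at_infinity"
      by (rule vlim_mat_mv[OF _ Gc]) (use sp in \<open>auto simp: strictly_proper_def mat_tendsto_eq_mlim\<close>)
    then have "((\<lambda>s. ip m (mv (G s) v) v) \<longlongrightarrow> 0) at_infinity" using vlim_ip[of _ 0 _ "\<lambda>_. v" v] by force
    then show "((\<lambda>s. ?f v s / s) \<longlongrightarrow> 0) at_infinity"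
    proof (rule Lim_transform_eventually)
      show "\<forall>\<^sub>F s in at_infinity. ip m (mv (G s) v) v = ?f v s / s"
        unfolding eventually_at_infinity by (intro exI[of _ 1]) auto
    qed
  qed
qed

lemma realization_at_infinity:
  assumes r: "realization m n A B C D G"
  shows "vlim (\<lambda>s. mv (G s) v) (rv D v) at_infinity"
proof -
  note car = realization_carrier[OF r]
  obtain K where K: "\<And>z. eigenvalue (cmat A) z \<Longrightarrow> norm z \<le> K"
    using finite_imp_bounded[OF finite_eigenvalues[OF car(5)]] by (auto simp: bounded_iff)
  have "\<forall>\<^sub>F s in at_infinity. rv C (mv (mat_inv (s \<cdot>\<^sub>m 1\<^sub>m n - cmat A)) (rv B v)) + rv D v = mv (G s) v"
    unfolding eventually_at_infinity
  proof (intro exI[of _ "K + 1"] allI impI)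
    fix s :: complex assume "K + 1 \<le> norm s"
    then have "det (s \<cdot>\<^sub>m 1\<^sub>m n - cmat A) \<noteq> 0" using K[of s] det_char_nonzero_iff[OF car(5)] by force
    from realization_mv[OF r this]
    show "rv C (mv (mat_inv (s \<cdot>\<^sub>m 1\<^sub>m n - cmat A)) (rv B v)) + rv D v = mv (G s) v" by simp
  qed
  moreover have "vlim (\<lambda>s. rv C (mv (mat_inv (s \<cdot>\<^sub>m 1\<^sub>m n - cmat A)) (rv B v)) + rv D v)
      (rv C 0 + rv D v) at_infinity"
    by (intro vlim_add vlim_mv resolvent_tendsto_zero[OF car(5)] vlim_const)
  ultimately show ?thesis by (auto intro: vlim_cong)
qed

lemma strictly_proper_D_zero:
  assumes tf: "transfer_function_matrix m G" and r: "realization m n A B C D G" and sp: "strictly_proper m G"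
  shows "D = 0\<^sub>m m m"
proof (rule eq_matI)
  note car = realization_carrier[OF r]
  fix i j assume "i < dim_row (0\<^sub>m m m :: real mat)" "j < dim_col (0\<^sub>m m m :: real mat)"
  then have ij: "i < m" "j < m" by auto
  have Gc: "G s \<in> carrier_mat m m" for s using tf by (simp add: transfer_function_matrix_def)
  have "vlim (\<lambda>s. mv (G s) (unitv j)) (mv (0\<^sub>m m m) (unitv j)) at_infinity"
    by (rule vlim_mat_mv[OF _ Gc]) (use sp in \<open>auto simp: strictly_proper_def mat_tendsto_eq_mlim\<close>)
  from vlim_unique[OF realization_at_infinity[OF r] this trivial_limit_at_infinity] have "rv D (unitv j) = 0" by simp
  then show "D $$ (i,j) = 0\<^sub>m m m $$ (i,j)" using mv_unitv[of i "cmat D" j] car ij by simp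
qed (use realization_carrier[OF r] in auto)

text \<open>The form of \<open>M\<close> is real, so on the imaginary axis it drops out of the real
  part of the quotient; what remains is the SNI inequality divided by the frequency. The singularity
  of the quotient at 0 has residue 0, because \<open>M\<close> is the value of \<open>G\<close>
  there. Strictness inside the half plane comes from the equality case of the minimum
  principle.\<close>

lemma sni_positive_real:
  assumes tf: "transfer_function_matrix m G" and sni: "strictly_negative_imaginary m G"
    and r: "realization m n A B C D G"
  defines "M \<equiv> cmat (dc_gain G)"
  shows "M \<in> carrier_mat m m"
    and "Im (ip m (mv M v) v) = 0"
    and "0 < Re s \<Longrightarrow> supp m v \<Longrightarrow> v \<noteq> 0 \<Longrightarrow> 0 < Re ((ip m (mv M v) v - ip m (mv (G s) v) v) / s)"
    and "Re s = 0 \<Longrightarrow> s \<noteq> 0 \<Longrightarrow> supp m v \<Longrightarrow> v \<noteq> 0 \<Longrightarrow>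
      0 < Re ((ip m (mv M v) v - ip m (mv (G s) v) v) / s)"
    and "0 \<le> Re s \<Longrightarrow> mlim G (G s) (at s)"
    and "G 0 = M"
proof -
  have Gc: "G s \<in> carrier_mat m m" for s using tf by (simp add: transfer_function_matrix_def)
  obtain S where S: "finite S" and hol: "\<And>i j. i < m \<Longrightarrow> j < m \<Longrightarrow> (\<lambda>s. G s $$ (i,j)) holomorphic_on - S"
    and pole: "\<And>z. z \<in> S \<Longrightarrow> mat_pole m G z"
    and holq: "\<And>v. (\<lambda>s. ip m (mv (G s) v) v) holomorphic_on - S"
    and conj: "\<And>s v. ip m (mv (G (cnj s)) v) v = cnj (ip m (mv (G s) (\<lambda>i. cnj (v i))) (\<lambda>i. cnj (v i)))"
    and cnj: "\<And>s i j. i < m \<Longrightarrow> j < m \<Longrightarrow> G (cnj s) $$ (i,j) = cnj (G s $$ (i,j))"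
    by (rule transfer_function_matrix_props[OF tf]) (rule that)
  have oS: "open (- S)" using S by (simp add: finite_imp_closed open_Compl)
  have Sneg: "Re z < 0" if "z \<in> S" for z
  proof -
    have "\<forall>s. Re s \<ge> 0 \<longrightarrow> \<not> mat_pole m G s" using sni unfolding strictly_negative_imaginary_def by (rule conjunct1)
    then show ?thesis using pole[OF that] by (meson not_le)
  qed
  show "M \<in> carrier_mat m m" using Gc[of 0] by (simp add: M_def dc_gain_def)
  then have Md: "dim_row M = m" "dim_col M = m" by auto
  have Gd: "dim_row (G 0) = m" "dim_col (G 0) = m" using Gc[of 0] by auto
  show G0: "G 0 = M"
  proof (rule eq_matI)
    fix i j assume "i < dim_row M" "j < dim_col M"
    then have ij: "i < m" "j < m" using Md by auto
    have "Im (G 0 $$ (i,j)) = 0" using arg_cong[OF cnj[OF ij, of 0], of Im] by simp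
    then show "G 0 $$ (i,j) = M $$ (i,j)" using ij Gd by (simp add: M_def dc_gain_def complex_eq_iff)
  qed (use Md Gd in auto)
  have cont: "((\<lambda>s. ip m (mv (G s) v) v) \<longlongrightarrow> ip m (mv (G s) v) v) (at s)" if "0 \<le> Re s" for s v
  proof -
    have "s \<notin> S" using Sneg[of s] that by auto
    then have "isCont (\<lambda>s. ip m (mv (G s) v) v) s"
      using holomorphic_on_imp_continuous_on[OF holq] oS by (simp add: continuous_on_eq_continuous_at)
    then show ?thesis by (simp add: isCont_def)
  qed
  show "mlim G (G s) (at s)" if "0 \<le> Re s"
    unfolding mlim_def
  proof (intro allI impI)
    fix i j assume "i < dim_row (G s)" "j < dim_col (G s)"
    then have ij: "i < m" "j < m" using Gc[of s] by auto
    have "s \<notin> S" using Sneg[of s] that by auto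
    then have "isCont (\<lambda>s. G s $$ (i,j)) s"
      using holomorphic_on_imp_continuous_on[OF hol[OF ij]] oS by (simp add: continuous_on_eq_continuous_at)
    then show "((\<lambda>s. G s $$ (i,j)) \<longlongrightarrow> G s $$ (i,j)) (at s)" by (simp add: isCont_def)
  qed
  have form: "ip m (mv (\<i> \<cdot>\<^sub>m (G z - mat_adjoint (G z))) v) v = of_real (- 2 * Im (ip m (mv (G z) v) v))" for z v
  proof -
    have "ip m (mv (mat_adjoint (G z)) v) v = cnj (ip m (mv (G z) v) v)"
      using ip_adjoint[OF Gc] ip_commute by metis
    then show ?thesis
      using Gc by (simp add: mv_smult mv_mat_diff[of _ m m] ip_linear complex_eq_iff)
  qed
  have im_neg: "Im (ip m (mv (G (\<i> * of_real x)) v) v) < 0" if "x > 0" "supp m v" "v \<noteq> 0" for v and x :: real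
  proof -
    have "pos_def (\<i> \<cdot>\<^sub>m (G (\<i> * of_real x) - mat_adjoint (G (\<i> * of_real x))))"
      using sni that by (auto simp: strictly_negative_imaginary_def)
    moreover have "\<i> \<cdot>\<^sub>m (G (\<i> * of_real x) - mat_adjoint (G (\<i> * of_real x))) \<in> carrier_mat m m"
      by (intro smult_carrier_mat minus_carrier_mat mat_adjoint_carrier Gc)
    ultimately show ?thesis using pos_def_ip[of _ m v] that unfolding form[symmetric] by (fastforce simp: form)
  qed
  \<comment> \<open>SNI gives strictness for nonzero supported vectors. Passing to the truncation of
    an arbitrary \<open>v\<close> yields a weak inequality for all \<open>v\<close>.\<close>
  have trunc: "ip m (mv (G s) (mv (1\<^sub>m m) v)) (mv (1\<^sub>m m) v) = ip m (mv (G s) v) v" for s v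
    using Gc[of s] by (auto simp: ip_def mv_def if_distrib[of "\<lambda>c. c * _"] cong: if_cong intro!: sum.cong)
  have im_nonpos: "Im (ip m (mv (G (\<i> * of_real x)) v) v) \<le> 0" if "x > 0" for v and x :: real
  proof (cases "mv (1\<^sub>m m) v = 0")
    case True
    then show ?thesis unfolding trunc[of _ v, symmetric] by simp
  next
    case False
    then show ?thesis using im_neg[OF that _ False] trunc[of _ v] by (simp add: less_imp_le)
  qed
  have im0: "Im (ip m (mv (G 0) v) v) \<le> 0" for v
  proof -
    have "filterlim (\<lambda>x. \<i> * of_real x) (at 0) (at_right (0::real))"
      unfolding filterlim_at by (auto intro!: tendsto_eq_intros simp: eventually_at_filter)
    from tendsto_Im[OF filterlim_compose[OF cont[of 0 v] this]]
    have "((\<lambda>x. Im (ip m (mv (G (\<i> * of_real x)) v) v)) \<longlongrightarrow> Im (ip m (mv (G 0) v) v)) (at_right 0)" by simp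
    moreover have "\<forall>\<^sub>F x in at_right (0::real). Im (ip m (mv (G (\<i> * of_real x)) v) v) \<le> 0"
      using im_nonpos by (auto simp: eventually_at_filter)
    ultimately show ?thesis by (rule tendsto_upperbound) simp
  qed
  \<comment> \<open>The weak inequality survives the limit at 0. It also holds for the conjugate of
    \<open>v\<close>, where the imaginary part has the opposite sign.\<close>
  have Mre: "Im (ip m (mv M v) v) = 0" for v
    using im0[of v] im0[of "\<lambda>i. cnj (v i)"] conj[of 0 v] by (simp add: G0)
  then show "Im (ip m (mv M v) v) = 0" .
  let ?f = "\<lambda>v s. (ip m (mv M v) v - ip m (mv (G s) v) v) / s"
  have neg: "?f v s = cnj (?f (\<lambda>i. cnj (v i)) (cnj s))" for v s
    using conj[of "cnj s" v] conj[of 0 v] by (simp add: G0)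
  have axis: "Re (?f v (\<i> * of_real x)) = - Im (ip m (mv (G (\<i> * of_real x)) v) v) / x" if "x \<noteq> 0" for v and x :: real
    using that Mre[of v] by (simp add: Re_divide power2_eq_square)
  have strict: "0 < Re (?f v s)" if s: "Re s = 0" "s \<noteq> 0" and v: "supp m v" "v \<noteq> 0" for v s
  proof -
    have pos: "0 < Re (?f v (\<i> * of_real x))" if "x > 0" "supp m v" "v \<noteq> 0" for v and x :: real
      using axis[of x v] im_neg[OF that] that by (simp add: divide_neg_pos)
    have seq: "s = \<i> * of_real (Im s)" using s by (simp add: complex_eq_iff)
    show ?thesis
    proof (cases "Im s > 0")
      case True then show ?thesis using pos[OF True v] seq by metis
    next
      case False
      then have "Im s < 0" using s by (metis complex_eq_iff linorder_neqE_linordered_idom zero_complex.simps)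
      moreover have "supp m (\<lambda>i. cnj (v i))" "(\<lambda>i. cnj (v i)) \<noteq> 0" using v by (auto simp: supp_def fun_eq_iff)
      ultimately have "0 < Re (?f (\<lambda>i. cnj (v i)) (\<i> * of_real (- Im s)))" by (intro pos) auto
      moreover have "cnj s = \<i> * of_real (- Im s)" using s by (simp add: complex_eq_iff)
      ultimately show ?thesis unfolding neg[of v s] cnj.simps(1) by (simp only:)
    qed
  qed
  then show "Re s = 0 \<Longrightarrow> s \<noteq> 0 \<Longrightarrow> supp m v \<Longrightarrow> v \<noteq> 0 \<Longrightarrow> 0 < Re (?f v s)" .
  have prem: "finite (insert 0 S)" "?f v holomorphic_on - insert 0 S" "\<And>z. z \<in> insert 0 S \<Longrightarrow> Re z \<le> 0"
    "\<And>x. \<i> * of_real x \<notin> insert 0 S \<Longrightarrow> 0 \<le> Re (?f v (\<i> * of_real x))"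
    "\<And>x. \<i> * of_real x \<in> insert 0 S \<Longrightarrow>
      \<exists>r\<ge>0. ((\<lambda>s. (s - \<i> * of_real x) * ?f v s) \<longlongrightarrow> of_real r) (at (\<i> * of_real x))"
    "((\<lambda>s. ?f v s / s) \<longlongrightarrow> 0) at_infinity" if v: "supp m v" "v \<noteq> 0" for v
  proof -
    show "finite (insert 0 S)" using S by simp
    show "?f v holomorphic_on - insert 0 S"
      by (intro holomorphic_intros holomorphic_on_subset[OF holq]) auto
    show "\<And>z. z \<in> insert 0 S \<Longrightarrow> Re z \<le> 0" using Sneg by force
    show "0 \<le> Re (?f v (\<i> * of_real x))" if "\<i> * of_real x \<notin> insert 0 S" for x :: real
      using strict[of "\<i> * of_real x" v] that v by force
    show "\<exists>r\<ge>0. ((\<lambda>s. (s - \<i> * of_real x) * ?f v s) \<longlongrightarrow> of_real r) (at (\<i> * of_real x))"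
      if x: "\<i> * of_real x \<in> insert 0 S" for x :: real
    proof -
      have "x = 0" using x Sneg[of "\<i> * of_real x"] by auto
      have "((\<lambda>s. ip m (mv M v) v - ip m (mv (G s) v) v) \<longlongrightarrow> ip m (mv M v) v - ip m (mv (G 0) v) v) (at 0)"
        by (intro tendsto_intros cont) simp
      then have "((\<lambda>s. ip m (mv M v) v - ip m (mv (G s) v) v) \<longlongrightarrow> 0) (at 0)" by (simp add: G0)
      then have "((\<lambda>s. s * ?f v s) \<longlongrightarrow> 0) (at 0)"
        by (rule Lim_transform_eventually) (auto simp: eventually_at_filter)
      then show ?thesis using \<open>x = 0\<close> by (intro exI[of _ 0]) simp
    qed
    have "((\<lambda>s. ip m (mv M v) v - ip m (mv (G s) v) v) \<longlongrightarrow> ip m (mv M v) v - ip m (rv D v) v) at_infinity"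
      by (intro tendsto_intros vlim_ip realization_at_infinity[OF r] vlim_const)
    moreover have "((\<lambda>s::complex. inverse s * inverse s) \<longlongrightarrow> 0 * 0) at_infinity"
      by (rule tendsto_mult[OF tendsto_inverse_0 tendsto_inverse_0])
    ultimately have "((\<lambda>s. (ip m (mv M v) v - ip m (mv (G s) v) v) * (inverse s * inverse s)) \<longlongrightarrow>
        (ip m (mv M v) v - ip m (rv D v) v) * (0 * 0)) at_infinity" by (rule tendsto_mult)
    then show "((\<lambda>s. ?f v s / s) \<longlongrightarrow> 0) at_infinity" by (simp add: divide_inverse mult.assoc)
  qed
  show "0 < Re (?f v s)" if s: "0 < Re s" and v: "supp m v" "v \<noteq> 0"
  proof (rule ccontr)
    assume "\<not> 0 < Re (?f v s)"
    moreover have "0 \<le> Re (?f v s)" using positive_real_from_boundary(1)[OF prem[OF v] s] by simp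
    ultimately have z: "Re (?f v s) = 0" by simp
    have zero: "Re (?f v w) = 0" if "0 < Re w" for w
      using positive_real_from_boundary(2)[OF prem[OF v] s z that] by simp
    \<comment> \<open>One interior zero makes the real part vanish throughout the half plane, hence
      by continuity also at the boundary point \<open>\<i>\<close>, where it is strictly
      positive.\<close>
    have "filterlim (\<lambda>x. \<i> + of_real x) (at \<i>) (at_right (0::real))"
      unfolding filterlim_at by (auto intro!: tendsto_eq_intros simp: eventually_at_filter)
    moreover have "((\<lambda>s. Re (?f v s)) \<longlongrightarrow> Re (?f v \<i>)) (at \<i>)" by (intro tendsto_intros cont) auto
    ultimately have "((\<lambda>x. Re (?f v (\<i> + of_real x))) \<longlongrightarrow> Re (?f v \<i>)) (at_right (0::real))"
      by (rule filterlim_compose[rotated])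
    moreover have "\<forall>\<^sub>F x in at_right (0::real). Re (?f v (\<i> + of_real x)) = 0"
      using zero by (intro eventually_at_right_0I) simp
    ultimately have "((\<lambda>x. 0) \<longlongrightarrow> Re (?f v \<i>)) (at_right (0::real))" by (rule Lim_transform_eventually)
    then have "Re (?f v \<i>) = 0" by (simp add: tendsto_const_iff)
    then show False using strict[of \<i> v] v by simp
  qed
qed

section \<open>Trajectories at points of the closed right half plane\<close>

text \<open>Controllability makes the map from \<open>(x, y)\<close> to
  \<open>(s I - A) x - B y\<close> onto. Surjectivity is stable under perturbation, so a solution at
  \<open>s\<close> extends to solutions at \<open>s + t\<close>; this gives meaning to input-output
  pairs at a pole of \<open>G\<close>.\<close>

lemma controllable_perturbation:
  assumes tf: "transfer_function_matrix m G" and min: "minimal_realization m n A B C D G"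
    and x: "supp n x" and y: "supp m y" and eq: "sv s x - rv A x = rv B y"
  obtains X Y where "vlim X x (at_right (0::real))" "vlim Y y (at_right 0)"
    "\<And>t. supp n (X t)" "\<And>t. supp m (Y t)"
    "\<forall>\<^sub>F t in at_right 0. sv (s + of_real t) (X t) - rv A (X t) = rv B (Y t)"
proof -
  have r: "realization m n A B C D G" using min by (simp add: minimal_realization_def)
  note car = realization_carrier[OF r]
  define P where "P = s \<cdot>\<^sub>m 1\<^sub>m n - cmat A"
  have P: "P \<in> carrier_mat n n" using car by (auto simp: P_def)
  (* P P^* + B B^* provides a right inverse of (s I - A, -B) that persists for s + t. *)
  define W where "W = P * mat_adjoint P + cmat B * mat_adjoint (cmat B)"
  have W: "W \<in> carrier_mat n n" using P car by (auto simp: W_def)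
  have Wv: "mv W w = mv P (mv (mat_adjoint P) w) + rv B (mv (mat_adjoint (cmat B)) w)" for w
    unfolding W_def using P car by (simp add: mv_mat_add[of _ n n] mv_mult[of _ n n _ n] mv_mult[of _ n m _ n])
  \<comment> \<open>The form of \<open>W\<close> is a sum of two squared norms, so a kernel vector
    is a left eigenvector of \<open>A\<close> annihilated by \<open>B\<close>.\<close>
  have "det W \<noteq> 0" unfolding det_nonzero_iff[OF W]
  proof (intro allI impI)
    fix w assume w: "supp n w" "mv W w = 0"
    have "0 = ip n (mv W w) w" using w by simp
    also have "\<dots> = ip n (mv (mat_adjoint P) w) (mv (mat_adjoint P) w) +
        ip m (mv (mat_adjoint (cmat B)) w) (mv (mat_adjoint (cmat B)) w)"
      unfolding Wv ip_add_left by (simp add: ip_adjoint[OF P] ip_adjoint[OF car(6)])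
    finally have "Re (ip n (mv (mat_adjoint P) w) (mv (mat_adjoint P) w)) = 0"
      "Re (ip m (mv (mat_adjoint (cmat B)) w) (mv (mat_adjoint (cmat B)) w)) = 0"
      using ip_self_nonneg(1)[of n "mv (mat_adjoint P) w"] ip_self_nonneg(1)[of m "mv (mat_adjoint (cmat B)) w"]
      by (auto simp: complex_eq_iff)
    then have Pw: "mv (mat_adjoint P) w = 0" and Bw: "mv (mat_adjoint (cmat B)) w = 0"
      using ip_self_eq_0[of n "mv (mat_adjoint P) w"] ip_self_eq_0[of m "mv (mat_adjoint (cmat B)) w"] P car by auto
    have "mat_adjoint P = cnj s \<cdot>\<^sub>m 1\<^sub>m n - cmat (A\<^sup>T)"
      using car by (intro eq_matI) (auto simp: P_def)
    then have "rv (A\<^sup>T) w = sv (cnj s) w" using Pw mv_char[of "cmat (A\<^sup>T)" n w "cnj s"] w(1) car by simp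
    then show "w = 0" using minimal_realization_controllable[OF tf min w(1)] Bw by (simp add: mat_adjoint_cmat)
  qed
  \<comment> \<open>The corrected pair \<open>x - P^* z\<close>, \<open>y + B^* z\<close> solves the
    equation at \<open>s + t\<close> exactly when \<open>V t\<close> maps \<open>z\<close> to
    \<open>t x\<close>. As \<open>t\<close> tends to 0, so does \<open>z\<close>.\<close>
  define V where "V = (\<lambda>t::real. W + of_real t \<cdot>\<^sub>m mat_adjoint P)"
  have V: "V t \<in> carrier_mat n n" for t using W P by (auto simp: V_def)
  have Vlim: "mlim V W (at_right 0)"
    unfolding mlim_def
  proof (intro allI impI)
    fix i j assume "i < dim_row W" "j < dim_col W"
    then have "V t $$ (i,j) = W $$ (i,j) + of_real t * mat_adjoint P $$ (i,j)" for t
      using W P by (simp add: V_def)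
    then show "((\<lambda>t. V t $$ (i,j)) \<longlongrightarrow> W $$ (i,j)) (at_right 0)" by (auto intro!: tendsto_eq_intros)
  qed
  have "((\<lambda>t. of_real t) \<longlongrightarrow> (0::complex)) (at_right 0)" by (auto intro!: tendsto_eq_intros)
  from vlim_sv[OF this vlim_const[of x]] have "vlim (\<lambda>t::real. sv (of_real t) x) 0 (at_right 0)" by simp
  note inv = vlim_mat_inv[OF V W Vlim \<open>det W \<noteq> 0\<close> this]
  define z where "z = (\<lambda>t::real. mv (mat_inv (V t)) (sv (of_real t) x))"
  have zlim: "vlim z 0 (at_right 0)" using inv(2) by (simp add: z_def)
  have "\<forall>\<^sub>F t in at_right 0. sv (s + of_real t) (x - mv (mat_adjoint P) (z t)) - rv A (x - mv (mat_adjoint P) (z t))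
      = rv B (y + mv (mat_adjoint (cmat B)) (z t))"
    using inv(1)
  proof eventually_elim
    case (elim t)
    have "mv (V t) (z t) = sv (of_real t) x" unfolding z_def by (rule mv_mat_inv[OF V elim]) (use x in auto)
    then have 1: "mv P (mv (mat_adjoint P) (z t)) + rv B (mv (mat_adjoint (cmat B)) (z t))
        + sv (of_real t) (mv (mat_adjoint P) (z t)) = sv (of_real t) x"
      unfolding V_def using W P by (simp add: mv_mat_add[of _ n n] mv_smult Wv)
    have "supp n (mv (mat_adjoint P) (z t))" using P by auto
    then have 2: "mv P (mv (mat_adjoint P) (z t)) = sv s (mv (mat_adjoint P) (z t)) - rv A (mv (mat_adjoint P) (z t))"
      unfolding P_def by (intro mv_char) (use car in auto)
    show ?case
      unfolding mv_diff mv_add sv_diff sv_add_left eq[symmetric] using 1 2 by (simp add: algebra_simps)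
  qed
  moreover have "vlim (\<lambda>t. x - mv (mat_adjoint P) (z t)) (x - mv (mat_adjoint P) 0) (at_right 0)"
    by (intro vlim_diff vlim_mv zlim vlim_const)
  moreover have "vlim (\<lambda>t. y + mv (mat_adjoint (cmat B)) (z t)) (y + mv (mat_adjoint (cmat B)) 0) (at_right 0)"
    by (intro vlim_add vlim_mv zlim vlim_const)
  moreover have "supp n (x - mv (mat_adjoint P) (z t))" "supp m (y + mv (mat_adjoint (cmat B)) (z t))" for t
    using P x y car by auto
  ultimately show ?thesis using that by simp
qed

lemma filterlim_shift_at: "filterlim (\<lambda>t. s + of_real t) (at (s :: complex)) (at_right (0::real))"
  unfolding filterlim_at by (auto intro!: tendsto_eq_intros simp: eventually_at_filter)

lemma trajectory_limit:
  assumes tf: "transfer_function_matrix m G" and min: "minimal_realization m n A B C D G"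
    and x: "supp n x" and y: "supp m y" and eq: "sv s x - rv A x = rv B y"
  obtains Y where "vlim Y y (at_right (0::real))" "\<And>t. supp m (Y t)"
    "vlim (\<lambda>t. mv (G (s + of_real t)) (Y t)) (rv C x + rv D y) (at_right 0)"
proof -
  have r: "realization m n A B C D G" using min by (simp add: minimal_realization_def)
  note car = realization_carrier[OF r]
  obtain X Y where XY: "vlim X x (at_right (0::real))" "vlim Y y (at_right 0)"
    "\<And>t. supp n (X t)" "\<And>t. supp m (Y t)"
    "\<forall>\<^sub>F t in at_right 0. sv (s + of_real t) (X t) - rv A (X t) = rv B (Y t)"
    using controllable_perturbation[OF tf min x y eq] by blast
  have "\<forall>\<^sub>F t in at_right (0::real). det ((s + of_real t) \<cdot>\<^sub>m 1\<^sub>m n - cmat A) \<noteq> 0"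
    using eventually_char_nonzero[OF car(5), of s] filterlim_shift_at[of s] by (auto simp: filterlim_iff)
  with XY(5) have "\<forall>\<^sub>F t in at_right 0. rv C (X t) + rv D (Y t) = mv (G (s + of_real t)) (Y t)"
    by eventually_elim (rule realization_output[OF r _ XY(3)])
  moreover have "vlim (\<lambda>t. rv C (X t) + rv D (Y t)) (rv C x + rv D y) (at_right 0)"
    by (intro vlim_add vlim_mv XY)
  ultimately show ?thesis using that[OF XY(2,4)] by (auto intro: vlim_cong)
qed

lemma trajectory_positive_real:
  assumes tf: "transfer_function_matrix m G" and min: "minimal_realization m n A B C D G"
    and pr: "\<And>s v. 0 < Re s \<Longrightarrow> 0 \<le> Re (s * ip m (mv (G s) v) v)"
    and x: "supp n x" and y: "supp m y" and eq: "sv s x - rv A x = rv B y" and s: "0 \<le> Re s"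
  shows "0 \<le> Re (s * ip m (rv C x + rv D y) y)"
proof -
  obtain Y where Y: "vlim Y y (at_right (0::real))"
    "vlim (\<lambda>t. mv (G (s + of_real t)) (Y t)) (rv C x + rv D y) (at_right 0)"
    using trajectory_limit[OF tf min x y eq] by metis
  have "((\<lambda>t. s + of_real t) \<longlongrightarrow> s) (at_right (0::real))" by (auto intro!: tendsto_eq_intros)
  then have "((\<lambda>t. Re ((s + of_real t) * ip m (mv (G (s + of_real t)) (Y t)) (Y t))) \<longlongrightarrow>
      Re (s * ip m (rv C x + rv D y) y)) (at_right 0)"
    by (intro tendsto_intros vlim_ip Y)
  moreover have "\<forall>\<^sub>F t in at_right (0::real). 0 \<le> Re ((s + of_real t) * ip m (mv (G (s + of_real t)) (Y t)) (Y t))"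
    using s by (intro eventually_at_right_0I pr) simp
  ultimately show ?thesis by (rule tendsto_lowerbound) simp
qed

text \<open>The pair is a limit of pairs at \<open>s + t\<close>, and continuity of \<open>G\<close>
  identifies the limit output. This avoids a proof that eigenvalues of a minimal \<open>A\<close>
  are poles.\<close>

lemma trajectory_output:
  assumes tf: "transfer_function_matrix m G" and min: "minimal_realization m n A B C D G"
    and cont: "mlim G (G s) (at s)"
    and x: "supp n x" and y: "supp m y" and eq: "sv s x - rv A x = rv B y"
  shows "rv C x + rv D y = mv (G s) y"
proof -
  have Gc: "G s \<in> carrier_mat m m" for s using tf by (simp add: transfer_function_matrix_def)
  obtain Y where Y: "vlim Y y (at_right (0::real))"
    "vlim (\<lambda>t. mv (G (s + of_real t)) (Y t)) (rv C x + rv D y) (at_right 0)"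
    using trajectory_limit[OF tf min x y eq] by metis
  have "mlim (\<lambda>t::real. G (s + of_real t)) (G s) (at_right 0)"
    by (rule mlim_compose[OF cont filterlim_shift_at])
  then have "vlim (\<lambda>t. mv (G (s + of_real t)) (Y t)) (mv (G s) y) (at_right 0)"
    by (rule vlim_mat_mv[OF _ Gc Gc Y(1)])
  from vlim_unique[OF Y(2) this] show ?thesis by simp
qed

section \<open>Laurent coefficients of a negative imaginary function at the origin\<close>

lemma Re_mult_real: "Re (z * complex_of_real r) = Re z * r"
  by simp

text \<open>First variation: an inequality along every real line through a minimizer forces the
  linear part to vanish.\<close>

lemma linear_term_zero:
  fixes b c :: real
  assumes "\<And>x. 0 \<le> x * b + x\<^sup>2 * c"
  shows "b = 0"
proof (rule ccontr)
  assume b: "b \<noteq> 0"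
  \<comment> \<open>With this \<open>x\<close> the polynomial equals
    \<open>- b\<^sup>2 (|c| + 1 - c) / (|c| + 1)\<^sup>2\<close>, which is negative for either sign
    of \<open>c\<close>.\<close>
  define x where "x = - b / (\<bar>c\<bar> + 1)"
  have x: "x * (\<bar>c\<bar> + 1) = - b" by (simp add: x_def)
  have "0 \<le> (x * b + x\<^sup>2 * c) * (\<bar>c\<bar> + 1)" using assms[of x] by (intro mult_nonneg_nonneg) auto
  also have "\<dots> = b * (x * (\<bar>c\<bar> + 1)) + x * c * (x * (\<bar>c\<bar> + 1))" by (simp add: algebra_simps power2_eq_square)
  also have "\<dots> = - b * (b + x * c)" unfolding x by (simp add: algebra_simps)
  finally have "0 \<le> - b * (b + x * c)" .
  then have "0 \<le> - b * (b + x * c) * (\<bar>c\<bar> + 1)" by (rule mult_nonneg_nonneg) simp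
  also have "\<dots> = - b * (b * (\<bar>c\<bar> + 1) + c * (x * (\<bar>c\<bar> + 1)))" by (simp add: algebra_simps)
  also have "\<dots> = - (b\<^sup>2 * (\<bar>c\<bar> + 1 - c))" unfolding x by (simp add: algebra_simps power2_eq_square)
  finally have "b\<^sup>2 * (\<bar>c\<bar> + 1 - c) \<le> 0" by simp
  moreover have "0 < b\<^sup>2 * (\<bar>c\<bar> + 1 - c)" using b by (intro mult_pos_pos) auto
  ultimately show False by simp
qed

lemma laurent_cancel: "s \<noteq> 0 \<Longrightarrow> s * (a - 1 / s\<^sup>2 * q - 1 / s * g) = s * a - q / s - g" for s :: complex
  by (simp add: right_diff_distrib power2_eq_square)

text \<open>\<open>Gp\<close> stands for the pseudo-inverse of \<open>G2\<close> and
  \<open>Pf\<close> for the orthogonal projection onto the range of \<open>F\<close>; both enter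
  only through the listed identities. \<open>F\<close> enters only through its range, so no singular
  value decomposition appears in the analysis.\<close>

locale ni_laurent =
  fixes m k :: nat and G :: "complex \<Rightarrow> complex mat" and G0 G1 G2 Gp F Pf :: "complex mat"
  assumes Gc: "\<And>s. G s \<in> carrier_mat m m"
    and car: "G0 \<in> carrier_mat m m" "G1 \<in> carrier_mat m m" "G2 \<in> carrier_mat m m" "Gp \<in> carrier_mat m m"
      "F \<in> carrier_mat m k" "Pf \<in> carrier_mat m m"
    and hol: "\<And>i j. i < m \<Longrightarrow> j < m \<Longrightarrow> (\<lambda>s. G s $$ (i,j)) holomorphic_on {s. 0 < Re s}"
    and pr: "\<And>s v. 0 < Re s \<Longrightarrow> 0 \<le> Re (s * ip m (mv (G s) v) v)"
    and laurent: "mlim (\<lambda>s. G s - (1 / s\<^sup>2) \<cdot>\<^sub>m G2 - (1 / s) \<cdot>\<^sub>m G1) G0 (at 0)"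
    and G2_sym: "\<And>v w. ip m (mv G2 v) w = ip m v (mv G2 w)"
    and Gp_sym: "\<And>v w. ip m (mv Gp v) w = ip m v (mv Gp w)"
    and G2_Gp: "\<And>v. mv G2 (mv Gp (mv G2 v)) = mv G2 v" "\<And>v. mv G2 (mv Gp v) = mv Gp (mv G2 v)"
    and F_G2: "\<And>v. \<exists>d. mv G2 v = mv F d"
    and F_G1: "\<And>v. supp m v \<Longrightarrow> mv G2 v = 0 \<Longrightarrow> \<exists>d. mv G1 v = mv F d"
    and F_split: "\<And>d. \<exists>a b. supp m a \<and> supp m b \<and> mv G2 b = 0 \<and> mv F d = mv G2 a + mv G1 b"
    and Pf_sym: "\<And>v w. ip m (mv Pf v) w = ip m v (mv Pf w)"
    and Pf_F: "\<And>d. mv Pf (mv F d) = mv F d" "\<And>v. \<exists>d. mv Pf v = mv F d"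
begin

section \<open>The limit form at the origin and its domain\<close>

definition S :: "complex mat" where "S = G0 + G1 * Gp * mat_adjoint G1"

definition E :: "(nat \<Rightarrow> complex) \<Rightarrow> bool" where
  "E y \<longleftrightarrow> supp m y \<and> (\<forall>d. ip m (mv F d) y = 0)"

lemma S_car: "S \<in> carrier_mat m m"
  using car by (auto simp: S_def)

lemma S_mv: "mv S v = mv G0 v + mv G1 (mv Gp (mv (mat_adjoint G1) v))"
proof -
  have a: "mat_adjoint G1 \<in> carrier_mat m m" by (rule mat_adjoint_carrier[OF car(2)])
  note g = mult_carrier_mat[OF car(2,4)]
  show ?thesis
    unfolding S_def mv_mat_add[OF car(1) mult_carrier_mat[OF g a]] mv_mult[OF g a] mv_mult[OF car(2,4)] ..
qed

lemma E_lin: "E y \<Longrightarrow> E z \<Longrightarrow> E (y + z)" "E y \<Longrightarrow> E (sv c y)"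
  by (auto simp: E_def ip_linear)

lemma E_supp: "E y \<Longrightarrow> supp m y"
  by (simp add: E_def)

lemma E_perp: "E y \<Longrightarrow> ip m (mv F d) y = 0" "E y \<Longrightarrow> ip m y (mv F d) = 0"
  by (auto simp: E_def ip_commute[of m y])

lemma E_iff_Pf: "E y \<longleftrightarrow> supp m y \<and> mv Pf y = 0"
proof
  assume y: "E y"
  obtain d where d: "mv Pf y = mv F d" using Pf_F by blast
  have "ip m (mv Pf y) (mv Pf y) = ip m (mv Pf (mv Pf y)) y" by (simp add: Pf_sym)
  also have "\<dots> = 0" unfolding d Pf_F using E_perp[OF y] by simp
  finally show "supp m y \<and> mv Pf y = 0" using ip_self_eq_0[of m "mv Pf y"] E_supp[OF y] car by auto
next
  assume y: "supp m y \<and> mv Pf y = 0"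
  have "ip m (mv F d) y = 0" for d using Pf_sym[of "mv F d" y] Pf_F(1) y by simp
  then show "E y" using y by (simp add: E_def)
qed

lemma E_double_perp:
  assumes w: "supp m w" and perp: "\<And>z. E z \<Longrightarrow> ip m w z = 0"
  obtains d where "w = mv F d"
proof -
  obtain d where d: "mv Pf w = mv F d" using Pf_F by blast
  have "mv Pf (w - mv Pf w) = 0" by (simp add: mv_diff d Pf_F)
  then have E: "E (w - mv Pf w)" using E_iff_Pf w car by auto
  then have "ip m (w - mv Pf w) (w - mv Pf w) = 0"
    using perp[OF E] E_perp(1)[OF E, of d] by (simp add: ip_diff_left d)
  then have "w - mv Pf w = 0" using ip_self_eq_0[of m "w - mv Pf w"] E E_supp by simp
  then show ?thesis using that d by simp
qed

text \<open>The two hypotheses cancel the terms of order \<open>1 / s\<^sup>2\<close> and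
  \<open>1 / s\<close>; the second-order correction \<open>y2\<close> then reaches the constant term
  through \<open>G2\<close>.\<close>

lemma laurent_limit:
  assumes y: "mv G2 y = 0" "mv G2 y1 + mv G1 y = 0"
  shows "vlim (\<lambda>s. mv (G s) (y + sv s y1 + sv (s\<^sup>2) y2)) (mv G2 y2 + mv G1 y1 + mv G0 y) (at 0)"
proof -
  let ?H = "\<lambda>s. G s - (1 / s\<^sup>2) \<cdot>\<^sub>m G2 - (1 / s) \<cdot>\<^sub>m G1"
  let ?v = "\<lambda>s::complex. y + sv s y1 + sv (s\<^sup>2) y2"
  have v: "vlim ?v (y + sv 0 y1 + sv (0\<^sup>2) y2) (at 0)"
    by (intro vlim_add vlim_sv vlim_const tendsto_intros)
  have H: "vlim (\<lambda>s. mv (?H s) (?v s)) (mv G0 (y + sv 0 y1 + sv (0\<^sup>2) y2)) (at 0)"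
    by (rule vlim_mat_mv[OF laurent _ _ v]) (use Gc car in auto)
  have "vlim (\<lambda>s. mv (?H s) (?v s) + (mv G2 y2 + mv G1 y1 + sv s (mv G1 y2)))
      (mv G0 (y + sv 0 y1 + sv (0\<^sup>2) y2) + (mv G2 y2 + mv G1 y1 + sv 0 (mv G1 y2))) (at 0)"
    by (intro vlim_add H vlim_sv vlim_const tendsto_intros)
  moreover have "\<forall>\<^sub>F s in at 0. mv (?H s) (?v s) + (mv G2 y2 + mv G1 y1 + sv s (mv G1 y2)) = mv (G s) (?v s)"
    unfolding eventually_at_filter
  proof (intro always_eventually allI impI)
    fix s :: complex assume s: "s \<noteq> 0"
    have G1y: "mv G1 y = - mv G2 y1" using y(2) by (simp add: eq_neg_iff_add_eq_0 add.commute)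
    have H1: "mv (?H s) (?v s) = mv (G s) (?v s) - sv (1 / s\<^sup>2) (mv G2 (?v s)) - sv (1 / s) (mv G1 (?v s))"
    proof -
      have "G s - (1 / s\<^sup>2) \<cdot>\<^sub>m G2 \<in> carrier_mat m m" using Gc car by auto
      then show ?thesis using Gc car by (simp add: mv_mat_diff[of _ m m] mv_smult)
    qed
    have H2: "sv (1 / s\<^sup>2) (mv G2 (?v s)) = sv (1 / s) (mv G2 y1) + mv G2 y2"
      using s by (simp add: mv_add mv_sv y(1) sv_add power2_eq_square)
    have H3: "sv (1 / s) (mv G1 (?v s)) = - sv (1 / s) (mv G2 y1) + mv G1 y1 + sv s (mv G1 y2)"
      using s by (simp add: mv_add mv_sv G1y sv_add sv_diff power2_eq_square)
    show "mv (?H s) (?v s) + (mv G2 y2 + mv G1 y1 + sv s (mv G1 y2)) = mv (G s) (?v s)"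
      unfolding H1 H2 H3 by simp
  qed
  ultimately have "vlim (\<lambda>s. mv (G s) (?v s))
      (mv G0 (y + sv 0 y1 + sv (0\<^sup>2) y2) + (mv G2 y2 + mv G1 y1 + sv 0 (mv G1 y2))) (at 0)"
    by (rule vlim_cong)
  then show ?thesis by (simp add: algebra_simps)
qed

text \<open>Near 0 the form \<open>s v^* G(s) v\<close> expands as
  \<open>v^* G2 v / s + v^* G1 v + o(1)\<close>. The form of \<open>G2\<close> is real, so it
  remains to approach 0 in such a way that the first term loses its real part.\<close>

lemma G1_accretive: "0 \<le> Re (ip m (mv G1 v) v)"
proof -
  let ?H = "\<lambda>s. G s - (1 / s\<^sup>2) \<cdot>\<^sub>m G2 - (1 / s) \<cdot>\<^sub>m G1"
  (* On this tangential path Re (q2 / s) tends to 0. *)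
  define p where "p = (\<lambda>x::real. Complex (x ^ 3) x)"
  have p: "filterlim p (at 0) (at_right 0)" "((\<lambda>x. p x) \<longlongrightarrow> 0) (at_right 0)"
    unfolding filterlim_at p_def
    by (auto intro!: tendsto_eq_intros simp: eventually_at_filter complex_eq_iff Complex_eq)
  have q2: "Im (ip m (mv G2 v) v) = 0" using G2_sym[of v v] ip_commute[of m v "mv G2 v"] by (simp add: complex_eq_iff)
  define q2 where "q2 = Re (ip m (mv G2 v) v)"
  have q2e: "ip m (mv G2 v) v = of_real q2" using q2 by (simp add: q2_def complex_eq_iff)
  have "vlim (\<lambda>s. mv (?H s) v) (mv G0 v) (at 0)"
    by (rule vlim_mat_mv[OF laurent]) (use Gc car in auto)
  then have "((\<lambda>s. ip m (mv (?H s) v) v) \<longlongrightarrow> ip m (mv G0 v) v) (at 0)" by (intro vlim_ip) auto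
  from filterlim_compose[OF this p(1)]
  have "((\<lambda>x. Re (p x * ip m (mv (?H (p x)) v) v) + Re (ip m (mv G1 v) v) + q2 * (x / (1 + x ^ 4)))
      \<longlongrightarrow> Re (0 * ip m (mv G0 v) v) + Re (ip m (mv G1 v) v) + q2 * (0 / (1 + 0 ^ 4))) (at_right 0)"
    by (intro tendsto_intros p(2)) auto
  moreover have "\<forall>\<^sub>F x in at_right 0. 0 \<le> Re (p x * ip m (mv (?H (p x)) v) v) + Re (ip m (mv G1 v) v) + q2 * (x / (1 + x ^ 4))"
  proof (rule eventually_at_right_0I)
    fix x :: real assume x: "x > 0"
    then have px: "0 < Re (p x)" "p x \<noteq> 0" by (auto simp: p_def complex_eq_iff)
    let ?s = "p x"
    have H: "mv (?H ?s) v = mv (G ?s) v - sv (1 / ?s\<^sup>2) (mv G2 v) - sv (1 / ?s) (mv G1 v)"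
    proof -
      have "G ?s - (1 / ?s\<^sup>2) \<cdot>\<^sub>m G2 \<in> carrier_mat m m" using Gc car by auto
      then show ?thesis using Gc car by (simp add: mv_mat_diff[of _ m m] mv_smult)
    qed
    have "?s * ip m (mv (?H ?s) v) v = ?s * ip m (mv (G ?s) v) v - of_real q2 / ?s - ip m (mv G1 v) v"
      unfolding H ip_diff_left ip_sv_left q2e by (rule laurent_cancel[OF px(2)])
    moreover have "Re (of_real q2 / ?s) = q2 * (x / (1 + x ^ 4))"
    proof -
      have "Re (of_real q2 / ?s) = q2 * x ^ 3 / ((x ^ 3)\<^sup>2 + x\<^sup>2)" by (simp add: Re_divide p_def)
      also have "\<dots> = q2 * (x / (1 + x ^ 4))"
      proof -
        have "(x ^ 3)\<^sup>2 + x\<^sup>2 = x\<^sup>2 * (1 + x ^ 4)" by (simp add: algebra_simps flip: power_mult power_add)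
        moreover have "x ^ 3 = x\<^sup>2 * x" by (simp add: power2_eq_square power3_eq_cube)
        ultimately show ?thesis using x by simp
      qed
      finally show ?thesis .
    qed
    ultimately show "0 \<le> Re (?s * ip m (mv (?H ?s) v) v) + Re (ip m (mv G1 v) v) + q2 * (x / (1 + x ^ 4))"
      using pr[OF px(1), of v] by simp
  qed
  ultimately have "0 \<le> Re (0 * ip m (mv G0 v) v) + Re (ip m (mv G1 v) v) + q2 * (0 / (1 + 0 ^ 4))"
    by (rule tendsto_lowerbound) simp
  then show ?thesis by simp
qed

lemma ip_ext:
  assumes "supp m w" "\<And>v. supp m v \<Longrightarrow> ip m v w = 0"
  shows "w = 0"
  using ip_self_eq_0[of m w] assms by simp

lemma E_G2: assumes y: "E y" shows "mv G2 y = 0"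
proof (rule ip_ext)
  fix v
  obtain d where "mv G2 v = mv F d" using F_G2 by blast
  then show "ip m v (mv G2 y) = 0" using E_perp[OF y] G2_sym[of v y] by simp
qed (use car in auto)

text \<open>This is the cancellation condition at order \<open>1 / s\<close>, solved by a
  first-order correction of \<open>y\<close>. Two facts combine: the adjoint of \<open>G1\<close>
  maps \<open>y\<close> into the range of \<open>G2\<close>, and \<open>y\<close> is a null vector
  of the accretive form of \<open>G1\<close>, so \<open>G1\<close> and minus its adjoint agree at
  \<open>y\<close>.\<close>

lemma E_G1:
  assumes y: "E y"
  shows "mv G2 (mv Gp (mv (mat_adjoint G1) y)) + mv G1 y = 0"
proof -
  let ?z = "mv (mat_adjoint G1) y"
  have adj: "ip m (mv G1 v) w = ip m v (mv (mat_adjoint G1) w)" for v w by (rule ip_adjoint[OF car(2)])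
  have "?z - mv G2 (mv Gp ?z) = 0"
  proof (rule ip_ext)
    fix v assume v: "supp m v"
    \<comment> \<open>\<open>?w\<close> lies in the kernel of \<open>G2\<close>, which
      \<open>G1\<close> maps into the range of \<open>F\<close>; and \<open>y\<close> is orthogonal
      to that range.\<close>
    let ?w = "v - mv Gp (mv G2 v)"
    have "supp m ?w" "mv G2 ?w = 0" using v car by (auto simp: mv_diff G2_Gp(1))
    then obtain d where "mv G1 ?w = mv F d" using F_G1 by blast
    then have "ip m ?w ?z = 0" using E_perp(1)[OF y, of d] adj[of ?w y] by simp
    then show "ip m v (?z - mv G2 (mv Gp ?z)) = 0" by (simp add: ip_linear G2_sym Gp_sym)
  qed (use car in auto)
  then have z: "mv G2 (mv Gp ?z) = ?z" by simp
  have zero: "ip m (mv G1 y) y = 0"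
    using adj[of y y] G2_sym[of y "mv Gp ?z"] E_G2[OF y] by (simp add: z)
  let ?u = "mv G1 y + ?z"
  \<comment> \<open>At a zero of a nonnegative form the first variation vanishes; here it is given
    by \<open>G1\<close> plus its adjoint, applied to \<open>y\<close>.\<close>
  have "Re (ip m ?u x) = 0" for x
  proof (rule linear_term_zero)
    fix t :: real
    have "0 \<le> Re (ip m (mv G1 (y + sv (of_real t) x)) (y + sv (of_real t) x))" by (rule G1_accretive)
    also have "\<dots> = t * Re (ip m ?u x) + t\<^sup>2 * Re (ip m (mv G1 x) x)"
      using ip_commute[of m x ?z] by (simp add: mv_add mv_sv ip_linear zero adj[of x y] power2_eq_square algebra_simps)
    finally show "0 \<le> t * Re (ip m ?u x) + t\<^sup>2 * Re (ip m (mv G1 x) x)" .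
  qed
  then have "?u = 0" using ip_self_eq_0[of m ?u] car by auto
  then show ?thesis by (simp add: z add.commute)
qed

text \<open>The pseudo-inverse in the first-order correction produces the second summand of
  \<open>S\<close>. Adding a kernel vector \<open>c\<close> of \<open>G2\<close> to this correction,
  and \<open>a\<close> at second order, changes the limit by \<open>G1 c + G2 a\<close>, that is, by
  an arbitrary element of the range of \<open>F\<close>.\<close>

lemma test_vectors:
  assumes y: "E y"
  obtains b where "\<And>s. supp m (b s)" "vlim b y (at 0)" "vlim (\<lambda>s. mv (G s) (b s)) (mv S y + mv F d) (at 0)"
proof -
  obtain a c where ac: "supp m a" "supp m c" "mv G2 c = 0" "mv F d = mv G2 a + mv G1 c" using F_split by blast
  let ?y1 = "mv Gp (mv (mat_adjoint G1) y) + c"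
  have "mv G2 ?y1 + mv G1 y = 0" using E_G1[OF y] ac by (simp add: mv_add)
  from laurent_limit[OF E_G2[OF y] this, of a]
  have "vlim (\<lambda>s. mv (G s) (y + sv s ?y1 + sv (s\<^sup>2) a)) (mv S y + mv F d) (at 0)"
    by (simp add: S_mv ac(4) mv_add algebra_simps)
  moreover have "vlim (\<lambda>s. y + sv s ?y1 + sv (s\<^sup>2) a) (y + sv 0 ?y1 + sv (0\<^sup>2) a) (at 0)"
    by (intro vlim_add vlim_sv vlim_const tendsto_intros)
  moreover have "supp m (y + sv s ?y1 + sv (s\<^sup>2) a)" for s
  proof -
    have "supp m ?y1" using car ac by auto
    then show ?thesis using E_supp[OF y] ac by auto
  qed
  ultimately show ?thesis using that[of "\<lambda>s. y + sv s ?y1 + sv (s\<^sup>2) a"] by simp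
qed

text \<open>Along every ray of direction \<open>e\<close> with \<open>Re e > 0\<close> the forms
  have the same limit \<open>?c\<close>, so \<open>Re (e * ?c)\<close> is nonnegative for all such
  \<open>e\<close>. Directions close to the imaginary axis force \<open>?c\<close> to be
  real.\<close>

lemma S_form: assumes y: "E y" shows "0 \<le> Re (ip m (mv S y) y)" "Im (ip m (mv S y) y) = 0"
proof -
  obtain b where b: "vlim b y (at 0)" "vlim (\<lambda>s. mv (G s) (b s)) (mv S y + mv F 0) (at 0)"
    using test_vectors[OF y, of 0] by metis
  let ?c = "ip m (mv S y) y"
  have lim: "((\<lambda>s. ip m (mv (G s) (b s)) (b s)) \<longlongrightarrow> ?c) (at 0)" using vlim_ip[OF b(2,1)] by simp
  have *: "0 \<le> Re (e * ?c)" if e: "0 < Re e" for e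
  proof -
    have "filterlim (\<lambda>x. of_real x * e) (at 0) (at_right (0::real))"
    proof -
      have "e \<noteq> 0" using e by auto
      then show ?thesis unfolding filterlim_at by (auto intro!: tendsto_eq_intros simp: eventually_at_filter)
    qed
    from filterlim_compose[OF lim this]
    have "((\<lambda>x. Re (e * ip m (mv (G (of_real x * e)) (b (of_real x * e))) (b (of_real x * e)))) \<longlongrightarrow> Re (e * ?c)) (at_right (0::real))"
      by (intro tendsto_intros)
    moreover have "\<forall>\<^sub>F x in at_right (0::real). 0 \<le> Re (e * ip m (mv (G (of_real x * e)) (b (of_real x * e))) (b (of_real x * e)))"
    proof (rule eventually_at_right_0I)
      fix x :: real assume x: "x > 0"
      let ?q = "ip m (mv (G (of_real x * e)) (b (of_real x * e))) (b (of_real x * e))"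
      have "0 \<le> Re ((of_real x * e) * ?q)" by (rule pr) (use x e in simp)
      also have "(of_real x * e) * ?q = (e * ?q) * of_real x" by (simp add: mult_ac)
      finally have "0 \<le> Re (e * ?q) * x" unfolding Re_mult_real .
      then show "0 \<le> Re (e * ?q)" using x by (simp add: zero_le_mult_iff)
    qed
    ultimately show ?thesis by (rule tendsto_lowerbound) simp
  qed
  show "0 \<le> Re ?c" using *[of 1] by simp
  have "\<bar>Im ?c\<bar> \<le> x * Re ?c" if "x > 0" for x :: real
    using *[of "Complex x 1"] *[of "Complex x (-1)"] that by (auto simp: abs_le_iff)
  then have "((\<lambda>x. \<bar>Im ?c\<bar>) \<longlongrightarrow> \<bar>Im ?c\<bar>) (at_right (0::real)) \<Longrightarrow> \<bar>Im ?c\<bar> \<le> 0 * Re ?c"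
    by (intro tendsto_le[of "at_right (0::real)" "\<lambda>x. x * Re ?c" "0 * Re ?c"])
      (auto intro!: tendsto_eq_intros simp: eventually_at_filter)
  then show "Im ?c = 0" by simp
qed

lemma S_sym: assumes y: "E y" and z: "E z" shows "ip m (mv S y) z = cnj (ip m (mv S z) y)"
proof -
  have 1: "Im (ip m (mv S y) z + ip m (mv S z) y) = 0"
    using S_form(2)[OF E_lin(1)[OF y z]] S_form(2)[OF y] S_form(2)[OF z] by (simp add: mv_add ip_linear)
  have 2: "Im (- \<i> * ip m (mv S y) z + \<i> * ip m (mv S z) y) = 0"
    using S_form(2)[OF E_lin(1)[OF y E_lin(2)[OF z, of \<i>]]] S_form(2)[OF y] S_form(2)[OF z]
    by (simp add: mv_add mv_sv ip_linear)
  show ?thesis using 1 2 by (simp add: complex_eq_iff)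
qed

section \<open>The limit of the graphs of \<open>G\<close> along the positive reals, and its
  resolvent\<close>

lemma accretive_real: "t > 0 \<Longrightarrow> 0 \<le> Re (ip m (mv (G (of_real t)) v) v)"
  using pr[of "of_real t" v] by (simp add: zero_le_mult_iff)

lemma at_right_complex: "filterlim complex_of_real (at 0) (at_right 0)"
  unfolding filterlim_at by (auto intro!: tendsto_eq_intros simp: eventually_at_filter)

lemma vlim_at_right: "vlim x a (at 0) \<Longrightarrow> vlim (\<lambda>t. x (complex_of_real t)) a (at_right 0)"
  using filterlim_compose[OF _ at_right_complex] by (auto simp: vlim_def)

text \<open>The maximal monotone relation \<open>{(y, S y + f) | y \<in> E, f \<in> range F}\<close> replaces the graph of \<open>G 0\<close>,
  which is not defined because of the pole.\<close>

lemma limit_relation: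
  assumes a: "\<And>t. supp m (a t)" "vlim a y (at_right (0::real))" and v: "vlim (\<lambda>t. mv (G (of_real t)) (a t)) v (at_right 0)"
  shows "E y" and "\<exists>d. v = mv S y + mv F d"
proof -
  have sy: "supp m y"
    unfolding supp_def
  proof (intro allI impI)
    fix i assume "m \<le> i"
    then have "(\<lambda>t. a t i) = (\<lambda>t. 0)" using a(1) by (auto simp: supp_def)
    then have "((\<lambda>t::real. 0) \<longlongrightarrow> y i) (at_right 0)" using a(2) unfolding vlim_def by metis
    then show "y i = 0" by (simp add: tendsto_const_iff)
  qed
  have sv_: "supp m v"
    unfolding supp_def
  proof (intro allI impI)
    fix i assume "m \<le> i"
    moreover have "dim_row (G s) = m" for s using Gc[of s] by auto
    ultimately have "(\<lambda>t. mv (G (of_real t)) (a t) i) = (\<lambda>t. 0)" by (simp add: mv_def)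
    then have "((\<lambda>t::real. 0) \<longlongrightarrow> v i) (at_right 0)" using v unfolding vlim_def by metis
    then show "v i = 0" by (simp add: tendsto_const_iff)
  qed
  \<comment> \<open>On the positive reals \<open>G\<close> is accretive. Applied to the difference
    of the given pair and a test pair, this passes to the limit and says that the limit pair is
    monotonically related to the whole relation; maximality will put it inside.\<close>
  have mono: "0 \<le> Re (ip m (v - (mv S z + mv F d)) (y - z))" if z: "E z" for z d
  proof -
    obtain b where b: "vlim b z (at 0)" "vlim (\<lambda>s. mv (G s) (b s)) (mv S z + mv F d) (at 0)"
      using test_vectors[OF z, of d] by metis
    have "((\<lambda>t. Re (ip m (mv (G (of_real t)) (a t) - mv (G (of_real t)) (b (of_real t))) (a t - b (of_real t)))) \<longlongrightarrow>
        Re (ip m (v - (mv S z + mv F d)) (y - z))) (at_right (0::real))"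
      by (intro tendsto_intros vlim_ip vlim_diff a v vlim_at_right[OF b(1)] vlim_at_right[OF b(2)])
    moreover have "\<forall>\<^sub>F t in at_right (0::real). 0 \<le> Re (ip m (mv (G (of_real t)) (a t) - mv (G (of_real t)) (b (of_real t))) (a t - b (of_real t)))"
      by (rule eventually_at_right_0I) (simp add: accretive_real flip: mv_diff)
    ultimately show ?thesis by (rule tendsto_lowerbound) simp
  qed
  have E0: "E 0" by (simp add: E_def)
  have Re0: "Re (ip m (mv F d) y) = 0" for d
  proof -
    have "- Re (ip m (mv F d) y) = 0"
    proof (rule linear_term_zero)
      fix x :: real
      show "0 \<le> x * - Re (ip m (mv F d) y) + x\<^sup>2 * 0"
      proof (rule ccontr)
        assume neg: "\<not> ?thesis"
        define q where "q = x * Re (ip m (mv F d) y)"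
        have q: "q > 0" using neg by (simp add: q_def)
        \<comment> \<open>The part of the relation over 0 is a subspace, so multiples of
          \<open>F d\<close> may be arbitrarily large; this multiple outweighs
          \<open>Re (ip m v y)\<close> by 1.\<close>
        define c where "c = (\<bar>Re (ip m v y)\<bar> + 1) / q"
        have "0 \<le> Re (ip m (v - (mv S 0 + mv F (sv (of_real (c * x)) d))) (y - 0))" by (rule mono[OF E0])
        also have "\<dots> = Re (ip m v y) - c * q"
          by (simp add: mv_sv ip_linear q_def)
        also have "c * q = \<bar>Re (ip m v y)\<bar> + 1" using q by (simp add: c_def)
        finally show False by linarith
      qed
    qed
    then show ?thesis by simp
  qed
  have "ip m (mv F d) y = 0" for d
    using Re0[of d] Re0[of "sv \<i> d"] by (simp add: mv_sv ip_linear complex_eq_iff)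
  then show Ey: "E y" using sy by (simp add: E_def)
  let ?w = "v - mv S y"
  \<comment> \<open>Minty's argument: the pair is tested at the points \<open>y - x z\<close> of
    \<open>E\<close>, and the term linear in \<open>x\<close> has to vanish.\<close>
  have Rew: "Re (ip m ?w z) = 0" if z: "E z" for z
  proof (rule linear_term_zero)
    fix x :: real
    have "0 \<le> Re (ip m (v - (mv S (y + sv (of_real (- x)) z) + mv F 0)) (y - (y + sv (of_real (- x)) z)))"
      by (rule mono) (intro E_lin Ey z)
    also have "\<dots> = x * Re (ip m ?w z) + x\<^sup>2 * Re (ip m (mv S z) z)"
      by (simp add: mv_add mv_sv ip_linear power2_eq_square algebra_simps)
    finally show "0 \<le> x * Re (ip m ?w z) + x\<^sup>2 * Re (ip m (mv S z) z)" .
  qed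
  have "ip m ?w z = 0" if z: "E z" for z
    using Rew[OF z] Rew[OF E_lin(2)[OF z, of \<i>]] by (simp add: ip_linear complex_eq_iff)
  moreover have "supp m ?w" using sv_ S_car by auto
  ultimately obtain d where "?w = mv F d" using E_double_perp by metis
  then show "\<exists>d. v = mv S y + mv F d" by (intro exI[of _ d]) (simp add: algebra_simps)
qed

text \<open>Minty surjectivity: the relation plus \<open>e\<close> is onto, because the compression
  of \<open>S + e\<close> to \<open>E\<close> has strictly positive real part.\<close>

lemma decomposition:
  assumes e: "e > 0" and v: "supp m v"
  obtains y d where "E y" "v = mv S y + sv (complex_of_real e) y + mv F d"
proof -
  let ?Q = "1\<^sub>m m - Pf"
  let ?T = "S + complex_of_real e \<cdot>\<^sub>m 1\<^sub>m m"
  \<comment> \<open>This matrix is the identity on the range of \<open>F\<close> and the compressed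
    \<open>S + e\<close> on its orthogonal complement, so that an ordinary inverse is
    available.\<close>
  let ?L = "?Q * ?T * ?Q + Pf"
  have Q: "?Q \<in> carrier_mat m m" and T: "?T \<in> carrier_mat m m" using car S_car by auto
  have QTQ: "?Q * ?T * ?Q \<in> carrier_mat m m" "?Q * ?T \<in> carrier_mat m m" using mult_carrier_mat[OF mult_carrier_mat[OF Q T] Q] mult_carrier_mat[OF Q T] .
  have L: "?L \<in> carrier_mat m m" using QTQ car by auto
  have Qv: "mv ?Q w = w - mv Pf w" if "supp m w" for w
    using that car by (simp add: mv_mat_diff[of _ m m] mv_one)
  have Tv: "mv ?T w = mv S w + sv (of_real e) w" if "supp m w" for w
    using that S_car by (simp add: mv_mat_add[of _ m m] mv_smult mv_one)
  have Pf2: "mv Pf (mv Pf w) = mv Pf w" for w using Pf_F by metis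
  have Lv: "mv ?L w = mv ?Q (mv ?T (mv ?Q w)) + mv Pf w" for w
    unfolding mv_mat_add[OF QTQ(1) car(6)] mv_mult[OF QTQ(2) Q] mv_mult[OF Q T] ..
  have PQ: "mv Pf (mv ?Q w) = 0" if "supp m w" for w using Qv[OF that] by (simp add: mv_diff Pf2)
  have sT: "supp m (mv ?T w)" for w using T by auto
  have PL: "mv Pf (mv ?L w) = mv Pf w" for w
    unfolding Lv mv_add Pf2 using PQ[OF sT] by simp
  have "det ?L \<noteq> 0" unfolding det_nonzero_iff[OF L]
  proof (intro allI impI)
    fix w assume w: "supp m w" "mv ?L w = 0"
    have Pw: "mv Pf w = 0" using PL[of w] w by simp
    then have Ew: "E w" using E_iff_Pf w by simp
    have "mv ?Q w = w" using Qv[OF w(1)] Pw by simp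
    then have "mv ?Q (mv S w + sv (of_real e) w) = 0" using w(2) Tv[OF w(1)] unfolding Lv by (simp add: Pw)
    then have "mv S w + sv (of_real e) w = mv Pf (mv S w + sv (of_real e) w)"
      using Qv[of "mv S w + sv (of_real e) w"] w(1) S_car by auto
    then have "ip m (mv S w + sv (of_real e) w) w = ip m (mv Pf (mv S w + sv (of_real e) w)) w" by metis
    also have "\<dots> = 0" using Pw by (simp add: Pf_sym)
    finally have "Re (ip m (mv S w) w) + e * Re (ip m w w) = 0" by (simp add: ip_linear complex_eq_iff)
    moreover have "0 \<le> e * Re (ip m w w)" using e ip_self_nonneg(1)[of m w] by simp
    ultimately have "e * Re (ip m w w) = 0" using S_form(1)[OF Ew] by linarith
    then show "w = 0" using ip_self_eq_0[OF w(1)] e by simp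
  qed
  define w where "w = mv (mat_inv ?L) (mv ?Q v)"
  have w: "supp m w" unfolding w_def using mat_inv(1)[OF L \<open>det ?L \<noteq> 0\<close>] by auto
  have Lw: "mv ?L w = mv ?Q v" unfolding w_def by (rule mv_mat_inv[OF L \<open>det ?L \<noteq> 0\<close>]) (use Q in auto)
  have Pw: "mv Pf w = 0" using PL[of w] PQ[OF v] unfolding Lw by simp
  have "mv ?Q w = w" using Qv[OF w] Pw by simp
  define z where "z = mv S w + sv (of_real e) w"
  have sz: "supp m z" unfolding z_def using w S_car by auto
  have "mv ?Q z = mv ?Q v" using Lw Tv[OF w] \<open>mv ?Q w = w\<close> unfolding Lv z_def by (simp add: Pw)
  then have "z - mv Pf z = v - mv Pf v" unfolding Qv[OF sz] Qv[OF v] .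
  then have "v - z = mv Pf (v - z)" unfolding mv_diff by (simp add: algebra_simps)
  moreover obtain d where "mv Pf (v - z) = mv F d" using Pf_F by blast
  ultimately have "v - z = mv F d" by simp
  then have "v = mv S w + sv (of_real e) w + mv F d" unfolding z_def by (simp add: algebra_simps)
  then show ?thesis using that E_iff_Pf w Pw by blast
qed

text \<open>Convergence of resolvents. The test vectors nearly solve the equation of
  \<open>a t\<close>, and accretivity bounds the error by the residual \<open>r t\<close> divided by
  \<open>e\<close>.\<close>

lemma regularized_inverse_limit:
  assumes e: "e > 0" and y: "E y"
    and a: "\<And>t. supp m (a t)"
      "\<And>t. t > 0 \<Longrightarrow> mv (G (of_real t)) (a t) + sv (of_real e) (a t) = mv S y + sv (of_real e) y + mv F d"
  shows "vlim a y (at_right (0::real))"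
proof -
  obtain b where b: "\<And>s. supp m (b s)" "vlim b y (at 0)" "vlim (\<lambda>s. mv (G s) (b s)) (mv S y + mv F d) (at 0)"
    using test_vectors[OF y, of d] by metis
  let ?v = "mv S y + sv (of_real e) y + mv F d"
  let ?b = "\<lambda>t::real. b (of_real t)"
  define r where "r = (\<lambda>t::real. ?v - (mv (G (of_real t)) (?b t) + sv (of_real e) (?b t)))"
  have "vlim r (?v - ((mv S y + mv F d) + sv (of_real e) y)) (at_right 0)"
    unfolding r_def by (intro vlim_diff vlim_add vlim_const vlim_sv tendsto_const vlim_at_right[OF b(2)] vlim_at_right[OF b(3)])
  moreover have "?v - ((mv S y + mv F d) + sv (of_real e) y) = 0" by simp
  ultimately have r0: "vlim r 0 (at_right 0)" by metis
  have bound: "Re (ip m (a t - ?b t) (a t - ?b t)) \<le> Re (ip m (r t) (r t)) / e\<^sup>2" if t: "t > 0" for t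
  proof -
    let ?e = "a t - ?b t"
    have req: "r t = mv (G (of_real t)) ?e + sv (of_real e) ?e"
      unfolding r_def a(2)[OF t, symmetric] by (simp add: mv_diff sv_diff)
    have "e * Re (ip m ?e ?e) \<le> Re (ip m (r t) ?e)"
      unfolding req using accretive_real[OF t, of ?e] by (simp add: ip_add_left ip_sv_left)
    then have "2 * e * (e * Re (ip m ?e ?e)) \<le> 2 * e * Re (ip m (r t) ?e)" using e by (intro mult_left_mono) auto
    \<comment> \<open>This square is Young's inequality; it absorbs half of the accretive
      term.\<close>
    moreover have "0 \<le> Re (ip m (r t - sv (of_real e) ?e) (r t - sv (of_real e) ?e))" by (rule ip_self_nonneg)
    then have "2 * e * Re (ip m (r t) ?e) \<le> Re (ip m (r t) (r t)) + e * e * Re (ip m ?e ?e)"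
      using ip_commute[of m ?e "r t"] by (simp add: ip_diff_left[of m "r t"] ip_diff_right[of m _ "r t"] ip_sv_left ip_sv_right algebra_simps)
    ultimately have "e\<^sup>2 * Re (ip m ?e ?e) \<le> Re (ip m (r t) (r t))" by (simp add: power2_eq_square algebra_simps)
    then show ?thesis using e by (simp add: field_simps)
  qed
  have "((\<lambda>t. Re (ip m (r t) (r t)) / e\<^sup>2) \<longlongrightarrow> Re (ip m 0 0) / e\<^sup>2) (at_right 0)"
    by (intro tendsto_intros vlim_ip r0) (use e in auto)
  then have lim: "((\<lambda>t. Re (ip m (r t) (r t)) / e\<^sup>2) \<longlongrightarrow> 0) (at_right 0)" by simp
  have "((\<lambda>t. Re (ip m (a t - ?b t) (a t - ?b t))) \<longlongrightarrow> 0) (at_right 0)"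
  proof (rule tendsto_sandwich[OF _ _ tendsto_const lim])
    show "\<forall>\<^sub>F t in at_right 0. 0 \<le> Re (ip m (a t - ?b t) (a t - ?b t))" by (simp add: ip_self_nonneg)
    show "\<forall>\<^sub>F t in at_right 0. Re (ip m (a t - ?b t) (a t - ?b t)) \<le> Re (ip m (r t) (r t)) / e\<^sup>2"
      by (rule eventually_at_right_0I) (rule bound)
  qed
  then have "vlim (\<lambda>t. a t - ?b t) 0 (at_right 0)" by (rule vlim_bound) (use a b in auto)
  from vlim_add[OF this vlim_at_right[OF b(2)]] show ?thesis by simp
qed

text \<open>Schwarz--Pick for \<open>s \<mapsto> v\<^sup>* (s (G s + e I))\<^sup>-\<^sup>1 v\<close> between \<open>s\<close> and \<open>t \<rightarrow> 0\<close>.\<close>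

lemma boundary_schwarz:
  assumes s: "0 < Re s" and e: "e > 0" and a: "supp m a" and y: "E y"
    and v: "v = mv (G s) a + sv (complex_of_real e) a" "v = mv S y + sv (of_real e) y + mv F d"
  shows "Re s * Re (ip m y v) \<le> Re (ip m a v * cnj s)"
proof (cases "v = 0")
  case False
  define X where "X = (\<lambda>s. G s + complex_of_real e \<cdot>\<^sub>m 1\<^sub>m m)"
  have X: "X s \<in> carrier_mat m m" for s using Gc by (auto simp: X_def)
  have Xv: "mv (X s) w = mv (G s) w + sv (of_real e) w" if "supp m w" for s w
    using that Gc by (simp add: X_def mv_mat_add[of _ m m] mv_smult mv_one)
  have sv: "supp m v" unfolding v(1) using a Gc by auto
  have pos: "0 < Re (z * ip m (mv (X z) w) w)" if z: "0 < Re z" and w: "supp m w" "w \<noteq> 0" for z w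
  proof -
    have "0 < e * Re z * Re (ip m w w)" using e z ip_self_pos[OF w] by simp
    moreover have "Re (z * ip m (mv (X z) w) w) = Re (z * ip m (mv (G z) w) w) + e * Re z * Re (ip m w w)"
      using ip_self_nonneg(2)[of m w] by (simp add: Xv[OF w(1)] ip_linear algebra_simps)
    ultimately show ?thesis using pr[OF z, of w] by simp
  qed
  have dX: "det (X z) \<noteq> 0" if "0 < Re z" for z
    unfolding det_nonzero_iff[OF X] using pos[OF that] by force
  define w where "w = (\<lambda>z. mv (mat_inv (X z)) v)"
  have Xw: "mv (X z) (w z) = v" "supp m (w z)" if "0 < Re z" for z
    unfolding w_def using mv_mat_inv(1)[OF X dX[OF that] sv] mat_inv(1)[OF X dX[OF that]] by auto
  \<comment> \<open>Up to conjugation and a positive factor, \<open>f z\<close> is \<open>z\<close>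
    times the form of \<open>X z\<close> at \<open>w z\<close>, hence has positive real part.
    Division by \<open>z\<close> leaves \<open>t * Re (f t)\<close> with a finite limit at
    0.\<close>
  define f where "f = (\<lambda>z. ip m (w z) v / z)"
  have "f holomorphic_on {z. 0 < Re z}"
  proof -
    have "(\<lambda>z. w z i) holomorphic_on {z. 0 < Re z}" for i
      unfolding w_def
    proof (rule holomorphic_mat_inv[OF X])
      fix i j assume ij: "i < m" "j < m"
      have "X z $$ (i,j) = G z $$ (i,j) + (if i = j then of_real e else 0)" for z
        using ij Gc[of z] by (auto simp: X_def)
      then show "(\<lambda>z. X z $$ (i,j)) holomorphic_on {z. 0 < Re z}"
        by (auto intro!: holomorphic_intros hol ij)
    qed (use dX in auto)
    then show ?thesis unfolding f_def ip_def by (intro holomorphic_intros) auto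
  qed
  moreover have "0 < Re (f z)" if z: "0 < Re z" for z
  proof -
    have "w z \<noteq> 0" using Xw(1)[OF z] False by auto
    then have "0 < Re (z * ip m (mv (X z) (w z)) (w z))" using pos[OF z Xw(2)[OF z]] by simp
    moreover have "f z = cnj (z * ip m (mv (X z) (w z)) (w z)) / of_real ((norm z)\<^sup>2)"
      unfolding f_def Xw(1)[OF z] ip_commute[of m "w z" v] complex_norm_square using z by auto
    ultimately show ?thesis using z by (auto simp: Re_divide_of_real intro!: divide_pos_pos)
  qed
  ultimately have sp: "Re s * t * Re (f (of_real t)) \<le> Re (f s) * (norm (s + of_real t))\<^sup>2" if "t > 0" for t
    by (rule half_plane_schwarz_pick) (use that s in auto)
  \<comment> \<open>For \<open>t \<le> 0\<close> the inverse may be unspecified, while the support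
    condition is required for all \<open>t\<close>; the value 0 meets it.\<close>
  let ?w = "\<lambda>t::real. if t > 0 then w (of_real t) else 0"
  have "vlim ?w y (at_right 0)"
    by (rule regularized_inverse_limit[OF e y]) (use Xw v(2) in \<open>auto simp: Xv\<close>)
  then have "((\<lambda>t. Re s * Re (ip m (?w t) v)) \<longlongrightarrow> Re s * Re (ip m y v)) (at_right 0)"
    by (intro tendsto_intros vlim_ip) auto
  moreover have "((\<lambda>t. Re (f s) * (norm (s + of_real t))\<^sup>2) \<longlongrightarrow> Re (f s) * (norm (s + of_real 0))\<^sup>2) (at_right (0::real))"
    by (intro tendsto_intros)
  moreover have "\<forall>\<^sub>F t in at_right (0::real). Re s * Re (ip m (?w t) v) \<le> Re (f s) * (norm (s + of_real t))\<^sup>2"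
  proof (rule eventually_at_right_0I)
    fix t :: real assume t: "t > 0"
    have "t * Re (f (of_real t)) = Re (ip m (w (of_real t)) v)" using t by (simp add: f_def)
    then show "Re s * Re (ip m (?w t) v) \<le> Re (f s) * (norm (s + of_real t))\<^sup>2"
      using sp[OF t] t by (simp add: mult.assoc)
  qed
  ultimately have "Re s * Re (ip m y v) \<le> Re (f s) * (norm (s + of_real 0))\<^sup>2"
    by (intro tendsto_le[OF _ _ _]) auto
  moreover have "w s = a"
    using mv_mat_inv(2)[OF X dX[OF s] a] Xv[OF a] v(1) by (simp add: w_def)
  moreover have "Re (ip m a v / s) * (norm s)\<^sup>2 = Re (ip m a v * cnj s)"
  proof -
    have "s \<noteq> 0" using s by auto
    then have "ip m a v / s * of_real ((norm s)\<^sup>2) = ip m a v * cnj s" unfolding complex_norm_square by simp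
    then show ?thesis by (metis Re_mult_real)
  qed
  ultimately show ?thesis by (simp add: f_def)
qed simp

end

section \<open>The closed loop\<close>

definition stack :: "nat \<Rightarrow> (nat \<Rightarrow> complex) \<Rightarrow> (nat \<Rightarrow> complex) \<Rightarrow> nat \<Rightarrow> complex" where
  "stack n x x' = (\<lambda>i. if i < n then x i else x' (i - n))"

lemma supp_stack: "supp n' x' \<Longrightarrow> supp (n + n') (stack n x x')"
  by (auto simp: supp_def stack_def)

lemma stack_cases:
  assumes "supp (n + n') z"
  obtains x x' where "supp n x" "supp n' x'" "z = stack n x x'"
proof (rule that[of "\<lambda>i. if i < n then z i else 0" "\<lambda>i. z (i + n)"])
  show "z = stack n (\<lambda>i. if i < n then z i else 0) (\<lambda>i. z (i + n))" by (auto simp: stack_def fun_eq_iff)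
qed (use assms in \<open>auto simp: supp_def\<close>)

lemma stack_eq_iff: "supp n x \<Longrightarrow> supp n y \<Longrightarrow> stack n x x' = stack n y y' \<longleftrightarrow> x = y \<and> x' = y'"
proof
  assume s: "supp n x" "supp n y" and eq: "stack n x x' = stack n y y'"
  have "x i = y i" if "i < n" for i using fun_cong[OF eq, of i] that by (simp add: stack_def)
  then have "x = y" by (intro supp_eqI[OF s]) auto
  moreover have "x' i = y' i" for i using fun_cong[OF eq, of "n + i"] by (simp add: stack_def)
  ultimately show "x = y \<and> x' = y'" by auto
qed auto

lemma stack_lin: "sv c (stack n x x') = stack n (sv c x) (sv c x')"
  "stack n x x' - stack n y y' = stack n (x - y) (x' - y')"
  by (auto simp: stack_def sv_def fun_eq_iff)

lemma stack_zero_zero [simp]: "stack n 0 0 = 0"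
  by (simp add: stack_def fun_eq_iff)

lemma stack_zero: "supp n x \<Longrightarrow> stack n x 0 = x"
  by (auto simp: stack_def supp_def fun_eq_iff)

lemma mv_stack: "X \<in> carrier_mat m n \<Longrightarrow> mv X (stack n x x') = mv X x"
  by (auto simp: mv_def stack_def fun_eq_iff)

lemma sum_lessThan_split: "(\<Sum>j<n + n'. f j) = (\<Sum>j<n. f j) + (\<Sum>j<n'. f (n + j :: nat) :: complex)"
  by (induction n') (simp_all add: add.assoc)

lemma mv_four_block:
  assumes "P \<in> carrier_mat p q" "Q \<in> carrier_mat p q'" "R \<in> carrier_mat p' q" "T \<in> carrier_mat p' q'"
  shows "mv (four_block_mat P Q R T) (stack q x x') = stack p (mv P x + mv Q x') (mv R x + mv T x')"
  using assms by (auto simp: mv_def sum_lessThan_split stack_def fun_eq_iff)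

lemma closed_loop_strictly_proper:
  assumes "A \<in> carrier_mat n n" "B \<in> carrier_mat n m" "C \<in> carrier_mat m n"
    and "A' \<in> carrier_mat n' n'" "B' \<in> carrier_mat n' m" "C' \<in> carrier_mat m n'" "D' \<in> carrier_mat m m"
  shows "closed_loop_matrix A B C (0\<^sub>m m m) A' B' C' D' =
    four_block_mat (A + B * D' * C) (B * C') (B' * C) A'"
    and "det (1\<^sub>m (dim_row (0\<^sub>m m m :: real mat)) - 0\<^sub>m m m * D') \<noteq> 0"
proof -
  have one: "1\<^sub>m m - 0\<^sub>m m m * D' = (1\<^sub>m m :: real mat)" using assms by (intro eq_matI) auto
  then show "det (1\<^sub>m (dim_row (0\<^sub>m m m :: real mat)) - 0\<^sub>m m m * D') \<noteq> 0" by simp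
  have inv: "mat_inv (1\<^sub>m m) = (1\<^sub>m m :: real mat)" by (rule mat_inv_unique(1)[of _ m]) auto
  have BD: "B * D' \<in> carrier_mat n m" using assms by auto
  have 1: "B * D' * 1\<^sub>m m = B * D'" "B' * 1\<^sub>m m = B'" using assms BD by auto
  have 2: "B * D' * 0\<^sub>m m m * C' = 0\<^sub>m n n'" "B' * 0\<^sub>m m m * C' = 0\<^sub>m n' n'" using assms BD by auto
  have 3: "B * C' + 0\<^sub>m n n' = B * C'" "A' + 0\<^sub>m n' n' = A'" using assms by auto
  show "closed_loop_matrix A B C (0\<^sub>m m m) A' B' C' D' = four_block_mat (A + B * D' * C) (B * C') (B' * C) A'"
    unfolding closed_loop_matrix_def Let_def by (simp add: one inv 1 2 3)
qed

text \<open>\<open>N\<close> is the Schur complement of \<open>M\<close> with respect to the range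
  of \<open>F\<close>, given by its characteristic property: a suitable shift of \<open>w\<close>
  along this range has the image \<open>N w\<close>, which is orthogonal to the range. No inverse of
  \<open>F^T M F\<close> appears in the stability argument.\<close>

locale ni_feedback = ni_laurent +
  fixes G' :: "complex \<Rightarrow> complex mat" and n n' :: nat and A B C A' B' C' D' :: "real mat" and M N :: "complex mat"
  assumes tf: "transfer_function_matrix m G" and tf': "transfer_function_matrix m G'"
    and min: "minimal_realization m n A B C (0\<^sub>m m m) G"
    and min': "minimal_realization m n' A' B' C' D' G'"
    and sni: "strictly_negative_imaginary m G'"
    and M_def: "M = cmat (dc_gain G')"
    and N_car: "N \<in> carrier_mat m m"
    and M_N: "\<And>w. supp m w \<Longrightarrow> \<exists>d. mv M (w + mv F d) = mv N w"
    and N_perp: "\<And>d w. ip m (mv F d) (mv N w) = 0"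
    and N_F: "\<And>d. mv N (mv F d) = 0"
begin

definition Acl :: "complex mat" where
  "Acl = cmat (closed_loop_matrix A B C (0\<^sub>m m m) A' B' C' D')"

lemma N_E: "E (mv N w)"
  using N_perp N_car by (auto simp: E_def)

lemma r: "realization m n A B C (0\<^sub>m m m) G" and r': "realization m n' A' B' C' D' G'"
  using min min' by (auto simp: minimal_realization_def)

lemmas rcar = realization_carrier[OF r] realization_carrier[OF r']

lemmas sni_pr = sni_positive_real[OF tf' sni r', folded M_def]

lemma M_sym: "ip m (mv M v) w = cnj (ip m (mv M w) v)"
  by (rule hermitian_ip_real[OF sni_pr(1,2)])

lemma cmat_zero [simp]: "rv (0\<^sub>m m m) v = 0"
  by (simp add: mv_def fun_eq_iff)

lemma Acl_car: "Acl \<in> carrier_mat (n + n') (n + n')"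
  unfolding Acl_def using rcar closed_loop_strictly_proper(1)[OF rcar(1-3) rcar(9-12)] by simp

text \<open>The closed-loop pencil splits into two state equations, coupled by the output
  \<open>u\<close> of \<open>G\<close> and its input \<open>y\<close>. Eigenvectors and the
  closed-loop resolvent are both read in this form.\<close>

lemma Acl_mv:
  assumes "supp n x" "supp n' x'" "u = rv C x" "y = rv C' x' + rv D' u"
  shows "sv s (stack n x x') - mv Acl (stack n x x') =
    stack n (sv s x - rv A x - rv B y) (sv s x' - rv A' x' - rv B' u)"
proof -
  have "Acl = four_block_mat (cmat (A + B * D' * C)) (cmat (B * C')) (cmat (B' * C)) (cmat A')"
    unfolding Acl_def closed_loop_strictly_proper(1)[OF rcar(1-3) rcar(9-12)]
    by (rule map_four_block_mat) (use rcar in auto)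
  moreover have dims: "dim_row A = n" "dim_col A = n" "dim_row B = n" "dim_col B = m" "dim_row C = m" "dim_col C = n"
    "dim_row B' = n'" "dim_col B' = m" "dim_row C' = m" "dim_row D' = m" "dim_col D' = m" using rcar by auto
  moreover have "rv (A + B * D' * C) x = rv A x + rv B (rv D' u)"
    by (simp add: dims mv_cmat_add mv_cmat_mult assms(3))
  moreover have "rv (B * C') x' = rv B (rv C' x')" by (simp add: dims mv_cmat_mult)
  moreover have "rv (B' * C) x = rv B' u" by (simp add: dims mv_cmat_mult assms(3))
  ultimately have eq: "mv Acl (stack n x x') = stack n (rv A x + rv B (rv D' u) + rv B (rv C' x'))
      (rv B' u + rv A' x')"
    using mv_four_block[of "cmat (A + B * D' * C)" n n "cmat (B * C')" n' "cmat (B' * C)" n' "cmat A'" x x'] rcar by simp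
  show ?thesis unfolding eq stack_lin assms(4) by (simp add: mv_add algebra_simps)
qed

lemma trajectory_output_G':
  assumes "0 \<le> Re s" "supp n' x'" "supp m u" "sv s x' - rv A' x' = rv B' u"
  shows "rv C' x' + rv D' u = mv (G' s) u"
  by (rule trajectory_output[OF tf' min' sni_pr(5)[OF assms(1)] assms(2-4)])

text \<open>On the axis \<open>1 / s\<close> is the conjugate of \<open>s\<close> over its squared
  norm, and \<open>u^* M u\<close> is real, so the inequality for the quotient becomes one for
  \<open>G'\<close> alone. Its sign is opposite to that of \<open>G\<close>, which excludes nonzero
  eigenvalues there.\<close>

lemma imag_axis:
  assumes "Re s = 0" "supp m u"
  shows "Re (s * ip m u (mv (G' s) u)) \<le> 0" and "s \<noteq> 0 \<Longrightarrow> u \<noteq> 0 \<Longrightarrow> Re (s * ip m u (mv (G' s) u)) < 0"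
proof -
  let ?q = "ip m (mv (G' s) u) u" and ?p = "ip m (mv M u) u"
  show *: "Re (s * ip m u (mv (G' s) u)) < 0" if "s \<noteq> 0" "u \<noteq> 0"
  proof -
    have "0 < Re ((?p - ?q) / s)" by (rule sni_pr(4)[OF assms(1) that(1) assms(2) that(2)])
    then have "0 < Re ((?p - ?q) / s) * (norm s)\<^sup>2" using that by simp
    also have "\<dots> = Re ((?p - ?q) / s * of_real ((norm s)\<^sup>2))" by (simp only: Re_mult_real)
    also have "(?p - ?q) / s * of_real ((norm s)\<^sup>2) = (?p - ?q) * cnj s"
      unfolding complex_norm_square using that by simp
    also have "Re \<dots> = - Re (s * ip m u (mv (G' s) u))"
      using assms(1) sni_pr(2)[of u] ip_commute[of m u "mv (G' s) u"] by (simp add: algebra_simps)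
    finally show ?thesis by simp
  qed
  then show "Re (s * ip m u (mv (G' s) u)) \<le> 0" by (cases "s = 0 \<or> u = 0") (auto intro: less_imp_le)
qed

text \<open>The closed-loop transfer function from a disturbance \<open>v\<close> added to the input
  of \<open>G\<close> to the output of \<open>G\<close>. The state-space form keeps it meaningful at
  poles of \<open>G\<close> that are not closed-loop eigenvalues.\<close>

definition U :: "complex \<Rightarrow> (nat \<Rightarrow> complex) \<Rightarrow> nat \<Rightarrow> complex" where
  "U s v = rv C (mv (mat_inv (s \<cdot>\<^sub>m 1\<^sub>m (n + n') - Acl)) (rv B v))"

lemma U_eqI:
  assumes d: "det (s \<cdot>\<^sub>m 1\<^sub>m (n + n') - Acl) \<noteq> 0" and x: "supp n x" "supp n' x'"
    and u: "u = rv C x" and y: "y = rv C' x' + rv D' u"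
    and eq: "sv s x - rv A x = rv B (y + v)" "sv s x' - rv A' x' = rv B' u"
  shows "U s v = u"
proof -
  have car: "s \<cdot>\<^sub>m 1\<^sub>m (n + n') - Acl \<in> carrier_mat (n + n') (n + n')" using Acl_car by auto
  have sj: "supp (n + n') (stack n x x')" by (rule supp_stack[OF x(2)])
  have "mv (s \<cdot>\<^sub>m 1\<^sub>m (n + n') - Acl) (stack n x x') = stack n (rv B v) 0"
    unfolding mv_char[OF Acl_car sj] Acl_mv[OF x u y] using eq by (simp add: mv_add)
  also have "\<dots> = rv B v" by (rule stack_zero) (use rcar in auto)
  finally have "stack n x x' = mv (mat_inv (s \<cdot>\<^sub>m 1\<^sub>m (n + n') - Acl)) (rv B v)"
    using mv_mat_inv(2)[OF car d sj] by simp
  then show ?thesis using u mv_stack[OF rcar(7), of x x'] by (simp add: U_def)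
qed

lemma U_cases:
  assumes d: "det (s \<cdot>\<^sub>m 1\<^sub>m (n + n') - Acl) \<noteq> 0"
  obtains x x' u y where "supp n x" "supp n' x'" "u = rv C x" "y = rv C' x' + rv D' u"
    "sv s x - rv A x = rv B (y + v)" "sv s x' - rv A' x' = rv B' u" "U s v = u"
proof -
  have car: "s \<cdot>\<^sub>m 1\<^sub>m (n + n') - Acl \<in> carrier_mat (n + n') (n + n')" using Acl_car by auto
  have "supp (n + n') (mv (mat_inv (s \<cdot>\<^sub>m 1\<^sub>m (n + n') - Acl)) (rv B v))"
    using mat_inv(1)[OF car d] by auto
  then obtain x x' where x: "supp n x" "supp n' x'"
    "mv (mat_inv (s \<cdot>\<^sub>m 1\<^sub>m (n + n') - Acl)) (rv B v) = stack n x x'" by (rule stack_cases)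
  have sB: "supp n (rv B v)" using rcar by auto
  have "mv (s \<cdot>\<^sub>m 1\<^sub>m (n + n') - Acl) (stack n x x') = rv B v"
    unfolding x(3)[symmetric] by (rule mv_mat_inv(1)[OF car d]) (use sB in \<open>auto simp: supp_def\<close>)
  then have "stack n (sv s x - rv A x - rv B (rv C' x' + rv D' (rv C x)))
      (sv s x' - rv A' x' - rv B' (rv C x)) = stack n (rv B v) 0"
    unfolding stack_zero[OF sB] mv_char[OF Acl_car supp_stack[OF x(2)]] Acl_mv[OF x(1,2) refl refl] .
  moreover have "supp n (sv s x - rv A x - rv B (rv C' x' + rv D' (rv C x)))"
    using x rcar by auto
  ultimately have "sv s x - rv A x - rv B (rv C' x' + rv D' (rv C x)) = rv B v"
    "sv s x' - rv A' x' - rv B' (rv C x) = 0" using stack_eq_iff[OF _ sB] by blast+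
  then show ?thesis
    by (intro that[OF x(1,2) refl refl]) (simp_all add: mv_add algebra_simps U_def x(3) mv_stack[OF rcar(7)])
qed

text \<open>For a stable loop no pole lies in the closed right half plane, so only the axis needs a
  sign. There \<open>ip m u v\<close> is \<open>ip m u (y + v)\<close> minus
  \<open>ip m u y\<close>; multiplied by \<open>s\<close>, the first has nonnegative real part
  because of \<open>G\<close>, the second nonpositive because of \<open>G'\<close>.\<close>

lemma stable_positive_real:
  assumes stable: "\<And>z. eigenvalue Acl z \<Longrightarrow> Re z < 0" and s: "0 < Re s" and v: "supp m v"
  shows "0 \<le> Re (s * ip m (U s v) v)"
proof (rule positive_real_from_boundary(1)[of "{z. eigenvalue Acl z}", OF _ _ _ _ _ _ s])
  have d: "det (s \<cdot>\<^sub>m 1\<^sub>m (n + n') - Acl) \<noteq> 0" if "\<not> eigenvalue Acl s" for s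
    using det_char_nonzero_iff[OF Acl_car] that by simp
  show "finite {z. eigenvalue Acl z}" by (rule finite_eigenvalues[OF Acl_car])
  have "(\<lambda>s. mv (mat_inv (s \<cdot>\<^sub>m 1\<^sub>m (n + n') - Acl)) (rv B v) i) holomorphic_on - {z. eigenvalue Acl z}" for i
  proof (rule holomorphic_mat_inv)
    show "s \<cdot>\<^sub>m 1\<^sub>m (n + n') - Acl \<in> carrier_mat (n + n') (n + n')" for s using Acl_car by auto
    fix i j assume "i < n + n'" "j < n + n'"
    then show "(\<lambda>s. (s \<cdot>\<^sub>m 1\<^sub>m (n + n') - Acl) $$ (i,j)) holomorphic_on - {z. eigenvalue Acl z}"
      using Acl_car by (auto intro!: holomorphic_intros)
  qed (use d in auto)
  then have "(\<lambda>s. U s v i) holomorphic_on - {z. eigenvalue Acl z}" for i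
    unfolding U_def mv_def[of "cmat C"] by (cases "i < dim_row (cmat C)") (simp_all, intro holomorphic_intros)
  then show "(\<lambda>s. s * ip m (U s v) v) holomorphic_on - {z. eigenvalue Acl z}"
    unfolding ip_def by (intro holomorphic_intros)
  show "Re z \<le> 0" if "z \<in> {z. eigenvalue Acl z}" for z using stable that by (auto intro: less_imp_le)
  show "\<exists>r\<ge>0. ((\<lambda>s. (s - \<i> * of_real x) * (s * ip m (U s v) v)) \<longlongrightarrow> of_real r) (at (\<i> * of_real x))"
    if "\<i> * of_real x \<in> {z. eigenvalue Acl z}" for x :: real using stable that by force
  show "0 \<le> Re (\<i> * of_real r * ip m (U (\<i> * of_real r) v) v)" if ne: "\<i> * of_real r \<notin> {z. eigenvalue Acl z}" for r :: real
  proof -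
    define s where "s = \<i> * complex_of_real r"
    have s0: "Re s = 0" "0 \<le> Re s" and dl: "det (s \<cdot>\<^sub>m 1\<^sub>m (n + n') - Acl) \<noteq> 0" using d ne by (auto simp: s_def)
    obtain x x' u y where x: "supp n x" "supp n' x'" and u: "u = rv C x" and y: "y = rv C' x' + rv D' u"
      and eq: "sv s x - rv A x = rv B (y + v)" "sv s x' - rv A' x' = rv B' u"
      and U: "U s v = u" using U_cases[OF dl, of v] by metis
    have su: "supp m u" and sy: "supp m (y + v)" using u y v rcar by auto
    have "y = mv (G' s) u" unfolding y by (rule trajectory_output_G'[OF s0(2) x(2) su eq(2)])
    then have "Re (s * ip m u y) \<le> 0" using imag_axis(1)[OF s0(1) su] by simp
    moreover have "0 \<le> Re (s * ip m (rv C x + rv (0\<^sub>m m m) (y + v)) (y + v))"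
      by (rule trajectory_positive_real[OF tf min pr x(1) sy eq(1) s0(2)])
    ultimately have "0 \<le> Re (s * ip m (U s v) v)" unfolding U by (simp add: u ip_add_right distrib_left)
    then show ?thesis by (simp only: s_def)
  qed
  have "vlim (\<lambda>s. U s v) (rv C 0) at_infinity"
    unfolding U_def by (intro vlim_mv resolvent_tendsto_zero[OF Acl_car])
  then have "((\<lambda>s. ip m (U s v) v) \<longlongrightarrow> 0) at_infinity" using vlim_ip[of _ 0 _ "\<lambda>_. v" v] by force
  then show "((\<lambda>s. s * ip m (U s v) v / s) \<longlongrightarrow> 0) at_infinity"
  proof (rule Lim_transform_eventually)
    show "\<forall>\<^sub>F s in at_infinity. ip m (U s v) v = s * ip m (U s v) v / s"
      unfolding eventually_at_infinity by (intro exI[of _ 1]) auto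
  qed
qed

text \<open>The disturbance \<open>w t\<close> is chosen so that \<open>G\<close> receives the test
  vector and the loop responds with \<open>u t\<close>. In the limit the disturbance is
  \<open>y - M v\<close> and the response \<open>v\<close>, and positivity of the closed loop gives
  the first claim. If the limit disturbance vanishes, so does the response of a stable loop, which
  is the second.\<close>

lemma stable_necessary:
  assumes stable: "\<And>z. eigenvalue Acl z \<Longrightarrow> Re z < 0" and y: "E y" and v: "v = mv S y + mv F d"
  shows "Re (ip m (mv M v) v) \<le> Re (ip m (mv S y) y)"
    and "y = mv M v \<Longrightarrow> v = 0"
proof -
  obtain b where b: "\<And>s. supp m (b s)" "vlim b y (at 0)" "vlim (\<lambda>s. mv (G s) (b s)) v (at 0)"
    unfolding v using test_vectors[OF y, of d] by metis
  define u where "u = (\<lambda>t::real. mv (G (of_real t)) (b (of_real t)))"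
  define w where "w = (\<lambda>t::real. b (of_real t) - mv (G' (of_real t)) (u t))"
  have ul: "vlim u v (at_right 0)" unfolding u_def by (rule vlim_at_right[OF b(3)])
  have Gc': "G' s \<in> carrier_mat m m" for s using tf' by (simp add: transfer_function_matrix_def)
  have "mlim (\<lambda>t. G' (complex_of_real t)) M (at_right 0)"
    using mlim_compose[OF sni_pr(5)[of 0] at_right_complex] by (simp add: sni_pr(6))
  then have wl: "vlim w (y - mv M v) (at_right 0)"
    unfolding w_def by (intro vlim_diff vlim_at_right[OF b(2)] vlim_mat_mv[OF _ Gc' sni_pr(1)] ul)
  have su: "supp m (u t)" and sw: "supp m (w t)" for t
    using Gc Gc' b(1) by (auto simp: u_def w_def)
  have "\<forall>\<^sub>F t in at_right (0::real). det (of_real t \<cdot>\<^sub>m 1\<^sub>m n - cmat A) \<noteq> 0 \<and> det (of_real t \<cdot>\<^sub>m 1\<^sub>m n' - cmat A') \<noteq> 0"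
    using eventually_char_nonzero[OF rcar(5), of 0] eventually_char_nonzero[OF rcar(13), of 0]
    by (intro filterlim_iff[THEN iffD1, OF at_right_complex, rule_format]) (auto elim: eventually_elim2)
  then have ev: "\<forall>\<^sub>F t in at_right (0::real). t > 0 \<and> U (of_real t) (w t) = u t"
    using eventually_at_right_less[of 0]
  proof eventually_elim
    case (elim t)
    let ?s = "complex_of_real t"
    have car: "?s \<cdot>\<^sub>m 1\<^sub>m n - cmat A \<in> carrier_mat n n" "?s \<cdot>\<^sub>m 1\<^sub>m n' - cmat A' \<in> carrier_mat n' n'" using rcar by auto
    define x where "x = mv (mat_inv (?s \<cdot>\<^sub>m 1\<^sub>m n - cmat A)) (rv B (b ?s))"
    define x' where "x' = mv (mat_inv (?s \<cdot>\<^sub>m 1\<^sub>m n' - cmat A')) (rv B' (u t))"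
    have sx: "supp n x" "supp n' x'" using mat_inv(1)[OF car(1)] mat_inv(1)[OF car(2)] elim by (auto simp: x_def x'_def)
    have x: "sv ?s x - rv A x = rv B (b ?s)"
      using mv_mat_inv(1)[OF car(1), of "rv B (b ?s)"] elim rcar mv_char[OF rcar(5) sx(1)] by (auto simp: x_def)
    have x': "sv ?s x' - rv A' x' = rv B' (u t)"
      using mv_mat_inv(1)[OF car(2), of "rv B' (u t)"] elim rcar mv_char[OF rcar(13) sx(2)] by (auto simp: x'_def)
    have "rv C x = u t" using realization_output[OF r _ sx(1) x] elim by (simp add: u_def)
    moreover have "rv C' x' + rv D' (u t) = mv (G' ?s) (u t)"
      using realization_output[OF r' _ sx(2) x'] elim by simp
    moreover have "det (?s \<cdot>\<^sub>m 1\<^sub>m (n + n') - Acl) \<noteq> 0"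
      using det_char_nonzero_iff[OF Acl_car] stable[of ?s] elim by force
    ultimately have "U ?s (w t) = u t"
      by (intro U_eqI[OF _ sx]) (use x x' in \<open>auto simp: w_def\<close>)
    then show ?case using elim by simp
  qed
  have "((\<lambda>t. Re (ip m (u t) (w t))) \<longlongrightarrow> Re (ip m v (y - mv M v))) (at_right 0)"
    by (intro tendsto_intros vlim_ip ul wl)
  moreover have "\<forall>\<^sub>F t in at_right 0. 0 \<le> Re (ip m (u t) (w t))"
    using ev
  proof eventually_elim
    case (elim t)
    then show ?case using stable_positive_real[OF stable, of "of_real t" "w t"] sw by (simp add: zero_le_mult_iff)
  qed
  ultimately have "0 \<le> Re (ip m v (y - mv M v))" by (rule tendsto_lowerbound) simp
  moreover have "ip m v y = ip m (mv S y) y" unfolding v using E_perp[OF y] by (simp add: ip_linear)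
  moreover have "ip m v (mv M v) = cnj (ip m (mv M v) v)" by (rule ip_commute)
  ultimately show "Re (ip m (mv M v) v) \<le> Re (ip m (mv S y) y)" by (simp add: ip_diff_right)
  show "v = 0" if "y = mv M v"
  proof -
    let ?X = "\<lambda>t::real. complex_of_real t \<cdot>\<^sub>m 1\<^sub>m (n + n') - Acl"
    have "mlim ?X (0 \<cdot>\<^sub>m 1\<^sub>m (n + n') - Acl) (at_right 0)"
      by (rule mlim_compose[OF mlim_char[OF Acl_car] at_right_complex])
    moreover have "det (0 \<cdot>\<^sub>m 1\<^sub>m (n + n') - Acl) \<noteq> 0" using det_char_nonzero_iff[OF Acl_car] stable[of 0] by force
    moreover have "vlim (\<lambda>t. rv B (w t)) (rv B 0) (at_right 0)"
      using vlim_mv[OF wl, of "cmat B"] that by simp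
    ultimately have "vlim (\<lambda>t. mv (mat_inv (?X t)) (rv B (w t)))
        (mv (mat_inv (0 \<cdot>\<^sub>m 1\<^sub>m (n + n') - Acl)) (rv B 0)) (at_right 0)"
      using Acl_car by (intro vlim_mat_inv(2)) auto
    from vlim_mv[OF this, of "cmat C"] have "vlim (\<lambda>t. U (of_real t) (w t)) 0 (at_right 0)" by (simp add: U_def)
    then have "vlim u 0 (at_right 0)" by (rule vlim_cong) (use ev in \<open>auto elim: eventually_mono\<close>)
    from vlim_unique[OF ul this] show ?thesis by simp
  qed
qed

text \<open>The image of \<open>w + F d0\<close> under \<open>M\<close> is orthogonal to the range
  of \<open>F\<close>, so all cross terms vanish.\<close>

lemma completed_square:
  assumes w: "supp m w"
  obtains d0 where "\<And>d. ip m (mv M (w + mv F d)) (w + mv F d) =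
      ip m (mv N w) w + ip m (mv M (mv F (d - d0))) (mv F (d - d0))" "mv M (w + mv F d0) = mv N w"
proof -
  obtain d0 where d0: "mv M (w + mv F d0) = mv N w" using M_N[OF w] by blast
  have "ip m (mv M (w + mv F d)) (w + mv F d) =
      ip m (mv N w) w + ip m (mv M (mv F (d - d0))) (mv F (d - d0))" for d
  proof -
    define p g where "p = w + mv F d0" and "g = mv F (d - d0)"
    have eq: "w + mv F d = p + g" by (simp add: p_def g_def mv_diff)
    have Mp: "mv M p = mv N w" unfolding p_def by (rule d0)
    have pg: "ip m (mv M p) g = 0" unfolding Mp g_def by (rule E_perp(2)[OF N_E])
    then have gp: "ip m (mv M g) p = 0" using M_sym[of g p] by simp
    have pp: "ip m (mv M p) p = ip m (mv N w) w"
      unfolding Mp unfolding p_def ip_add_right using E_perp(2)[OF N_E] by simp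
    show ?thesis unfolding eq g_def[symmetric] mv_add ip_add_left ip_add_right pg gp pp by simp
  qed
  with d0 that show ?thesis by blast
qed

text \<open>Common core of both criteria. In \<open>N_bound\<close> the last term is a slack that
  disappears with \<open>e\<close>; \<open>N_strict\<close> is the equality case, required at the
  eigenvalue 0.\<close>

lemma stable_sufficient:
  assumes neg: "\<And>d. mv F d \<noteq> 0 \<Longrightarrow> Re (ip m (mv M (mv F d)) (mv F d)) < 0"
    and N_bound: "\<And>e y w. e > 0 \<Longrightarrow> E y \<Longrightarrow> w = mv S y + sv (complex_of_real e) y \<Longrightarrow>
      Re (ip m (mv N w) w) \<le> Re (ip m y w) + e * Re (ip m (mv N w) (mv N w))"
    and N_strict: "\<And>y. E y \<Longrightarrow> Re (ip m (mv S y) y) \<le> Re (ip m (mv N (mv S y)) (mv S y)) \<Longrightarrow> mv N (mv S y) = 0"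
    and ev: "eigenvalue Acl s"
  shows "Re s < 0"
proof (rule ccontr)
  assume "\<not> Re s < 0"
  then have s: "0 \<le> Re s" by simp
  obtain z where z: "supp (n + n') z" "z \<noteq> 0" "mv Acl z = sv s z" using ev eigenvalue_iff[OF Acl_car] by blast
  obtain x x' where x: "supp n x" "supp n' x'" "z = stack n x x'" using stack_cases[OF z(1)] by metis
  define u where "u = rv C x"
  define y where "y = rv C' x' + rv D' u"
  have su: "supp m u" and sy: "supp m y" using rcar by (auto simp: u_def y_def)
  have "stack n (sv s x - rv A x - rv B y) (sv s x' - rv A' x' - rv B' u) = 0"
    using Acl_mv[OF x(1,2) u_def y_def, of s] z(3) x(3) by simp
  also have "0 = stack n 0 0" by simp
  finally have "sv s x - rv A x - rv B y = 0 \<and> sv s x' - rv A' x' - rv B' u = 0"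
    using x rcar by (subst (asm) stack_eq_iff) auto
  then have eq: "sv s x - rv A x = rv B y" "sv s x' - rv A' x' = rv B' u" by auto
  have y: "y = mv (G' s) u" unfolding y_def by (rule trajectory_output_G'[OF s x(2) su eq(2)])
  \<comment> \<open>If \<open>u\<close> vanished then so would \<open>y\<close>, and observability
    of both systems would make the eigenvector 0.\<close>
  have "u \<noteq> 0"
  proof
    assume u: "u = 0"
    have "x = 0" by (rule minimal_realization_observable[OF tf min x(1), of s]) (use u y eq u_def in auto)
    moreover have "x' = 0"
      by (rule minimal_realization_observable[OF tf' min' x(2), of s]) (use u y y_def eq in auto)
    ultimately show False using x(3) z(2) by simp
  qed
  consider "Re s = 0" "s \<noteq> 0" | "s = 0" | "0 < Re s" using s by force
  then show False
  proof cases
    case 1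
    have "0 \<le> Re (s * ip m (rv C x + rv (0\<^sub>m m m) y) y)"
      by (rule trajectory_positive_real[OF tf min pr x(1) sy eq(1) s])
    then show False using imag_axis(2)[OF 1(1) su 1(2) \<open>u \<noteq> 0\<close>] y by (simp add: u_def)
  next
    case 2
    obtain Y where Y: "vlim Y y (at_right (0::real))" "\<And>t. supp m (Y t)"
      "vlim (\<lambda>t. mv (G (s + of_real t)) (Y t)) (rv C x + rv (0\<^sub>m m m) y) (at_right 0)"
      using trajectory_limit[OF tf min x(1) sy eq(1)] by metis
    then have "vlim (\<lambda>t. mv (G (of_real t)) (Y t)) u (at_right 0)" using 2 by (simp add: u_def)
    from limit_relation[OF Y(2,1) this] obtain d where Ey: "E y" and d: "u = mv S y + mv F d" by blast
    have yM: "y = mv M u" using y 2 sni_pr(6) by simp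
    let ?w = "mv S y"
    have sw: "supp m ?w" using S_car by auto
    obtain d0 where d0: "\<And>d. ip m (mv M (?w + mv F d)) (?w + mv F d) =
      ip m (mv N ?w) ?w + ip m (mv M (mv F (d - d0))) (mv F (d - d0))" "mv M (?w + mv F d0) = mv N ?w"
      using completed_square[OF sw] by metis
    let ?g = "mv F (d - d0)"
    \<comment> \<open>With \<open>y = M u\<close> the completed square equates the form of
      \<open>S\<close> at \<open>y\<close> with that of \<open>N\<close> at \<open>S y\<close>, up
      to the nonpositive term in \<open>?g\<close>. \<open>N_strict\<close> and negativity on the
      range of \<open>F\<close> then leave only a \<open>u\<close> in this range with
      \<open>M u = 0\<close>, which negativity excludes.\<close>
    have "ip m (mv M u) u = ip m y u" by (simp flip: yM)
    also have "\<dots> = ip m y ?w" unfolding d ip_add_right E_perp(2)[OF Ey] by simp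
    also have "\<dots> = cnj (ip m ?w y)" by (rule ip_commute)
    finally have "cnj (ip m ?w y) = ip m (mv N ?w) ?w + ip m (mv M ?g) ?g" using d0(1)[of d] unfolding d[symmetric] by simp
    from arg_cong[OF this, of Re]
    have eq1: "Re (ip m ?w y) = Re (ip m (mv N ?w) ?w) + Re (ip m (mv M ?g) ?g)" by simp
    have g: "Re (ip m (mv M ?g) ?g) \<le> 0" using neg[of "d - d0"] by (cases "?g = 0") auto
    have Nw: "mv N ?w = 0" by (rule N_strict[OF Ey]) (use eq1 g in simp)
    have "0 \<le> Re (ip m (mv M ?g) ?g)" using eq1 S_form(1)[OF Ey] by (simp add: Nw)
    then have "?g = 0" using neg[of "d - d0"] by (meson not_le)
    then have "mv F d = mv F d0" by (simp add: mv_diff)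
    then have "u = ?w + mv F d0" unfolding d by simp
    then have "mv M u = mv N ?w" using d0(2) by (simp only:)
    then have y0: "y = 0" using yM Nw by (simp only:)
    have "mv M u = 0" using yM unfolding y0 by (rule sym)
    moreover have "u = mv S 0 + mv F d" using d unfolding y0 .
    then have "u = mv F d" by simp
    ultimately have "u = mv F d" "mv M u = 0" by blast+
    then show False using neg[of d] \<open>u \<noteq> 0\<close> by simp
  next
    case 3
    have "mlim G (G s) (at s)"
      unfolding mlim_def
    proof (intro allI impI)
      fix i j assume "i < dim_row (G s)" "j < dim_col (G s)"
      then have ij: "i < m" "j < m" using Gc[of s] by auto
      have "isCont (\<lambda>s. G s $$ (i,j)) s"
        using holomorphic_on_imp_continuous_on[OF hol[OF ij]] 3 open_halfspace_Re_gt[of 0]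
        by (simp add: continuous_on_eq_continuous_at)
      then show "((\<lambda>s. G s $$ (i,j)) \<longlongrightarrow> G s $$ (i,j)) (at s)" by (simp add: isCont_def)
    qed
    from trajectory_output[OF tf min this x(1) sy eq(1)] have uG: "u = mv (G s) y" by (simp add: u_def)
    \<comment> \<open>\<open>?v e\<close> is \<open>G s + e\<close> applied to \<open>y\<close>, and
      by surjectivity also a value at some \<open>q\<close> in \<open>E\<close> of the limit
      relation with the same shift. Schwarz-Pick compares \<open>y\<close> with
      \<open>q\<close>.\<close>
    let ?v = "\<lambda>e::real. u + sv (of_real e) y"
    have le: "Re s * (Re (ip m (mv M (?v e)) (?v e)) - e * Re (ip m (mv N (?v e)) (mv N (?v e)))) \<le> Re (ip m y (?v e) * cnj s)"
      if e: "e > 0" for e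
    proof -
      have sv: "supp m (?v e)" using su sy by auto
      obtain q d where q: "E q" "?v e = mv S q + sv (of_real e) q + mv F d" using decomposition[OF e sv] by metis
      let ?w = "mv S q + sv (of_real e) q"
      have sw: "supp m ?w" using S_car E_supp[OF q(1)] by auto
      obtain d0 where d0: "\<And>d. ip m (mv M (?w + mv F d)) (?w + mv F d) =
        ip m (mv N ?w) ?w + ip m (mv M (mv F (d - d0))) (mv F (d - d0))"
        using completed_square[OF sw] by metis
      have "Re (ip m (mv M (mv F (d - d0))) (mv F (d - d0))) \<le> 0"
        using neg[of "d - d0"] by (cases "mv F (d - d0) = 0") auto
      then have "Re (ip m (mv M (?v e)) (?v e)) \<le> Re (ip m (mv N ?w) ?w)" unfolding q(2) d0 by simp
      also have "\<dots> \<le> Re (ip m q ?w) + e * Re (ip m (mv N ?w) (mv N ?w))" by (rule N_bound[OF e q(1) refl])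
      also have "ip m q ?w = ip m q (?v e)" unfolding q(2) using E_perp[OF q(1)] by (simp add: ip_linear)
      also have "mv N ?w = mv N (?v e)" unfolding q(2) by (simp add: mv_add N_F)
      finally have bound: "Re (ip m (mv M (?v e)) (?v e)) \<le> Re (ip m q (?v e)) + e * Re (ip m (mv N (?v e)) (mv N (?v e)))" .
      have "Re s * (Re (ip m (mv M (?v e)) (?v e)) - e * Re (ip m (mv N (?v e)) (mv N (?v e)))) \<le> Re s * Re (ip m q (?v e))"
        by (rule mult_left_mono) (use bound 3 in linarith)+
      also have "\<dots> \<le> Re (ip m y (?v e) * cnj s)"
        by (rule boundary_schwarz[OF 3 e sy q(1) _ q(2)]) (simp add: uG)
      finally show ?thesis .
    qed
    have vl: "vlim ?v (u + sv 0 y) (at_right 0)"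
      by (intro vlim_add vlim_sv vlim_const) (auto intro!: tendsto_eq_intros)
    have "((\<lambda>e. Re s * (Re (ip m (mv M (?v e)) (?v e)) - e * Re (ip m (mv N (?v e)) (mv N (?v e))))) \<longlongrightarrow>
       Re s * (Re (ip m (mv M (u + sv 0 y)) (u + sv 0 y)) - 0 * Re (ip m (mv N (u + sv 0 y)) (mv N (u + sv 0 y))))) (at_right 0)"
      by (intro tendsto_intros vlim_ip vlim_mv vl)
    moreover have "((\<lambda>e. Re (ip m y (?v e) * cnj s)) \<longlongrightarrow> Re (ip m y (u + sv 0 y) * cnj s)) (at_right 0)"
      by (intro tendsto_intros vlim_ip vl vlim_const)
    moreover have "\<forall>\<^sub>F e in at_right 0. Re s * (Re (ip m (mv M (?v e)) (?v e)) - e * Re (ip m (mv N (?v e)) (mv N (?v e)))) \<le> Re (ip m y (?v e) * cnj s)"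
      by (rule eventually_at_right_0I) (rule le)
    ultimately have "Re s * Re (ip m (mv M u) u) \<le> Re (ip m y u * cnj s)"
      using tendsto_le[OF trivial_limit_at_right_real] by fastforce
    \<comment> \<open>As \<open>y\<close> is \<open>G' s\<close> applied to \<open>u\<close>, strict
      positive realness of \<open>(M - G') / s\<close> is the opposite strict inequality.\<close>
    moreover have "0 < Re ((ip m (mv M u) u - ip m (mv (G' s) u) u) / s) * (norm s)\<^sup>2"
      using sni_pr(3)[OF 3 su \<open>u \<noteq> 0\<close>] 3 by (intro mult_pos_pos) auto
    moreover have "Re ((ip m (mv M u) u - ip m (mv (G' s) u) u) / s) * (norm s)\<^sup>2 =
        Re s * Re (ip m (mv M u) u) - Re (ip m y u * cnj s)"
    proof -
      have "s \<noteq> 0" using 3 by auto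
      then have "(ip m (mv M u) u - ip m (mv (G' s) u) u) / s * of_real ((norm s)\<^sup>2) = (ip m (mv M u) u - ip m y u) * cnj s"
        unfolding complex_norm_square y by simp
      moreover have "Re ((ip m (mv M u) u - ip m (mv (G' s) u) u) / s) * (norm s)\<^sup>2 =
          Re ((ip m (mv M u) u - ip m (mv (G' s) u) u) / s * of_real ((norm s)\<^sup>2))" by (simp only: Re_mult_real)
      ultimately show ?thesis using sni_pr(2)[of u] by (simp add: left_diff_distrib)
    qed
    ultimately show False by simp
  qed
qed

end

section \<open>Singular value decompositions and the matrix \<open>F\<close>\<close>

lemma ip_cmat: "X \<in> carrier_mat p q \<Longrightarrow> ip p (rv X v) w = ip q v (rv (X\<^sup>T) w)"
  using ip_adjoint[of "cmat X" p q v w] by (simp add: mat_adjoint_cmat)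

lemma cmat_symI:
  assumes X: "X \<in> carrier_mat n n"
    and sym: "\<And>v w. supp n v \<Longrightarrow> supp n w \<Longrightarrow> ip n (rv X v) w = ip n v (rv X w)"
  shows "X\<^sup>T = X"
proof (rule eq_matI)
  fix i j assume "i < dim_row X" "j < dim_col X"
  then have ij: "i < n" "j < n" using X by auto
  have supp: "supp n (unitv i)" "supp n (unitv j)" using ij by (auto simp: supp_def unitv_def)
  have right: "ip n v (unitv k) = v k" if "k < n" for v k
    using that by (simp add: ip_def unitv_def if_distrib[of cnj] if_distrib[of "\<lambda>c. _ * c"] cong: if_cong)
  have "rv X (unitv i) j = ip n (rv X (unitv i)) (unitv j)" using right ij by simp
  also have "\<dots> = cnj (ip n (rv X (unitv j)) (unitv i))"
    using sym[OF supp] ip_commute[of n "unitv i"] by simp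
  also have "\<dots> = cnj (rv X (unitv j) i)" using right ij by simp
  finally show "X\<^sup>T $$ (i,j) = X $$ (i,j)" using X ij by (simp add: mv_unitv)
qed (use X in auto)

lemma hcat_dims: "X \<in> carrier_mat p k \<Longrightarrow> Y \<in> carrier_mat p l \<Longrightarrow> hcat X Y \<in> carrier_mat p (k + l)"
  by (auto simp: hcat_def)

lemma mv_hcat:
  assumes "X \<in> carrier_mat p k" "Y \<in> carrier_mat p l"
  shows "rv (hcat X Y) (stack k a b) = rv X a + rv Y b"
  using assms by (auto simp: mv_def sum_lessThan_split stack_def fun_eq_iff hcat_def)

lemma mv_hcat_transpose:
  assumes "X \<in> carrier_mat p k" "Y \<in> carrier_mat p l"
  shows "rv ((hcat X Y)\<^sup>T) v = stack k (rv (X\<^sup>T) v) (rv (Y\<^sup>T) v)"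
  using assms by (auto simp: mv_def stack_def fun_eq_iff hcat_def)

lemma orthonormal_matD:
  assumes "orthonormal_mat n Q"
  shows "Q \<in> carrier_mat n n" "Q\<^sup>T * Q = 1\<^sub>m n" "Q * Q\<^sup>T = 1\<^sub>m n"
  using assms mat_mult_left_right_inverse[of "Q\<^sup>T" n Q] by (auto simp: orthonormal_mat_def)

lemma orthonormal_hcat:
  assumes o: "orthonormal_mat q (hcat V1 V2)" and V: "V1 \<in> carrier_mat q k" "V2 \<in> carrier_mat q (q - k)" and k: "k \<le> q"
  shows "supp k a \<Longrightarrow> rv (V1\<^sup>T) (rv V1 a) = a"
    and "supp (q - k) b \<Longrightarrow> rv (V1\<^sup>T) (rv V2 b) = 0"
    and "supp q v \<Longrightarrow> rv V1 (rv (V1\<^sup>T) v) + rv V2 (rv (V2\<^sup>T) v) = v"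
proof -
  note Q = orthonormal_matD[OF o]
  have 1: "stack k (rv (V1\<^sup>T) (rv V1 a + rv V2 b)) (rv (V2\<^sup>T) (rv V1 a + rv V2 b)) = stack k a b"
    if "supp (q - k) b" for a b
  proof -
    have "supp q (stack k a b)" using supp_stack[OF that, of k a] k by simp
    then have "rv ((hcat V1 V2)\<^sup>T * hcat V1 V2) (stack k a b) = stack k a b"
      unfolding Q(2) by (rule mv_cmat_one)
    moreover have "dim_col ((hcat V1 V2)\<^sup>T) = dim_row (hcat V1 V2)" by simp
    ultimately show ?thesis by (simp add: mv_cmat_mult mv_hcat[OF V] mv_hcat_transpose[OF V])
  qed
  have s: "supp k (rv (V1\<^sup>T) w)" for w using V by auto
  show "rv (V1\<^sup>T) (rv V1 a) = a" if "supp k a"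
    using 1[of 0 a] stack_eq_iff[OF s that] by simp
  show "rv (V1\<^sup>T) (rv V2 b) = 0" if "supp (q - k) b"
    using 1[OF that, of 0] stack_eq_iff[OF s, of 0] by simp
  show "rv V1 (rv (V1\<^sup>T) v) + rv V2 (rv (V2\<^sup>T) v) = v" if "supp q v"
  proof -
    have "rv (hcat V1 V2 * (hcat V1 V2)\<^sup>T) v = v" unfolding Q(3) by (rule mv_cmat_one[OF that])
    then show ?thesis by (simp add: mv_cmat_mult mv_hcat[OF V] mv_hcat_transpose[OF V])
  qed
qed

text \<open>The columns of \<open>H1\<close> are orthonormal and \<open>S\<close> is diagonal with
  positive entries, so \<open>H1 * S\<close> is injective and the kernel of \<open>M\<close> is that
  of \<open>V1\<^sup>T\<close>.\<close>

lemma is_svd_factor: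
  assumes svd: "is_svd p q k M H1 H2 S V1 V2"
  shows "rv M v = rv (H1 * S) (rv (V1\<^sup>T) v)"
    and "rv M v = 0 \<Longrightarrow> rv (V1\<^sup>T) v = 0"
proof -
  have k: "k \<le> p" "k \<le> q" and H: "H1 \<in> carrier_mat p k" "H2 \<in> carrier_mat p (p - k)"
    and V: "V1 \<in> carrier_mat q k" "V2 \<in> carrier_mat q (q - k)"
    and oH: "orthonormal_mat p (hcat H1 H2)" and S: "S \<in> carrier_mat k k" "diagonal_mat S" "\<And>i. i < k \<Longrightarrow> 0 < S $$ (i,i)"
    and M: "M = hcat H1 H2 * four_block_mat S (0\<^sub>m k (q - k)) (0\<^sub>m (p - k) k) (0\<^sub>m (p - k) (q - k)) * (hcat V1 V2)\<^sup>T"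
    using svd by (auto simp: is_svd_def)
  let ?B = "four_block_mat S (0\<^sub>m k (q - k)) (0\<^sub>m (p - k) k) (0\<^sub>m (p - k) (q - k))"
  have cB: "cmat ?B = four_block_mat (cmat S) (0\<^sub>m k (q - k)) (0\<^sub>m (p - k) k) (0\<^sub>m (p - k) (q - k))"
    using S by (intro eq_matI) auto
  have Bv: "rv ?B (stack k a b) = stack k (rv S a) 0" for a b
    unfolding cB using S by (subst mv_four_block[of _ k k _ "q - k" _ "p - k"]) auto
  have d: "dim_col (hcat H1 H2) = dim_row ?B" "dim_col (hcat H1 H2 * ?B) = dim_row ((hcat V1 V2)\<^sup>T)"
    using hcat_dims[OF H] hcat_dims[OF V] S k by auto
  show *: "rv M v = rv (H1 * S) (rv (V1\<^sup>T) v)"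
    unfolding M mv_cmat_mult[OF d(2)] mv_cmat_mult[OF d(1)] mv_hcat_transpose[OF V] Bv mv_hcat[OF H]
    using H S by (simp add: mv_cmat_mult)
  show "rv (V1\<^sup>T) v = 0" if "rv M v = 0"
  proof -
    let ?c = "rv (V1\<^sup>T) v"
    have sc: "supp k (rv S ?c)" using S by auto
    have "rv H1 (rv S ?c) = 0" using that * H S by (simp add: mv_cmat_mult)
    then have z: "rv S ?c = 0" using orthonormal_hcat(1)[OF oH H k(1) sc] by simp
    have "?c i = 0" if i: "i < k" for i
    proof -
      have "rv S ?c i = (\<Sum>j<k. of_real (S $$ (i,j)) * ?c j)"
        unfolding mv_def[of "cmat S"] using S(1) i by simp
      also have "\<dots> = (\<Sum>j<k. if j = i then of_real (S $$ (i,i)) * ?c i else 0)"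
        by (intro sum.cong refl) (use S(1,2) i in \<open>auto simp: diagonal_mat_def\<close>)
      also have "\<dots> = of_real (S $$ (i,i)) * ?c i" using i by simp
      finally have "rv S ?c i = of_real (S $$ (i,i)) * ?c i" .
      then show ?thesis using z i S(3)[OF i] by simp
    qed
    then show ?thesis using V by (intro supp_eqI[of k]) auto
  qed
qed

lemma mv_append_rows:
  assumes "X \<in> carrier_mat p k" "Y \<in> carrier_mat p' k"
  shows "rv (X @\<^sub>r Y) v = stack p (rv X v) (rv Y v)"
  using assms by (auto simp: mv_def stack_def fun_eq_iff append_rows_def)

text \<open>In particular the range of \<open>F\<close> does not depend on the chosen decompositions.\<close>

lemma F_matrix_range:
  assumes F: "is_F_matrix m G1 G2 F" and G: "G1 \<in> carrier_mat m m" "G2 \<in> carrier_mat m m" and sym: "G2\<^sup>T = G2"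
  obtains c where "F \<in> carrier_mat m c"
    "\<And>a b. supp m a \<Longrightarrow> supp m b \<Longrightarrow> rv G2 b = 0 \<Longrightarrow>
      \<exists>d. rv G2 a + rv G1 b = rv F d"
    "\<And>d. \<exists>a b. supp m a \<and> supp m b \<and> rv G2 b = 0 \<and> rv F d = rv G2 a + rv G1 b"
proof -
  let ?\<Gamma> = "four_block_mat G1 G2 G2 (0\<^sub>m m m)"
  obtain k l H1 H2 S V1 V2 U1 U2 W1 W2 S1 X1 X2 where
    svd: "is_svd (2 * m) (2 * m) k ?\<Gamma> H1 H2 S V1 V2" and U: "U1 \<in> carrier_mat m k" "U2 \<in> carrier_mat m k"
    and HS: "H1 * S = U1 @\<^sub>r U2" and svd': "is_svd k k l (U1\<^sup>T * U2) W1 W2 S1 X1 X2" and Feq: "F = U1 * X2"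
    using F unfolding is_F_matrix_def by blast
  have k: "k \<le> 2 * m" and V: "V1 \<in> carrier_mat (2 * m) k" "V2 \<in> carrier_mat (2 * m) (2 * m - k)"
    and oV: "orthonormal_mat (2 * m) (hcat V1 V2)" using svd by (auto simp: is_svd_def)
  have l: "l \<le> k" and X: "X1 \<in> carrier_mat k l" "X2 \<in> carrier_mat k (k - l)"
    and oX: "orthonormal_mat k (hcat X1 X2)" using svd' by (auto simp: is_svd_def)
  let ?K = "rv (U1\<^sup>T * U2)"
  have c\<Gamma>: "cmat ?\<Gamma> = four_block_mat (cmat G1) (cmat G2) (cmat G2) (0\<^sub>m m m)"
    using G by (intro eq_matI) auto
  have \<Gamma>v: "rv ?\<Gamma> (stack m b a) = stack m (rv G1 b + rv G2 a) (rv G2 b)" for a b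
    unfolding c\<Gamma> using G by (subst mv_four_block[of _ m m _ m _ m]) auto
  have fact: "rv ?\<Gamma> v = stack m (rv U1 (rv (V1\<^sup>T) v)) (rv U2 (rv (V1\<^sup>T) v))" for v
    unfolding is_svd_factor(1)[OF svd] HS mv_append_rows[OF U] ..
  have sU: "supp m (rv U1 v)" "supp m (rv G1 b + rv G2 a)" for v a b using U G by auto
  \<comment> \<open>The columns of \<open>U\<close> span the range of \<open>?\<Gamma>\<close>,
    whose elements have the halves \<open>G1 b + G2 a\<close> and \<open>G2 b\<close>. Restriction
    to the kernel of \<open>U1\<^sup>T * U2\<close> will amount to \<open>G2 b = 0\<close>.\<close>
  have graph: "rv U1 (rv (V1\<^sup>T) (stack m b a)) = rv G1 b + rv G2 a"
    "rv U2 (rv (V1\<^sup>T) (stack m b a)) = rv G2 b" for a b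
  proof -
    have "stack m (rv U1 (rv (V1\<^sup>T) (stack m b a))) (rv U2 (rv (V1\<^sup>T) (stack m b a)))
        = stack m (rv G1 b + rv G2 a) (rv G2 b)"
      using fact[of "stack m b a"] unfolding \<Gamma>v by (rule HOL.sym)
    then show "rv U1 (rv (V1\<^sup>T) (stack m b a)) = rv G1 b + rv G2 a"
      "rv U2 (rv (V1\<^sup>T) (stack m b a)) = rv G2 b"
      using stack_eq_iff[OF sU(1) sU(2)] by blast+
  qed
  have Kv: "?K c = rv (U1\<^sup>T) (rv U2 c)" for c using U by (simp add: mv_cmat_mult)
  have Fv: "rv F d = rv U1 (rv X2 d)" for d unfolding Feq using U X by (simp add: mv_cmat_mult)
  show ?thesis
  proof (rule that)
    show "F \<in> carrier_mat m (k - l)" unfolding Feq using U X by auto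
    fix a b assume ab: "supp m a" "supp m b" "rv G2 b = 0"
    let ?c = "rv (V1\<^sup>T) (stack m b a)"
    have sc: "supp k ?c" using V by auto
    have "?K ?c = 0" unfolding Kv graph ab by simp
    then have "rv (X1\<^sup>T) ?c = 0" by (rule is_svd_factor(2)[OF svd'])
    then have "?c = rv X2 (rv (X2\<^sup>T) ?c)" using orthonormal_hcat(3)[OF oX X l sc] by simp
    then have "rv F (rv (X2\<^sup>T) ?c) = rv U1 ?c" unfolding Fv by metis
    then show "\<exists>d. rv G2 a + rv G1 b = rv F d"
      unfolding graph by (metis add.commute)
  next
    fix d
    let ?c = "rv X2 (rv (1\<^sub>m (k - l)) d)"
    have sc: "supp k ?c" using X by auto
    have s1: "supp (k - l) (rv (1\<^sub>m (k - l)) d)" by simp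
    have "rv (X1\<^sup>T) ?c = 0" by (rule orthonormal_hcat(2)[OF oX X l s1])
    then have Kc: "?K ?c = 0" unfolding is_svd_factor(1)[OF svd'] by simp
    have "supp (m + m) (rv V1 ?c)" using V by auto
    then obtain b a where ba: "supp m b" "supp m a" "rv V1 ?c = stack m b a" by (rule stack_cases)
    have Vc: "rv (V1\<^sup>T) (stack m b a) = ?c"
      unfolding ba(3)[symmetric] by (rule orthonormal_hcat(1)[OF oV V k sc])
    have Uc: "rv U1 ?c = rv G1 b + rv G2 a" "rv U2 ?c = rv G2 b"
      using graph[of b a] unfolding Vc by auto
    let ?w = "rv G2 b"
    have w: "rv (U1\<^sup>T) ?w = 0" using Kc unfolding Kv Uc .
    \<comment> \<open>\<open>G2 b\<close> is itself a value of \<open>U1\<close>, obtained from the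
      vector with blocks 0 and \<open>b\<close>, while \<open>U1\<^sup>T\<close> annihilates it; a
      vector in a range and orthogonal to it is 0.\<close>
    obtain c' where "rv U1 c' = ?w" using graph(1)[of 0 b] by force
    then have "ip m ?w ?w = ip k c' (rv (U1\<^sup>T) ?w)" using ip_cmat[OF U(1), of c' ?w] by simp
    then have "?w = 0" using w ip_self_eq_0[of m ?w] G by auto
    moreover have "rv F d = rv U1 ?c"
      unfolding Fv using X by (simp add: mv_cmat_truncate)
    ultimately show "\<exists>a b. supp m a \<and> supp m b \<and> rv G2 b = 0 \<and> rv F d = rv G2 a + rv G1 b"
      using ba Uc by (intro exI[of _ a] exI[of _ b]) (simp add: add.commute)
  qed
qed

section \<open>Full column rank and the Gram matrix\<close>

lemma full_rank_injective:
  fixes J :: "real mat"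
  assumes J: "J \<in> carrier_mat m k" and rank: "vec_space.rank m J = k" and v: "v \<in> carrier_vec k" "J *\<^sub>v v = 0\<^sub>v m"
  shows "v = 0\<^sub>v k"
proof -
  interpret vec_space "TYPE(real)" m .
  obtain S where S: "maximal S (\<lambda>T. T \<subseteq> set (cols J) \<and> lin_indpt T)"
    using maximal_exists[of "(\<lambda>T. T \<subseteq> set (cols J) \<and> lin_indpt T)" "card (set (cols J))" "{}"]
    by (meson List.finite_set card_mono empty_iff empty_subsetI finite_lin_indpt2 rev_finite_subset)
  then have "card S \<le> card (set (cols J))" by (simp add: card_mono maximal_def)
  moreover have "length (cols J) = card S" using rank_card_indpt[OF J S] rank J by simp
  \<comment> \<open>Rank counts a set of columns, so equality with the number of columns also
    excludes repeated ones, which independence of the set would not detect.\<close>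
  ultimately have "card (set (cols J)) = length (cols J)" using card_length[of "cols J"] by linarith
  then have d: "distinct (cols J)" by (rule card_distinct)
  have "lin_indpt (set (cols J))" by (rule full_rank_lin_indpt[OF J rank d])
  then show ?thesis using lin_depI[OF J v(1) _ v(2) d] by blast
qed

lemma full_rank_factor_gram:
  assumes J: "full_rank_factor m G2 J" and G2: "G2 \<in> carrier_mat m m"
  shows "J \<in> carrier_mat m (dim_col J)" "det (J\<^sup>T * J) \<noteq> 0" "G2 = J * J\<^sup>T"
proof -
  let ?k = "dim_col J"
  show Jc: "J \<in> carrier_mat m ?k" and "G2 = J * J\<^sup>T" using J by (auto simp: full_rank_factor_def)
  have JJ: "J\<^sup>T * J \<in> carrier_mat ?k ?k" by (rule carrier_matI) simp_all
  show "det (J\<^sup>T * J) \<noteq> 0"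
  proof
    assume "det (J\<^sup>T * J) = 0"
    then obtain v where v: "v \<in> carrier_vec ?k" "v \<noteq> 0\<^sub>v ?k" "(J\<^sup>T * J) *\<^sub>v v = 0\<^sub>v ?k"
      using det_0_iff_vec_prod_zero_field[OF JJ] by blast
    let ?w = "J *\<^sub>v v"
    have w: "?w \<in> carrier_vec m" by (rule mult_mat_vec_carrier[OF Jc v(1)])
    have "J\<^sup>T *\<^sub>v ?w = 0\<^sub>v ?k"
      using v(3) unfolding assoc_mult_mat_vec[OF transpose_carrier_mat[THEN iffD2, OF Jc] Jc v(1)] .
    then have "0\<^sub>v ?k \<bullet> v = ?w \<bullet> ?w"
      using transpose_vec_mult_scalar[OF Jc v(1) w] by (simp only:)
    then have "?w \<bullet> ?w = 0" using v(1) by (simp only: scalar_prod_left_zero)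
    moreover have "conjugate ?w = ?w" by (rule eq_vecI) auto
    ultimately have "?w = 0\<^sub>v m" using conjugate_square_eq_0_vec[OF w] by simp
    then show False using full_rank_injective[OF Jc _ v(1)] v(2) J by (simp add: full_rank_factor_def)
  qed
qed

section \<open>Definiteness of real matrices\<close>

text \<open>Definiteness of a real matrix is tested on real vectors, while the analysis yields
  complex ones; the real part of the complex form is the sum of the real forms at real and imaginary
  part. Symmetry remains a separate condition, since this real part does not see a skew
  summand.\<close>

lemma pos_def_real_iff:
  fixes X :: "real mat"
  assumes X: "X \<in> carrier_mat n n"
  shows "pos_def X \<longleftrightarrow> X\<^sup>T = X \<and> (\<forall>v. supp n v \<longrightarrow> v \<noteq> 0 \<longrightarrow> 0 < Re (ip n (rv X v) v))"
proof -
  define qf where "qf = (\<lambda>u::nat \<Rightarrow> real. \<Sum>i<n. (\<Sum>j<n. X $$ (i,j) * u j) * u i)"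
  have vec: "(X *\<^sub>v vec n u) \<bullet>c vec n u = qf u" for u
    using X by (auto simp: qf_def scalar_prod_def lessThan_atLeast0 intro!: sum.cong)
  have split: "Re (ip n (rv X v) v) = qf (\<lambda>i. Re (v i)) + qf (\<lambda>i. Im (v i))" for v
    using X by (simp add: ip_def mv_def qf_def sum.distrib)
  have zero: "vec n u = 0\<^sub>v n \<longleftrightarrow> (\<forall>i<n. u i = 0)" for u :: "nat \<Rightarrow> real"
  proof
    assume eq: "vec n u = 0\<^sub>v n"
    have "u i = 0" if "i < n" for i using arg_cong[OF eq, of "\<lambda>w. w $ i"] that by simp
    then show "\<forall>i<n. u i = 0" by blast
  qed auto
  have herm: "hermitian X \<longleftrightarrow> X\<^sup>T = X" using X by (auto simp: hermitian_def mat_adjoint_real)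
  have d: "dim_row X = n" using X by simp
  show ?thesis
  proof
    assume pd: "pos_def X"
    have pos: "0 < qf u" if "\<exists>i<n. u i \<noteq> 0" for u
      using pd that zero[of u] unfolding pos_def_def d vec[symmetric] by (metis vec_carrier)
    have nonneg: "0 \<le> qf u" for u
      using pos[of u] by (cases "\<exists>i<n. u i \<noteq> 0") (auto simp: qf_def)
    have "0 < Re (ip n (rv X v) v)" if v: "supp n v" "v \<noteq> 0" for v
    proof -
      obtain i where i: "i < n" "v i \<noteq> 0" using supp_eqI[OF v(1), of 0] v(2) by fastforce
      then consider "Re (v i) \<noteq> 0" | "Im (v i) \<noteq> 0" by (metis complex_eq_iff zero_complex.simps)
      then show ?thesis unfolding split
        using pos[of "\<lambda>i. Re (v i)"] pos[of "\<lambda>i. Im (v i)"] nonneg[of "\<lambda>i. Re (v i)"] nonneg[of "\<lambda>i. Im (v i)"] i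
        by cases (meson add_pos_nonneg add_nonneg_pos)+
    qed
    then show "X\<^sup>T = X \<and> (\<forall>v. supp n v \<longrightarrow> v \<noteq> 0 \<longrightarrow> 0 < Re (ip n (rv X v) v))"
      using pd herm by (auto simp: pos_def_def)
  next
    assume *: "X\<^sup>T = X \<and> (\<forall>v. supp n v \<longrightarrow> v \<noteq> 0 \<longrightarrow> 0 < Re (ip n (rv X v) v))"
    have "0 < (X *\<^sub>v w) \<bullet>c w" if w: "w \<in> carrier_vec n" "w \<noteq> 0\<^sub>v n" for w
    proof -
      let ?v = "\<lambda>i. if i < n then complex_of_real (w $ i) else 0"
      have weq: "w = vec n (($) w)" using w by auto
      obtain i where i: "i < n" "w $ i \<noteq> 0" using w zero[of "($) w"] weq by metis
      have "supp n ?v" by (simp add: supp_def)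
      moreover have "?v \<noteq> 0"
      proof
        assume "?v = 0"
        from fun_cong[OF this, of i] i show False by simp
      qed
      ultimately have "0 < Re (ip n (rv X ?v) ?v)" using * by blast
      also have "\<dots> = qf (($) w)" unfolding split by (simp add: qf_def)
      also have "\<dots> = (X *\<^sub>v w) \<bullet>c w" using vec[of "($) w"] weq by simp
      finally show ?thesis .
    qed
    then show "pos_def X" using * herm d by (simp add: pos_def_def)
  qed
qed

lemma det_cmat: "det (cmat X) \<noteq> 0 \<longleftrightarrow> det X \<noteq> 0"
  by (simp add: of_real_hom.hom_det)

lemma mv_cmat_inv:
  assumes X: "X \<in> carrier_mat n n" "det X \<noteq> 0" and v: "supp n v"
  shows "rv X (rv (mat_inv X) v) = v" "rv (mat_inv X) (rv X v) = v"
  using mat_inv[OF X] X v by (auto simp: mv_cmat_one simp flip: mv_cmat_mult)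

lemma mv_cmat_inv_sym:
  assumes X: "X \<in> carrier_mat n n" "det X \<noteq> 0" "X\<^sup>T = X" and vw: "supp n v" "supp n w"
  shows "ip n (rv (mat_inv X) v) w = ip n v (rv (mat_inv X) w)"
  using ip_cmat[OF X(1), of "rv (mat_inv X) v" "rv (mat_inv X) w"]
  by (simp add: X(3) mv_cmat_inv(1)[OF X(1,2)] vw)

section \<open>The stability criteria\<close>

context ni_feedback
begin

text \<open>The case \<open>y = 0\<close> of the necessary condition makes \<open>M\<close> negative
  semidefinite on the range of \<open>F\<close>. A null vector of a semidefinite form lies in its
  kernel, and nondegeneracy leaves only 0.\<close>

lemma F_negative_of_stable:
  assumes stable: "\<And>z. eigenvalue Acl z \<Longrightarrow> Re z < 0"
    and nondeg: "\<And>d. supp k d \<Longrightarrow> mv (mat_adjoint F) (mv M (mv F d)) = 0 \<Longrightarrow> d = 0"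
    and d: "supp k d" "d \<noteq> 0"
  shows "Re (ip m (mv M (mv F d)) (mv F d)) < 0"
proof -
  have E0: "E 0" by (simp add: E_def)
  have le: "Re (ip m (mv M (mv F x)) (mv F x)) \<le> 0" for x
    using stable_necessary(1)[OF stable E0, of "mv F x" x] by simp
  moreover have "Re (ip m (mv M (mv F d)) (mv F d)) \<noteq> 0"
  proof
    assume z: "Re (ip m (mv M (mv F d)) (mv F d)) = 0"
    have zero: "Re (ip m (mv M (mv F d)) (mv F x)) = 0" for x
    proof -
      have "- 2 * Re (ip m (mv M (mv F d)) (mv F x)) = 0"
      proof (rule linear_term_zero)
        fix t :: real
        have "Re (ip m (mv M (mv F x)) (mv F d)) = Re (ip m (mv M (mv F d)) (mv F x))"
          using M_sym[of "mv F x" "mv F d"] by simp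
        then show "0 \<le> t * (- 2 * Re (ip m (mv M (mv F d)) (mv F x))) + t\<^sup>2 * (- Re (ip m (mv M (mv F x)) (mv F x)))"
          using le[of "d + sv (of_real t) x"] z by (simp add: mv_add mv_sv ip_linear power2_eq_square algebra_simps)
      qed
      then show ?thesis by simp
    qed
    have "Re (ip k (mv (mat_adjoint F) (mv M (mv F d))) x) = 0" for x
      using zero[of x] unfolding ip_adjoint'[OF car(5)] .
    then have "mv (mat_adjoint F) (mv M (mv F d)) = 0"
      using ip_self_eq_0[of k "mv (mat_adjoint F) (mv M (mv F d))"] car by auto
    then show False using nondeg d by blast
  qed
  ultimately show ?thesis by (metis le_less)
qed

lemma F_negative_truncate:
  assumes "\<And>d. supp k d \<Longrightarrow> d \<noteq> 0 \<Longrightarrow> Re (ip m (mv M (mv F d)) (mv F d)) < 0" and nz: "mv F d \<noteq> 0"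
  shows "Re (ip m (mv M (mv F d)) (mv F d)) < 0"
proof -
  let ?d = "mv (1\<^sub>m k) d"
  have "mv F ?d = mv F d" using mv_mult[OF car(5), of "1\<^sub>m k" k d] car(5) by simp
  moreover have "supp k ?d" by simp
  moreover have "?d \<noteq> 0" using calculation(1) nz by force
  ultimately show ?thesis using assms(1) by metis
qed

text \<open>If the square of a symmetric \<open>R\<close> annihilates the range of \<open>F\<close>,
  then so does \<open>R\<close>. This brings the range of \<open>R\<close> into \<open>E\<close>,
  where \<open>S\<close> is Hermitian and nonnegative.\<close>

lemma root_range_in_E:
  assumes R: "R \<in> carrier_mat m m" and sym: "\<And>v w. ip m (mv R v) w = ip m v (mv R w)"
    and RN: "\<And>d. mv R (mv R (mv F d)) = 0"
  shows "E (mv R v)"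
  unfolding E_def
proof (intro conjI allI)
  fix d
  have "mv R (mv F d) = 0"
    using ip_self_eq_0[of m "mv R (mv F d)"] sym[of "mv F d" "mv R (mv F d)"] RN[of d] R by auto
  then show "ip m (mv F d) (mv R v) = 0" using sym[of "mv F d" v] by simp
qed (use R in auto)

context
  fixes R :: "complex mat"
  assumes R: "R \<in> carrier_mat m m" and R_sym: "\<And>v w. ip m (mv R v) w = ip m v (mv R w)"
begin

lemma root_form_sym:
  assumes RE: "\<And>v. E (mv R v)"
  shows "ip m (mv R (mv S (mv R v))) w = ip m v (mv R (mv S (mv R w)))"
  using S_sym[OF RE RE, of v w] ip_commute[of m "mv R v" "mv S (mv R w)"] by (simp add: R_sym)

text \<open>Expansion of the nonnegative form of \<open>S + e I\<close> at \<open>y - R z\<close>.\<close>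

lemma root_bound:
  assumes RE: "\<And>v. E (mv R v)" and y: "E y" and e: "e \<ge> 0"
    and w: "w = mv S y + sv (complex_of_real e) y" and z: "z = mv R w"
  shows "Re (ip m z z) + Re (ip m (z - mv R (mv S (mv R z))) z) \<le> Re (ip m w y) + e * Re (ip m (mv R z) (mv R z))"
proof -
  let ?r = "mv R z"
  have Ey: "E (y - ?r)" using E_lin(1)[OF y E_lin(2)[OF RE, of "-1" z]] by simp
  have "0 \<le> Re (ip m (mv S (y - ?r)) (y - ?r)) + e * Re (ip m (y - ?r) (y - ?r))"
    using S_form(1)[OF Ey] ip_self_nonneg(1)[of m "y - ?r"] e by simp
  also have "\<dots> = Re (ip m w y) - Re (ip m w ?r) - Re (ip m (mv S ?r) y + e * ip m ?r y)
      + Re (ip m (mv S ?r) ?r) + e * Re (ip m ?r ?r)"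
    unfolding w by (simp add: mv_diff ip_linear algebra_simps)
  also have "ip m (mv S ?r) y + e * ip m ?r y = cnj (ip m w ?r)"
    unfolding w using S_sym[OF RE y, of z] ip_commute[of m ?r y] by (simp add: ip_linear)
  also have "ip m w ?r = ip m z z" unfolding z by (simp add: R_sym)
  also have "ip m (mv S ?r) ?r = ip m (mv R (mv S ?r)) z" by (simp add: R_sym)
  finally show ?thesis by (simp add: ip_diff_left)
qed

text \<open>Necessity is applied at \<open>y = R v\<close> with the shift that removes the term in
  \<open>F\<close>. For \<open>q = R S R v\<close> it gives
  \<open>|q|^2 \<le> Re (ip m q v)\<close>, hence
  \<open>|v - q|^2 \<le> Re (ip m (v - q) v)\<close>. For sufficiency the criterion makes the second
  term of \<open>root_bound\<close> nonnegative.\<close>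

lemma stable_iff_pos:
  assumes RR: "\<And>v. mv R (mv R v) = mv N v"
    and nondeg: "\<And>d. supp k d \<Longrightarrow> mv (mat_adjoint F) (mv M (mv F d)) = 0 \<Longrightarrow> d = 0"
  shows "(\<forall>z. eigenvalue Acl z \<longrightarrow> Re z < 0) \<longleftrightarrow>
    (\<forall>d. supp k d \<longrightarrow> d \<noteq> 0 \<longrightarrow> Re (ip m (mv M (mv F d)) (mv F d)) < 0) \<and>
    (\<forall>v. supp m v \<longrightarrow> v \<noteq> 0 \<longrightarrow> 0 < Re (ip m (v - mv R (mv S (mv R v))) v))"
proof -
  have RE: "E (mv R v)" for v by (rule root_range_in_E[OF R R_sym]) (simp add: RR N_F)
  have Nform: "ip m (mv N w) w = ip m (mv R w) (mv R w)" for w by (simp add: R_sym flip: RR)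
  show ?thesis
  proof (intro iffI conjI allI impI)
    assume stable: "\<forall>z. eigenvalue Acl z \<longrightarrow> Re z < 0"
    show "Re (ip m (mv M (mv F d)) (mv F d)) < 0" if "supp k d" "d \<noteq> 0" for d
      by (rule F_negative_of_stable[OF _ nondeg that]) (use stable in auto)
    fix v assume v: "supp m v" "v \<noteq> 0"
    let ?y = "mv R v"
    let ?q = "mv R (mv S ?y)"
    have sS: "supp m (mv S ?y)" using S_car by auto
    obtain d0 where d0: "\<And>d. ip m (mv M (mv S ?y + mv F d)) (mv S ?y + mv F d) =
      ip m (mv N (mv S ?y)) (mv S ?y) + ip m (mv M (mv F (d - d0))) (mv F (d - d0))"
      "mv M (mv S ?y + mv F d0) = mv N (mv S ?y)" using completed_square[OF sS] by metis
    have "Re (ip m ?q ?q) \<le> Re (ip m (mv S ?y) ?y)"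
      using stable_necessary(1)[OF _ RE refl, of v d0] stable d0(1)[of d0] by (simp add: Nform)
    also have "\<dots> = Re (ip m ?q v)" by (simp add: R_sym)
    finally have q: "Re (ip m ?q ?q) \<le> Re (ip m ?q v)" .
    moreover have "Re (ip m (v - ?q) (v - ?q)) = Re (ip m (v - ?q) v) - (Re (ip m ?q v) - Re (ip m ?q ?q))"
      using ip_commute[of m v ?q] by (simp add: ip_linear)
    ultimately have le: "Re (ip m (v - ?q) (v - ?q)) \<le> Re (ip m (v - ?q) v)" by linarith
    show "0 < Re (ip m (v - ?q) v)"
    proof (rule ccontr)
      assume "\<not> ?thesis"
      then have "Re (ip m (v - ?q) (v - ?q)) = 0" using le ip_self_nonneg(1)[of m "v - ?q"] by linarith
      then have vq: "v = ?q" using ip_self_eq_0[of m "v - ?q"] v R by auto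
      \<comment> \<open>In the equality case \<open>v = q\<close>, so \<open>R v\<close> is
        \<open>N\<close> applied to \<open>S R v\<close>. The loop would then respond without a
        disturbance, and stability makes this response 0.\<close>
      have "?y = mv M (mv S ?y + mv F d0)" unfolding d0(2) RR[symmetric] using arg_cong[OF vq, of "mv R"] by simp
      then have "mv S ?y + mv F d0 = 0" using stable_necessary(2)[OF _ RE refl, of v d0] stable by blast
      then have "?y = 0" using \<open>?y = mv M (mv S ?y + mv F d0)\<close> by simp
      then show False using vq v by simp
    qed
  next
    assume *: "(\<forall>d. supp k d \<longrightarrow> d \<noteq> 0 \<longrightarrow> Re (ip m (mv M (mv F d)) (mv F d)) < 0) \<and>
      (\<forall>v. supp m v \<longrightarrow> v \<noteq> 0 \<longrightarrow> 0 < Re (ip m (v - mv R (mv S (mv R v))) v))"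
    fix z assume ev: "eigenvalue Acl z"
    have pos: "0 \<le> Re (ip m (v - mv R (mv S (mv R v))) v)" if "supp m v" for v
      using * that by (cases "v = 0") (auto intro: less_imp_le)
    show "Re z < 0"
    proof (rule stable_sufficient[OF _ _ _ ev])
      show "Re (ip m (mv M (mv F d)) (mv F d)) < 0" if "mv F d \<noteq> 0" for d
        by (rule F_negative_truncate[OF _ that]) (use * in blast)
      show "Re (ip m (mv N w) w) \<le> Re (ip m y w) + e * Re (ip m (mv N w) (mv N w))"
        if "e > 0" "E y" "w = mv S y + sv (complex_of_real e) y" for e y w
        using root_bound[OF RE that(2) _ that(3) refl] that(1) pos[of "mv R w"] R ip_commute[of m y w]
        by (simp add: Nform RR supp_mv')
      show "mv N (mv S y) = 0" if y: "E y" and le: "Re (ip m (mv S y) y) \<le> Re (ip m (mv N (mv S y)) (mv S y))" for y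
      proof -
        let ?z = "mv R (mv S y)"
        have "Re (ip m ?z ?z) + Re (ip m (?z - mv R (mv S (mv R ?z))) ?z) \<le> Re (ip m (mv S y) y)"
          using root_bound[OF RE y, of 0 "mv S y" ?z] by simp
        then have "Re (ip m (?z - mv R (mv S (mv R ?z))) ?z) \<le> 0" using le by (simp add: Nform)
        moreover have "supp m ?z" using R by auto
        ultimately have "?z = 0" using * by (meson not_le)
        then show ?thesis by (simp flip: RR)
      qed
    qed
  qed
qed

text \<open>\<open>N\<close> is minus the square of \<open>R\<close>, so the left side of
  \<open>N_bound\<close> is nonpositive and its right side nonnegative. As \<open>R S R\<close> is
  positive semidefinite, adding it to the identity leaves no kernel.\<close>

lemma stable_iff_neg:
  assumes RR: "\<And>v. mv R (mv R v) = - mv N v"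
    and nondeg: "\<And>d. supp k d \<Longrightarrow> mv (mat_adjoint F) (mv M (mv F d)) = 0 \<Longrightarrow> d = 0"
  shows "(\<forall>z. eigenvalue Acl z \<longrightarrow> Re z < 0) \<longleftrightarrow>
      (\<forall>d. supp k d \<longrightarrow> d \<noteq> 0 \<longrightarrow> Re (ip m (mv M (mv F d)) (mv F d)) < 0)"
    and "supp m v \<Longrightarrow> v + mv R (mv S (mv R v)) = 0 \<Longrightarrow> v = 0"
proof -
  have RE: "E (mv R v)" for v by (rule root_range_in_E[OF R R_sym]) (simp add: RR N_F)
  have N: "mv N w = - mv R (mv R w)" for w by (simp add: RR)
  have Nform: "ip m (mv N w) w = - ip m (mv R w) (mv R w)" for w by (simp add: N ip_linear R_sym)
  show "(\<forall>z. eigenvalue Acl z \<longrightarrow> Re z < 0) \<longleftrightarrow>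
      (\<forall>d. supp k d \<longrightarrow> d \<noteq> 0 \<longrightarrow> Re (ip m (mv M (mv F d)) (mv F d)) < 0)"
  proof (intro iffI allI impI)
    assume stable: "\<forall>z. eigenvalue Acl z \<longrightarrow> Re z < 0"
    show "Re (ip m (mv M (mv F d)) (mv F d)) < 0" if "supp k d" "d \<noteq> 0" for d
      by (rule F_negative_of_stable[OF _ nondeg that]) (use stable in auto)
  next
    assume *: "\<forall>d. supp k d \<longrightarrow> d \<noteq> 0 \<longrightarrow> Re (ip m (mv M (mv F d)) (mv F d)) < 0"
    fix z assume ev: "eigenvalue Acl z"
    show "Re z < 0"
    proof (rule stable_sufficient[OF _ _ _ ev])
      show "Re (ip m (mv M (mv F d)) (mv F d)) < 0" if "mv F d \<noteq> 0" for d
        by (rule F_negative_truncate[OF _ that]) (use * in blast)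
      show "Re (ip m (mv N w) w) \<le> Re (ip m y w) + e * Re (ip m (mv N w) (mv N w))"
        if "e > 0" "E y" "w = mv S y + sv (complex_of_real e) y" for e y w
      proof -
        have "0 \<le> Re (ip m (mv S y) y) + e * Re (ip m y y) + e * Re (ip m (mv N w) (mv N w)) + Re (ip m (mv R w) (mv R w))"
          using S_form(1)[OF that(2)] that(1) ip_self_nonneg(1) by (intro add_nonneg_nonneg mult_nonneg_nonneg) auto
        moreover have "Re (ip m y w) = Re (ip m (mv S y) y) + e * Re (ip m y y)"
          unfolding that(3) using ip_commute[of m y "mv S y"] by (simp add: ip_linear)
        ultimately show ?thesis unfolding Nform by simp
      qed
      show "mv N (mv S y) = 0" if y: "E y" and le: "Re (ip m (mv S y) y) \<le> Re (ip m (mv N (mv S y)) (mv S y))" for y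
      proof -
        have "Re (ip m (mv R (mv S y)) (mv R (mv S y))) = 0"
          using le S_form(1)[OF y] ip_self_nonneg(1)[of m "mv R (mv S y)"] unfolding Nform by simp
        then have "mv R (mv S y) = 0" using ip_self_eq_0[of m "mv R (mv S y)"] R by auto
        then show ?thesis by (simp add: N)
      qed
    qed
  qed
  assume v: "supp m v" and eq: "v + mv R (mv S (mv R v)) = 0"
  have "0 = ip m (v + mv R (mv S (mv R v))) v" unfolding eq by simp
  then have "Re (ip m v v) + Re (ip m (mv S (mv R v)) (mv R v)) = 0" by (simp add: ip_linear R_sym complex_eq_iff)
  then have "Re (ip m v v) = 0" using S_form(1)[OF RE, of v] ip_self_nonneg(1)[of m v] by linarith
  then show "v = 0" by (rule ip_self_eq_0[OF v])
qed

end

end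

text \<open>Bridge from the given matrices to the abstract data: the pseudo-inverse of
  \<open>G2\<close> is \<open>J (J^T J)^(-2) J^T\<close>, the projection is
  \<open>F (F^T F)^(-1) F^T\<close>, and \<open>Nf\<close> is the Schur complement.\<close>

lemma ni_feedback_intro:
  fixes J F :: "real mat"
  assumes tf: "transfer_function_matrix m G" and tf': "transfer_function_matrix m G'"
    and sp: "strictly_proper m G" and ni: "negative_imaginary m G"
    and sni: "strictly_negative_imaginary m G'"
    and min: "minimal_realization m n A B C D G" and min': "minimal_realization m n' A' B' C' D' G'"
    and lau: "laurent_matrices m G G0 G1 G2"
    and J: "full_rank_factor m G2 J"
    and F: "is_F_matrix m G1 G2 F"
    and nd: "det (F\<^sup>T * dc_gain G' * F) \<noteq> 0"
    and Nf: "Nf = proj_compl (dc_gain G') F"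
  obtains c Pf where "F \<in> carrier_mat m c" "D = 0\<^sub>m m m"
    "ni_feedback m c G (cmat G0) (cmat G1) (cmat G2) (cmat (J * (mat_inv (J\<^sup>T * J) * mat_inv (J\<^sup>T * J)) * J\<^sup>T))
      (cmat F) Pf G' n n' A B C A' B' C' D' (cmat (dc_gain G')) (cmat Nf)"
proof -
  have r: "realization m n A B C D G" and r': "realization m n' A' B' C' D' G'"
    using min min' by (auto simp: minimal_realization_def)
  have D: "D = 0\<^sub>m m m" by (rule strictly_proper_D_zero[OF tf r sp])
  have Gs: "G0 \<in> carrier_mat m m" "G1 \<in> carrier_mat m m" "G2 \<in> carrier_mat m m"
    and l2: "mlim (\<lambda>s. s\<^sup>2 \<cdot>\<^sub>m G s) (cmat G2) (at 0)"
    and l0: "mlim (\<lambda>s. G s - (1 / s\<^sup>2) \<cdot>\<^sub>m cmat G2 - (1 / s) \<cdot>\<^sub>m cmat G1) (cmat G0) (at 0)"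
    using lau by (auto simp: laurent_matrices_def mat_tendsto_eq_mlim)
  note Jp = full_rank_factor_gram[OF J Gs(3)]
  let ?k = "dim_col J"
  define K where "K = mat_inv (J\<^sup>T * J)"
  have JJ: "J\<^sup>T * J \<in> carrier_mat ?k ?k" by (rule carrier_matI) simp_all
  have JJs: "(J\<^sup>T * J)\<^sup>T = J\<^sup>T * J" using transpose_mult[OF transpose_carrier_mat[THEN iffD2, OF Jp(1)] Jp(1)] by simp
  have K: "K \<in> carrier_mat ?k ?k" unfolding K_def by (rule mat_inv(1)[OF JJ Jp(2)])
  have Jd: "dim_row J = m" using Jp(1) by auto
  have KJ: "rv K (rv (J\<^sup>T) (rv J v)) = v" "rv (J\<^sup>T) (rv J (rv K v)) = v"
    if "supp ?k v" for v
    using mv_cmat_inv[OF JJ Jp(2) that] by (simp_all add: K_def mv_cmat_mult)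
  have Ksym: "ip ?k (rv K v) w = ip ?k v (rv K w)" if "supp ?k v" "supp ?k w" for v w
    unfolding K_def by (rule mv_cmat_inv_sym[OF JJ Jp(2) JJs that])
  have sJ: "supp ?k (rv (J\<^sup>T) v)" "supp ?k (rv K v)" for v using K by auto
  have G2v: "rv G2 v = rv J (rv (J\<^sup>T) v)" for v unfolding Jp(3) by (simp add: mv_cmat_mult)
  let ?Gp = "J * (K * K) * J\<^sup>T"
  have Gpv: "rv ?Gp v = rv J (rv K (rv K (rv (J\<^sup>T) v)))" for v
    using K by (simp add: mv_cmat_mult)
  have Jip: "ip m (rv J v) w = ip ?k v (rv (J\<^sup>T) w)" for v w by (rule ip_cmat[OF Jp(1)])
  have Jip': "ip m w (rv J v) = ip ?k (rv (J\<^sup>T) w) v" for v w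
    using Jip[of v w] ip_commute by metis
  have G2sym: "ip m (rv G2 v) w = ip m v (rv G2 w)" for v w by (simp add: G2v Jip Jip')
  have G2pos: "0 \<le> Re (ip m (rv G2 v) v)" "Im (ip m (rv G2 v) v) = 0" for v
    by (simp_all add: G2v Jip ip_self_nonneg)
  have G2T: "G2\<^sup>T = G2" unfolding Jp(3) using transpose_mult[OF Jp(1) transpose_carrier_mat[THEN iffD2, OF Jp(1)]] by simp
  obtain c where Fc: "F \<in> carrier_mat m c"
    and FG: "\<And>a b. supp m a \<Longrightarrow> supp m b \<Longrightarrow> rv G2 b = 0 \<Longrightarrow>
      \<exists>d. rv G2 a + rv G1 b = rv F d"
    and Fs: "\<And>d. \<exists>a b. supp m a \<and> supp m b \<and> rv G2 b = 0 \<and> rv F d = rv G2 a + rv G1 b"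
    using F_matrix_range[OF F Gs(2,3) G2T] by metis
  have Fd: "dim_row F = m" "dim_col F = c" using Fc by auto
  let ?M = "dc_gain G'"
  note M = sni_positive_real[OF tf' sni r']
  have Md: "?M \<in> carrier_mat m m" using M(1) by simp
  then have Mdd: "dim_row ?M = m" "dim_col ?M = m" by auto
  let ?Kf = "F\<^sup>T * ?M * F"
  have Kf: "?Kf \<in> carrier_mat c c" using Fc Md by auto
  have Kfv: "rv ?Kf d = rv (F\<^sup>T) (rv ?M (rv F d))" for d
    using Fd Mdd by (simp add: mv_cmat_mult)
  let ?H = "F\<^sup>T * F"
  have H: "?H \<in> carrier_mat c c" using Fc by auto
  have Hs: "?H\<^sup>T = ?H" using transpose_mult[OF transpose_carrier_mat[THEN iffD2, OF Fc] Fc] by simp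
  have Hv: "rv ?H d = rv (F\<^sup>T) (rv F d)" for d using Fd by (simp add: mv_cmat_mult)
  have Fip: "ip m (rv F v) w = ip c v (rv (F\<^sup>T) w)" for v w by (rule ip_cmat[OF Fc])
  have sF: "supp c (rv (F\<^sup>T) v)" "supp m (rv F v)" for v using Fd by auto
  \<comment> \<open>\<open>F\<close> has full column rank, because a kernel vector of
    \<open>F\<close> would be one of \<open>F^T M F\<close>.\<close>
  have dH: "det ?H \<noteq> 0"
    unfolding det_cmat[symmetric]
  proof (subst det_nonzero_iff)
    show "cmat ?H \<in> carrier_mat c c" using H by simp
    show "\<forall>v. supp c v \<longrightarrow> rv ?H v = 0 \<longrightarrow> v = 0"
    proof (intro allI impI)
      fix v assume v: "supp c v" "rv ?H v = 0"
      have "ip m (rv F v) (rv F v) = 0" using v by (simp add: Fip flip: Hv)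
      then have "rv F v = 0" using ip_self_eq_0[OF sF(2)] by simp
      then have "rv ?Kf v = 0" unfolding Kfv by simp
      moreover have "det (cmat ?Kf) \<noteq> 0" using nd det_cmat by blast
      ultimately show "v = 0" using det_nonzero_iff[of "cmat ?Kf" c] Kf v(1) by simp
    qed
  qed
  let ?P = "F * mat_inv ?H * F\<^sup>T"
  have iH: "mat_inv ?H \<in> carrier_mat c c" by (rule mat_inv(1)[OF H dH])
  have Pv: "rv ?P v = rv F (rv (mat_inv ?H) (rv (F\<^sup>T) v))" for v
    using Fd iH by (simp add: mv_cmat_mult)
  have iK: "mat_inv ?Kf \<in> carrier_mat c c" by (rule mat_inv(1)[OF Kf nd])
  have Nv: "rv Nf w = rv ?M w -
      rv ?M (rv F (rv (mat_inv ?Kf) (rv (F\<^sup>T) (rv ?M w))))" for w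
    unfolding Nf proj_compl_def using Fd Mdd iK by (simp add: mv_cmat_mult mv_cmat_diff)
  have Nc: "Nf \<in> carrier_mat m m" unfolding Nf proj_compl_def using Fd Mdd iK by auto
  obtain T where T: "finite T" "\<And>i j. i < m \<Longrightarrow> j < m \<Longrightarrow> (\<lambda>s. G s $$ (i,j)) holomorphic_on - T"
    "\<And>z. z \<in> T \<Longrightarrow> mat_pole m G z"
    by (rule transfer_function_matrix_props[OF tf]) (rule that)
  have Tneg: "Re z \<le> 0" if "z \<in> T" for z
  proof -
    have "\<forall>s. Re s > 0 \<longrightarrow> \<not> mat_pole m G s" using ni unfolding negative_imaginary_def by (rule conjunct1)
    then show ?thesis using T(3)[OF that] by (meson not_le)
  qed
  have "ni_feedback m c G (cmat G0) (cmat G1) (cmat G2) (cmat ?Gp)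
      (cmat F) (cmat ?P) G' n n' A B C A' B' C' D' (cmat ?M) (cmat Nf)"
  proof (unfold_locales)
    show "G s \<in> carrier_mat m m" for s using tf by (simp add: transfer_function_matrix_def)
    show "cmat G0 \<in> carrier_mat m m" "cmat G1 \<in> carrier_mat m m" "cmat G2 \<in> carrier_mat m m" using Gs by simp_all
    show "cmat ?Gp \<in> carrier_mat m m" "cmat F \<in> carrier_mat m c" "cmat ?P \<in> carrier_mat m m" "cmat Nf \<in> carrier_mat m m"
      using Jd Fd Nc by auto
    show "(\<lambda>s. G s $$ (i,j)) holomorphic_on {s. 0 < Re s}" if "i < m" "j < m" for i j
      by (rule holomorphic_on_subset[OF T(2)[OF that]]) (use Tneg in force)
    show "0 \<le> Re (s * ip m (mv (G s) v) v)" if "0 < Re s" for s v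
      by (rule ni_positive_real[OF tf ni sp _ l2 G2pos that]) (use Gs in simp)
    show "mlim (\<lambda>s. G s - (1 / s\<^sup>2) \<cdot>\<^sub>m cmat G2 - (1 / s) \<cdot>\<^sub>m cmat G1) (cmat G0) (at 0)" by (rule l0)
    show "ip m (rv G2 v) w = ip m v (rv G2 w)" for v w by (rule G2sym)
    show "ip m (rv ?Gp v) w = ip m v (rv ?Gp w)" for v w
      by (simp add: Gpv Jip Jip' Ksym sJ)
    \<comment> \<open>Both products of \<open>G2\<close> and \<open>?Gp\<close> equal
      \<open>J (J^T J)^(-1) J^T\<close>, the projection onto the range of \<open>J\<close>.\<close>
    show "rv G2 (rv ?Gp (rv G2 v)) = rv G2 v"
      "rv G2 (rv ?Gp v) = rv ?Gp (rv G2 v)" for v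
      by (simp_all add: Gpv G2v KJ sJ)
    show "\<exists>d. rv G2 v = rv F d" for v
      using FG[of "rv (1\<^sub>m m) v" 0] Gs by (simp add: mv_cmat_truncate)
    show "\<exists>d. rv G1 v = rv F d" if "supp m v" "rv G2 v = 0" for v
      using FG[of 0 v] that by simp
    show "\<exists>a b. supp m a \<and> supp m b \<and> rv G2 b = 0 \<and> rv F d = rv G2 a + rv G1 b" for d
      by (rule Fs)
    show "ip m (rv ?P v) w = ip m v (rv ?P w)" for v w
    proof -
      have "ip m v (rv ?P w) = cnj (ip m (rv ?P w) v)" by (rule ip_commute)
      also have "\<dots> = ip c (rv (F\<^sup>T) v) (rv (mat_inv ?H) (rv (F\<^sup>T) w))"
        unfolding Pv Fip by (rule ip_commute[symmetric])
      finally show ?thesis unfolding Pv Fip by (simp add: mv_cmat_inv_sym[OF H dH Hs] sF)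
    qed
    show "rv ?P (rv F d) = rv F d" for d
    proof -
      let ?d = "rv (1\<^sub>m c) d"
      have Fd': "rv F ?d = rv F d" using Fd by (simp add: mv_cmat_truncate)
      have "rv ?P (rv F ?d) = rv F ?d"
        unfolding Pv Hv[symmetric] by (subst mv_cmat_inv(2)[OF H dH]) auto
      then show ?thesis unfolding Fd' .
    qed
    show "\<exists>d. rv ?P v = rv F d" for v unfolding Pv by blast
    show "transfer_function_matrix m G" "transfer_function_matrix m G'"
      "minimal_realization m n' A' B' C' D' G'" "strictly_negative_imaginary m G'" by fact+
    show "minimal_realization m n A B C (0\<^sub>m m m) G" using min D by simp
    \<comment> \<open>The shift is the critical point of the form of \<open>?M\<close> on
      \<open>w\<close> plus the range of \<open>F\<close>.\<close>
    show "\<exists>d. rv ?M (w + rv F d) = rv Nf w" for w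
      unfolding Nv by (intro exI[of _ "- rv (mat_inv ?Kf) (rv (F\<^sup>T) (rv ?M w))"])
        (simp add: mv_add mv_minus mv_diff)
    show "rv Nf (rv F d) = 0" for d
    proof -
      let ?d = "rv (1\<^sub>m c) d"
      have Fd': "rv F ?d = rv F d" using Fd by (simp add: mv_cmat_truncate)
      have "rv Nf (rv F ?d) = 0"
        unfolding Nv Kfv[symmetric] by (subst mv_cmat_inv(2)[OF Kf nd]) auto
      then show ?thesis unfolding Fd' .
    qed
    show "ip m (rv F d) (rv Nf w) = 0" for d w
      unfolding Fip Nv mv_diff Kfv[symmetric] by (subst mv_cmat_inv(1)[OF Kf nd sF(1)]) simp
  qed simp
  from that[OF Fc D this[unfolded K_def]] show ?thesis .
qed

theorem theorem1:
  fixes m n n' :: nat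
    and G G' :: "complex \<Rightarrow> complex mat"
    and A B C D A' B' C' D' G0 G1 G2 J F Nf :: "real mat"
  assumes "transfer_function_matrix m G" and "transfer_function_matrix m G'"
    and "strictly_proper m G" and "negative_imaginary m G"
    and "strictly_negative_imaginary m G'"
    and "minimal_realization m n A B C D G" and "minimal_realization m n' A' B' C' D' G'"
    and "laurent_matrices m G G0 G1 G2" and "G2 \<noteq> 0\<^sub>m m m"
    and "full_rank_factor m G2 J"
    and "is_F_matrix m G1 G2 F"
    and "det (F\<^sup>T * dc_gain G' * F) \<noteq> 0"
    and "Nf = proj_compl (dc_gain G') F"
  shows "(pos_semidef Nf \<longrightarrow> (\<forall>R. is_psd_sqrt R Nf \<longrightarrow>
            (internally_stable A B C D A' B' C' D' \<longleftrightarrow>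
               neg_def (F\<^sup>T * dc_gain G' * F) \<and>
               pos_def (1\<^sub>m m - R * G0 * R
                  - R * G1 * J * (mat_inv (J\<^sup>T * J) ^\<^sub>m 2) * J\<^sup>T * G1\<^sup>T * R))))
       \<and> (neg_semidef Nf \<longrightarrow> (\<forall>R. is_psd_sqrt R (- Nf) \<longrightarrow>
            (internally_stable A B C D A' B' C' D' \<longleftrightarrow>
               neg_def (F\<^sup>T * dc_gain G' * F) \<and>
               det (1\<^sub>m m + R * G0 * R
                  + R * G1 * J * (mat_inv (J\<^sup>T * J) ^\<^sub>m 2) * J\<^sup>T * G1\<^sup>T * R) \<noteq> 0)))"
proof -
  let ?K = "mat_inv (J\<^sup>T * J)" and ?M = "dc_gain G'"
  obtain c Pf where Fc: "F \<in> carrier_mat m c" and D: "D = 0\<^sub>m m m"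
    and loc: "ni_feedback m c G (cmat G0) (cmat G1) (cmat G2) (cmat (J * (?K * ?K) * J\<^sup>T))
      (cmat F) Pf G' n n' A B C A' B' C' D' (cmat ?M) (cmat Nf)"
    using ni_feedback_intro[OF assms(1-8,10-13)] by metis
  interpret ni_feedback m c G "cmat G0" "cmat G1" "cmat G2" "cmat (J * (?K * ?K) * J\<^sup>T)"
      "cmat F" Pf G' n n' A B C A' B' C' D' "cmat ?M" "cmat Nf" by (rule loc)
  have Gs: "G0 \<in> carrier_mat m m" "G1 \<in> carrier_mat m m" "Nf \<in> carrier_mat m m" "?M \<in> carrier_mat m m"
    using car N_car sni_pr(1) by auto
  have Jd: "dim_row J = m" using assms(10) by (simp add: full_rank_factor_def)
  have "det (J\<^sup>T * J) \<noteq> 0" using full_rank_factor_gram(2)[OF assms(10)] assms(8) by (simp add: laurent_matrices_def)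
  then have K: "?K \<in> carrier_mat (dim_col J) (dim_col J)" by (intro mat_inv(1) carrier_matI) simp_all
  then have K2: "?K ^\<^sub>m 2 = ?K * ?K" by (simp add: numeral_2_eq_2)
  have Fd: "dim_row F = m" "dim_col F = c" using Fc by auto
  have Gd: "dim_row G0 = m" "dim_col G0 = m" "dim_row G1 = m" "dim_col G1 = m" "dim_row ?M = m" "dim_col ?M = m"
    "dim_row ?K = dim_col J" "dim_col ?K = dim_col J"
    using Gs K by auto
  have stable_def: "internally_stable A B C D A' B' C' D' \<longleftrightarrow> (\<forall>z. eigenvalue Acl z \<longrightarrow> Re z < 0)"
    using closed_loop_strictly_proper(2)[OF rcar(1-3) rcar(9-12)]
    by (simp add: internally_stable_def hurwitz_def Acl_def D)
  let ?Kf = "F\<^sup>T * ?M * F"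
  have Kf: "?Kf \<in> carrier_mat c c" using Fc Gs by auto
  have Kfv: "rv ?Kf d = rv (F\<^sup>T) (rv ?M (rv F d))" for d
    using Fd Gd by (simp add: mv_cmat_mult)
  have nondeg: "d = 0" if "supp c d" "mv (mat_adjoint (cmat F)) (rv ?M (rv F d)) = 0" for d
    using det_nonzero_iff[of "cmat ?Kf" c] assms(12) Kf that by (simp add: det_cmat Kfv mat_adjoint_cmat)
  have Kf_form: "ip c (rv (- ?Kf) d) d = - ip m (rv ?M (rv F d)) (rv F d)" for d
    unfolding mv_cmat_uminus ip_minus_left Kfv using ip_cmat[OF transpose_carrier_mat[THEN iffD2, OF Fc]] by simp
  \<comment> \<open>Definiteness includes symmetry, which comes from the real values of the form of
    \<open>?M\<close>.\<close>
  have "(- ?Kf)\<^sup>T = - ?Kf"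
  proof (rule cmat_symI)
    show "- ?Kf \<in> carrier_mat c c" using Kf by simp
    fix v w
    have F: "ip c (rv (F\<^sup>T) a) b = ip m a (rv F b)" for a b
      using ip_cmat[of "F\<^sup>T" c m a b] Fc by simp
    have "ip c v (rv ?Kf w) = cnj (ip c (rv ?Kf w) v)" by (rule ip_commute)
    then show "ip c (rv (- ?Kf) v) w = ip c v (rv (- ?Kf) w)"
      unfolding mv_cmat_uminus ip_minus_left ip_minus_right Kfv F
      using M_sym[of "rv F v" "rv F w"] by simp
  qed
  then have neg: "neg_def ?Kf \<longleftrightarrow> (\<forall>d. supp c d \<longrightarrow> d \<noteq> 0 \<longrightarrow> Re (ip m (rv ?M (rv F d)) (rv F d)) < 0)"
    using pos_def_real_iff[of "- ?Kf" c] Kf by (simp add: Kf_form)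
  let ?Q = "\<lambda>R. R * G1 * J * (?K ^\<^sub>m 2) * J\<^sup>T * G1\<^sup>T * R"
  have Rv: "rv (R * G0 * R) v + rv (?Q R) v = rv R (mv S (rv R v))"
    if R: "R \<in> carrier_mat m m" for R v
  proof -
    have "dim_row R = m" "dim_col R = m" using R by auto
    then show ?thesis using Gd Jd by (simp add: S_mv K2 mv_cmat_mult mat_adjoint_cmat mv_add)
  qed
  have root: "R \<in> carrier_mat m m" "\<And>v w. ip m (rv R v) w = ip m v (rv R w)"
    "\<And>v. rv R (rv R v) = rv X v"
    if "is_psd_sqrt R X" "X \<in> carrier_mat m m" for R X
  proof -
    show R: "R \<in> carrier_mat m m" using that by (auto simp: is_psd_sqrt_def)
    have "R\<^sup>T = R" using that by (auto simp: is_psd_sqrt_def pos_semidef_def hermitian_def mat_adjoint_real)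
    then show "ip m (rv R v) w = ip m v (rv R w)" for v w using ip_cmat[OF R] by simp
    show "rv R (rv R v) = rv X v" for v
      using that R by (auto simp: is_psd_sqrt_def simp flip: mv_cmat_mult)
  qed
  show ?thesis
  proof (intro conjI impI allI)
    fix R assume "is_psd_sqrt R Nf"
    note R = root[OF this Gs(3)]
    let ?X = "1\<^sub>m m - R * G0 * R - ?Q R"
    have dims: "R * G0 * R \<in> carrier_mat m m" "?Q R \<in> carrier_mat m m" using R(1) Gd Jd by auto
    have X: "?X \<in> carrier_mat m m" by (rule minus_carrier_mat[OF dims(2)])
    have Rd: "dim_row R = m" "dim_col R = m" using R(1) by auto
    have Xv: "rv ?X v = v - rv R (mv S (rv R v))" if "supp m v" for v
    proof -
      have "rv ?X v = v - (rv (R * G0 * R) v + rv (?Q R) v)"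
        using that by (simp add: Rd mv_cmat_diff mv_cmat_one)
      then show ?thesis unfolding Rv[OF R(1)] .
    qed
    have Rc: "cmat R \<in> carrier_mat m m" using R(1) by simp
    have RE: "E (rv R v)" for v
      by (rule root_range_in_E[OF Rc R(2)]) (simp add: R(3) N_F)
    \<comment> \<open>\<open>S\<close> is known to be Hermitian only on \<open>E\<close>; symmetry
      of the criterion matrix rests on the range of \<open>R\<close> lying in
      \<open>E\<close>.\<close>
    have "?X\<^sup>T = ?X"
      by (rule cmat_symI[OF X]) (simp add: Xv ip_linear root_form_sym[OF Rc R(2) RE])
    then have "pos_def ?X \<longleftrightarrow> (\<forall>v. supp m v \<longrightarrow> v \<noteq> 0 \<longrightarrow> 0 < Re (ip m (v - rv R (mv S (rv R v))) v))"
      using pos_def_real_iff[OF X] by (simp add: Xv)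
    then show "internally_stable A B C D A' B' C' D' \<longleftrightarrow> neg_def ?Kf \<and> pos_def ?X"
      unfolding stable_def neg using stable_iff_pos[OF Rc R(2,3) nondeg] by simp
  next
    fix R assume "is_psd_sqrt R (- Nf)"
    note R = root[OF this, simplified, OF Gs(3)]
    let ?X = "1\<^sub>m m + R * G0 * R + ?Q R"
    have dims: "R * G0 * R \<in> carrier_mat m m" "?Q R \<in> carrier_mat m m" using R(1) Gd Jd by auto
    have X: "cmat ?X \<in> carrier_mat m m" using dims by (simp only: map_carrier_mat add_carrier_mat)
    have Rd: "dim_row R = m" "dim_col R = m" using R(1) by auto
    have Xv: "rv ?X v = v + rv R (mv S (rv R v))" if "supp m v" for v
    proof -
      have "rv ?X v = v + (rv (R * G0 * R) v + rv (?Q R) v)"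
        using that by (simp add: Rd mv_cmat_add mv_cmat_one add.assoc)
      then show ?thesis unfolding Rv[OF R(1)] .
    qed
    have Rc: "cmat R \<in> carrier_mat m m" using R(1) by simp
    have RN: "rv R (rv R v) = - rv Nf v" for v by (simp add: R(3) mv_cmat_uminus)
    have "det (cmat ?X) \<noteq> 0"
      unfolding det_nonzero_iff[OF X] using stable_iff_neg(2)[OF Rc R(2) RN nondeg] by (simp add: Xv)
    then have "det ?X \<noteq> 0" using det_cmat by blast
    then show "internally_stable A B C D A' B' C' D' \<longleftrightarrow> neg_def ?Kf \<and> det ?X \<noteq> 0"
      unfolding stable_def neg using stable_iff_neg(1)[OF Rc R(2) RN nondeg] by simp
  qed
qed

end
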